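(* Every free amalgamation theory is either $\mathrm{NSOP}_1$ or $\mathrm{SOP}_3$.
   Context: A complete theory $T$ is a free amalgamation theory if there is a ternary relation $\perp$ between small sets over small sets (in a monster model) satisfying: Invariance: $A\perp_C B$ depends only on $\mathrm{tp}(ABC)$. Monotonicity: $A\perp_C B$, $A_0\subseteq A$, $B_0\subseteq B$ imply $A_0\perp_C B_0$. Full transitivity: if $D\subseteq C\subseteq B$ then $A\perp_D B$ iff ($A\perp_D C$ and $A\perp_C B$). Full existence: for any $a,B$ and algebraically closed $C$ there is $a'\equiv_C a$ with $a'\perp_C B$. Stationarity: for algebraically closed $a,b,C$ with $C\subseteq a\cap b$ and $a'\equiv_C a$, if $a\perp_C b$ and $a'\perp_C b$ then $a'\equiv_b a$. Freedom: if $A\perp_C B$ and $C\cap AB\subseteq D\subseteq C$ then $A\perp_D B$. Closure: for algebraically closed $a,b,C$ with $C\subseteq a\cap b$ and $a\perp_C b$, $ab$ is algebraically closed. $\mathrm{SOP}_1$: there are $\varphi(x,y)$ and $(b_\eta)_{\eta\in2^{<\omega}}$ with $\{\varphi(x,b_{\sigma|n})\}_n$ consistent for every $\sigma\in2^\omega$ and $\{\varphi(x,b_{\eta_2}),\varphi(x,b_{\eta_1\frown\langle1\rangle})\}$ inconsistent whenever $\eta_2\unrhd\eta_1\frown\langle0\rangle$; $\mathrm{NSOP}_1$ is its negation. $\mathrm{SOP}_3$: a definable $R(x_1,x_2)$ with no $3$-cycles and $(a_i)_{i<\omega}$ with $R(a_i,a_j)$ for $i<j$. *)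

theory Defs
  imports Main "HOL-Library.Sublist"
begin

unbundle cardinal_syntax

section \<open>First-order logic with equality\<close>

text \<open>The symbols of the language are those with a defined arity, so languages without function
  symbols, or without relation symbols, are covered although HOL types are nonempty.\<close>

record ('f, 'r) lang =
  fun_arity :: "'f \<Rightarrow> nat option"
  rel_arity :: "'r \<Rightarrow> nat option"

datatype 'f trm = Var nat | Fn 'f "'f trm list"

datatype ('f, 'r) fm =
    Eq "'f trm" "'f trm"
  | Rel 'r "'f trm list"
  | Neg "('f, 'r) fm"
  | Conj "('f, 'r) fm" "('f, 'r) fm"
  | Ex nat "('f, 'r) fm"

primrec fvt :: "'f trm \<Rightarrow> nat set" where
  "fvt (Var v) = {v}"
| "fvt (Fn f ts) = \<Union> (set (map fvt ts))"

primrec fv :: "('f, 'r) fm \<Rightarrow> nat set" where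
  "fv (Eq s t) = fvt s \<union> fvt t"
| "fv (Rel r ts) = (\<Union>t\<in>set ts. fvt t)"
| "fv (Neg \<phi>) = fv \<phi>"
| "fv (Conj \<phi> \<psi>) = fv \<phi> \<union> fv \<psi>"
| "fv (Ex v \<phi>) = fv \<phi> - {v}"

primrec wft :: "('f, 'r) lang \<Rightarrow> 'f trm \<Rightarrow> bool" where
  "wft L (Var v) = True"
| "wft L (Fn f ts) = (fun_arity L f = Some (length ts) \<and> list_all id (map (wft L) ts))"

primrec wff :: "('f, 'r) lang \<Rightarrow> ('f, 'r) fm \<Rightarrow> bool" where
  "wff L (Eq s t) = (wft L s \<and> wft L t)"
| "wff L (Rel r ts) = (rel_arity L r = Some (length ts) \<and> list_all (wft L) ts)"
| "wff L (Neg \<phi>) = wff L \<phi>"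
| "wff L (Conj \<phi> \<psi>) = (wff L \<phi> \<and> wff L \<psi>)"
| "wff L (Ex v \<phi>) = wff L \<phi>"

definition formulas :: "('f, 'r) lang \<Rightarrow> ('f, 'r) fm set" where
  "formulas L = {\<phi>. wff L \<phi>}"

definition sentences :: "('f, 'r) lang \<Rightarrow> ('f, 'r) fm set" where
  "sentences L = {\<phi> \<in> formulas L. fv \<phi> = {}}"

text \<open>The universe of a structure is the whole type \<open>'m\<close>.  The values of the interpretations at
  symbols outside the language, or at lists of the wrong length, are never used.\<close>

record ('f, 'r, 'm) struct =
  fun_interp :: "'f \<Rightarrow> 'm list \<Rightarrow> 'm"
  rel_interp :: "'r \<Rightarrow> 'm list \<Rightarrow> bool"

primrec eval :: "('f, 'r, 'm) struct \<Rightarrow> (nat \<Rightarrow> 'm) \<Rightarrow> 'f trm \<Rightarrow> 'm" where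
  "eval M e (Var v) = e v"
| "eval M e (Fn f ts) = fun_interp M f (map (eval M e) ts)"

primrec sat :: "('f, 'r, 'm) struct \<Rightarrow> (nat \<Rightarrow> 'm) \<Rightarrow> ('f, 'r) fm \<Rightarrow> bool" where
  "sat M e (Eq s t) = (eval M e s = eval M e t)"
| "sat M e (Rel r ts) = rel_interp M r (map (eval M e) ts)"
| "sat M e (Neg \<phi>) = (\<not> sat M e \<phi>)"
| "sat M e (Conj \<phi> \<psi>) = (sat M e \<phi> \<and> sat M e \<psi>)"
| "sat M e (Ex v \<phi>) = (\<exists>d. sat M (e(v := d)) \<phi>)"

definition models :: "('f, 'r, 'm) struct \<Rightarrow> ('f, 'r) fm set \<Rightarrow> bool" where
  "models M T \<longleftrightarrow> (\<forall>\<phi>\<in>T. \<forall>e. sat M e \<phi>)"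

text \<open>Theories are taken closed under consequence.  Consistency of \<open>T\<close> is not part of this
  definition; below, \<open>T\<close> always comes with a model.\<close>

definition complete_theory :: "('f, 'r) lang \<Rightarrow> ('f, 'r) fm set \<Rightarrow> bool" where
  "complete_theory L T \<longleftrightarrow>
     T \<subseteq> sentences L \<and> (\<forall>\<phi>\<in>sentences L. \<phi> \<in> T \<or> Neg \<phi> \<in> T)"


section \<open>Formulas with parameters, types, algebraic closure\<close>

text \<open>A formula over a parameter set \<open>B\<close> in variables \<open>x\<^sub>i\<close> for \<open>i \<in> I\<close> is a pair \<open>(\<phi>, e)\<close> where
  \<open>e\<close> substitutes for each free variable of \<open>\<phi>\<close> either a variable (\<open>Inl i\<close>) or a
  parameter (\<open>Inr b\<close>).\<close>

type_synonym ('f, 'r, 'i, 'm) pfm = "('f, 'r) fm \<times> (nat \<Rightarrow> 'i + 'm)"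

definition pformulas :: "('f, 'r) lang \<Rightarrow> 'i set \<Rightarrow> 'm set \<Rightarrow> ('f, 'r, 'i, 'm) pfm set" where
  "pformulas L I B = {(\<phi>, e). \<phi> \<in> formulas L \<and> (\<forall>v\<in>fv \<phi>. e v \<in> I <+> B)}"

definition psat :: "('f, 'r, 'm) struct \<Rightarrow> ('i \<Rightarrow> 'm) \<Rightarrow> ('f, 'r, 'i, 'm) pfm \<Rightarrow> bool" where
  "psat M a p \<longleftrightarrow> sat M (case_sum a id \<circ> snd p) (fst p)"

definition consistent :: "('f, 'r, 'm) struct \<Rightarrow> ('f, 'r, 'i, 'm) pfm set \<Rightarrow> bool" where
  "consistent M \<Sigma> \<longleftrightarrow> (\<forall>\<Sigma>0. finite \<Sigma>0 \<and> \<Sigma>0 \<subseteq> \<Sigma> \<longrightarrow> (\<exists>a. \<forall>p\<in>\<Sigma>0. psat M a p))"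

text \<open>\<open>tp L M a I B\<close> is the complete type over \<open>B\<close> of the tuple \<open>(a i)\<close>, \<open>i \<in> I\<close>.\<close>

definition tp :: "('f, 'r) lang \<Rightarrow> ('f, 'r, 'm) struct \<Rightarrow> ('i \<Rightarrow> 'm) \<Rightarrow> 'i set \<Rightarrow> 'm set \<Rightarrow>
    ('f, 'r, 'i, 'm) pfm set" where
  "tp L M a I B = {p \<in> pformulas L I B. psat M a p}"

definition acl :: "('f, 'r) lang \<Rightarrow> ('f, 'r, 'm) struct \<Rightarrow> 'm set \<Rightarrow> 'm set" where
  "acl L M B = {m. \<exists>p \<in> pformulas L {()} B.
     psat M (\<lambda>_. m) p \<and> finite {d. psat M (\<lambda>_. d) p}}"

definition alg_closed :: "('f, 'r) lang \<Rightarrow> ('f, 'r, 'm) struct \<Rightarrow> 'm set \<Rightarrow> bool" where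
  "alg_closed L M B \<longleftrightarrow> acl L M B = B"


section \<open>Monster models\<close>

definition small :: "'k rel \<Rightarrow> 'm set \<Rightarrow> bool" where
  "small \<kappa> A \<longleftrightarrow> |A| <o \<kappa>"

definition saturated :: "('f, 'r) lang \<Rightarrow> 'k rel \<Rightarrow> ('f, 'r, 'm) struct \<Rightarrow> bool" where
  "saturated L \<kappa> M \<longleftrightarrow>
     (\<forall>B \<Sigma>. small \<kappa> B \<and> \<Sigma> \<subseteq> pformulas L {()} B \<and> consistent M \<Sigma> \<longrightarrow>
        (\<exists>a. \<forall>p\<in>\<Sigma>. psat M a p))"

definition automorphism :: "('f, 'r) lang \<Rightarrow> ('f, 'r, 'm) struct \<Rightarrow> ('m \<Rightarrow> 'm) \<Rightarrow> bool" where
  "automorphism L M g \<longleftrightarrow> bij g \<and>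
     (\<forall>f ms. fun_arity L f = Some (length ms) \<longrightarrow>
        g (fun_interp M f ms) = fun_interp M f (map g ms)) \<and>
     (\<forall>r ms. rel_arity L r = Some (length ms) \<longrightarrow>
        rel_interp M r (map g ms) = rel_interp M r ms)"

text \<open>A set \<open>A\<close> is viewed as a tuple by enumerating it by itself, i.e. as the family \<open>id\<close> on the
  index set \<open>A\<close>.  A tuple of the same length is then a map \<open>f\<close> on \<open>A\<close>, and
  \<open>tp L M f A C = tp L M id A C\<close> says that \<open>f\<close> restricted to \<open>A\<close> enumerates a tuple
  \<open>a' \<equiv>\<^sub>C a\<close>.  For \<open>C = {}\<close> this means that \<open>f\<close> is a partial elementary map.\<close>

definition strongly_homogeneous ::
    "('f, 'r) lang \<Rightarrow> 'k rel \<Rightarrow> ('f, 'r, 'm) struct \<Rightarrow> bool" where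
  "strongly_homogeneous L \<kappa> M \<longleftrightarrow>
     (\<forall>A f. small \<kappa> A \<and> tp L M f A {} = tp L M id A {} \<longrightarrow>
        (\<exists>g. automorphism L M g \<and> (\<forall>a\<in>A. g a = f a)))"

text \<open>As there are infinitely many formulas, the bound on \<open>\<kappa>\<close> says that it is greater than the
  cardinality of the language and uncountable.\<close>

definition monster_model ::
    "('f, 'r) lang \<Rightarrow> ('f, 'r) fm set \<Rightarrow> 'k rel \<Rightarrow> ('f, 'r, 'm) struct \<Rightarrow> bool" where
  "monster_model L T \<kappa> M \<longleftrightarrow>
     models M T \<and> Card_order \<kappa> \<and> |formulas L| <o \<kappa> \<and>
     saturated L \<kappa> M \<and> strongly_homogeneous L \<kappa> M"


section \<open>Free amalgamation theories\<close>

text \<open>In all of the following, \<open>R A C B\<close> stands for \<open>A \<perp>\<^sub>C B\<close>; only its values at small sets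
  matter.\<close>

type_synonym 'm indep = "'m set \<Rightarrow> 'm set \<Rightarrow> 'm set \<Rightarrow> bool"

definition invariance ::
    "('f, 'r) lang \<Rightarrow> 'k rel \<Rightarrow> ('f, 'r, 'm) struct \<Rightarrow> 'm indep \<Rightarrow> bool" where
  "invariance L \<kappa> M R \<longleftrightarrow>
     (\<forall>A B C f. small \<kappa> A \<and> small \<kappa> B \<and> small \<kappa> C \<and>
        tp L M f (A \<union> B \<union> C) {} = tp L M id (A \<union> B \<union> C) {} \<longrightarrow>
        (R (f ` A) (f ` C) (f ` B) \<longleftrightarrow> R A C B))"

definition monotonicity :: "'k rel \<Rightarrow> 'm indep \<Rightarrow> bool" where
  "monotonicity \<kappa> R \<longleftrightarrow>
     (\<forall>A B C A\<^sub>0 B\<^sub>0. small \<kappa> A \<and> small \<kappa> B \<and> small \<kappa> C \<and>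
        R A C B \<and> A\<^sub>0 \<subseteq> A \<and> B\<^sub>0 \<subseteq> B \<longrightarrow> R A\<^sub>0 C B\<^sub>0)"

definition full_transitivity :: "'k rel \<Rightarrow> 'm indep \<Rightarrow> bool" where
  "full_transitivity \<kappa> R \<longleftrightarrow>
     (\<forall>A B C D. small \<kappa> A \<and> small \<kappa> B \<and> D \<subseteq> C \<and> C \<subseteq> B \<longrightarrow>
        (R A D B \<longleftrightarrow> R A D C \<and> R A C B))"

definition full_existence ::
    "('f, 'r) lang \<Rightarrow> 'k rel \<Rightarrow> ('f, 'r, 'm) struct \<Rightarrow> 'm indep \<Rightarrow> bool" where
  "full_existence L \<kappa> M R \<longleftrightarrow>
     (\<forall>A B C. small \<kappa> A \<and> small \<kappa> B \<and> small \<kappa> C \<and> alg_closed L M C \<longrightarrow>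
        (\<exists>f. tp L M f A C = tp L M id A C \<and> R (f ` A) C B))"

definition stationarity ::
    "('f, 'r) lang \<Rightarrow> 'k rel \<Rightarrow> ('f, 'r, 'm) struct \<Rightarrow> 'm indep \<Rightarrow> bool" where
  "stationarity L \<kappa> M R \<longleftrightarrow>
     (\<forall>A B C f. small \<kappa> A \<and> small \<kappa> B \<and> small \<kappa> C \<and>
        alg_closed L M A \<and> alg_closed L M B \<and> alg_closed L M C \<and> C \<subseteq> A \<inter> B \<and>
        tp L M f A C = tp L M id A C \<and> R A C B \<and> R (f ` A) C B \<longrightarrow>
        tp L M f A B = tp L M id A B)"

definition freedom :: "'k rel \<Rightarrow> 'm indep \<Rightarrow> bool" where
  "freedom \<kappa> R \<longleftrightarrow>
     (\<forall>A B C D. small \<kappa> A \<and> small \<kappa> B \<and> small \<kappa> C \<and>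
        R A C B \<and> C \<inter> (A \<union> B) \<subseteq> D \<and> D \<subseteq> C \<longrightarrow> R A D B)"

definition indep_closure ::
    "('f, 'r) lang \<Rightarrow> 'k rel \<Rightarrow> ('f, 'r, 'm) struct \<Rightarrow> 'm indep \<Rightarrow> bool" where
  "indep_closure L \<kappa> M R \<longleftrightarrow>
     (\<forall>A B C. small \<kappa> A \<and> small \<kappa> B \<and> small \<kappa> C \<and>
        alg_closed L M A \<and> alg_closed L M B \<and> alg_closed L M C \<and> C \<subseteq> A \<inter> B \<and>
        R A C B \<longrightarrow> alg_closed L M (A \<union> B))"

text \<open>\<open>M\<close> is the monster model of \<open>T\<close> in which the independence relation lives.\<close>

definition free_amalgamation_theory ::
    "('f, 'r) lang \<Rightarrow> ('f, 'r) fm set \<Rightarrow> 'k rel \<Rightarrow> ('f, 'r, 'm) struct \<Rightarrow> bool" where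
  "free_amalgamation_theory L T \<kappa> M \<longleftrightarrow> complete_theory L T \<and>
     (\<exists>R. invariance L \<kappa> M R \<and> monotonicity \<kappa> R \<and> full_transitivity \<kappa> R \<and>
        full_existence L \<kappa> M R \<and> stationarity L \<kappa> M R \<and> freedom \<kappa> R \<and>
        indep_closure L \<kappa> M R)"


section \<open>The properties SOP1 and SOP3\<close>

text \<open>For \<open>\<phi>(x,y)\<close> with \<open>x\<close> the variables \<open>0, \<dots>, k - 1\<close> and \<open>y\<close> the variables
  \<open>k, \<dots>, k + l - 1\<close>, and for an \<open>l\<close>-tuple \<open>b\<close>, \<open>subst_params k \<phi> b\<close> is \<open>\<phi>(x,b)\<close>.\<close>

definition subst_params :: "nat \<Rightarrow> ('f, 'r) fm \<Rightarrow> 'm list \<Rightarrow> ('f, 'r, nat, 'm) pfm" where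
  "subst_params k \<phi> b = (\<phi>, \<lambda>v. if v < k then Inl v else Inr (b ! (v - k)))"

definition SOP1 :: "('f, 'r) lang \<Rightarrow> ('f, 'r, 'm) struct \<Rightarrow> bool" where
  "SOP1 L M \<longleftrightarrow>
     (\<exists>\<phi> \<in> formulas L. \<exists>k l. \<exists>b :: bool list \<Rightarrow> 'm list.
        fv \<phi> \<subseteq> {..<k + l} \<and> (\<forall>\<eta>. length (b \<eta>) = l) \<and>
        (\<forall>\<sigma> :: nat \<Rightarrow> bool. consistent M {subst_params k \<phi> (b (map \<sigma> [0..<n])) | n. True}) \<and>
        (\<forall>\<eta>1 \<eta>2. prefix (\<eta>1 @ [False]) \<eta>2 \<longrightarrow>
           \<not> consistent M {subst_params k \<phi> (b \<eta>2), subst_params k \<phi> (b (\<eta>1 @ [True]))}))"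

definition NSOP1 :: "('f, 'r) lang \<Rightarrow> ('f, 'r, 'm) struct \<Rightarrow> bool" where
  "NSOP1 L M \<longleftrightarrow> \<not> SOP1 L M"

text \<open>\<open>holds2 M k \<phi> a b\<close> is \<open>\<phi>(a,b)\<close>, for \<open>k\<close>-tuples \<open>a\<close> and \<open>b\<close>.\<close>

definition holds2 :: "('f, 'r, 'm) struct \<Rightarrow> nat \<Rightarrow> ('f, 'r) fm \<Rightarrow> 'm list \<Rightarrow> 'm list \<Rightarrow> bool" where
  "holds2 M k \<phi> a b \<longleftrightarrow> sat M (\<lambda>v. if v < k then a ! v else b ! (v - k)) \<phi>"

definition SOP3 :: "('f, 'r) lang \<Rightarrow> ('f, 'r, 'm) struct \<Rightarrow> bool" where
  "SOP3 L M \<longleftrightarrow>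
     (\<exists>\<phi> \<in> formulas L. \<exists>k. fv \<phi> \<subseteq> {..<k + k} \<and>
        \<not> (\<exists>a1 a2 a3. length a1 = k \<and> length a2 = k \<and> length a3 = k \<and>
              holds2 M k \<phi> a1 a2 \<and> holds2 M k \<phi> a2 a3 \<and> holds2 M k \<phi> a3 a1) \<and>
        (\<exists>a :: nat \<Rightarrow> 'm list. (\<forall>i. length (a i) = k) \<and>
              (\<forall>i j. i < j \<longrightarrow> holds2 M k \<phi> (a i) (a j))))"

end

theory Submission
  imports Defs "HOL-Library.Countable" HOL.Filter
begin

text \<open>Let \<open>\<phi>\<close> witness SOP1.  By compactness and the pigeonhole principle, the tree yields pairs
  \<open>(c\<^sub>i, c'\<^sub>i)\<close> such that \<open>c\<^sub>i\<close> and \<open>c'\<^sub>i\<close> have the same type over the algebraic closure of the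
  previous pairs, all \<open>\<phi>(x, c\<^sub>i)\<close> have a common solution \<open>a\<close>, and \<open>\<phi>(x, c'\<^sub>i)\<close> is inconsistent
  with \<open>\<phi>(x, c\<^sub>j)\<close> for \<open>i < j\<close>.  Limits of the two sequences are tuples \<open>b \<equiv>\<^sub>C b'\<close>, where \<open>C\<close> is
  the algebraic closure of all pairs, with \<open>\<phi>(a, b)\<close> and \<open>\<phi>(x, b) \<and> \<phi>(x, b')\<close> inconsistent;
  finite satisfiability in \<open>C\<close> makes \<open>acl(Cb)\<close> meet both \<open>acl(Ca)\<close> and \<open>acl(Cb')\<close> in \<open>C\<close> only.

  If \<open>P\<close> and \<open>B\<close> are closed and \<open>P \<inter> B = C\<close>, then copies of \<open>B\<close> taken free over \<open>P\<close> are free over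
  \<open>C\<close>, by freedom.  By stationarity and closure, sequences of copies of \<open>B\<close> free over \<open>C\<close> are
  conjugate.  For \<open>P = acl(Ca)\<close> this shows that \<open>\<phi>(x, \<cdot>)\<close> is consistent along every free
  sequence of conjugates of \<open>b\<close>.  For \<open>P = B = acl(Cb)\<close> and copies of \<open>acl(Cb')\<close> it produces
  conjugates \<open>u\<^sub>i, v\<^sub>i\<close> of \<open>b\<close> such that \<open>u\<^sub>0, \<dots>, u\<^sub>j, v\<^sub>j, v\<^sub>j\<^sub>+\<^sub>1, \<dots>\<close> is free for every \<open>j\<close>, while
  \<open>(u\<^sub>i, v\<^sub>k) \<equiv> (b, b')\<close> for \<open>k < i\<close>.  With \<open>w\<^sub>j\<close> a solution of \<open>\<phi>\<close> along the \<open>j\<close>-th free sequence,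
  the triples \<open>(u\<^sub>j, v\<^sub>j, w\<^sub>j)\<close> witness SOP3.\<close>

section \<open>Definable predicates\<close>

lemma finite_fvt: "finite (fvt t)"
  by (induction t) auto

lemma finite_fv [simp]: "finite (fv \<phi>)"
  by (induction \<phi>) (auto simp: finite_fvt)

lemma eval_cong: "(\<And>v. v \<in> fvt t \<Longrightarrow> e v = e' v) \<Longrightarrow> eval M e t = eval M e' t"
proof (induction t)
  case (Fn f ts)
  have "map (eval M e) ts = map (eval M e') ts"
    using Fn by (intro map_cong refl Fn.IH) auto
  then show ?case by (simp only: eval.simps)
qed simp

lemma sat_cong: "(\<And>v. v \<in> fv \<phi> \<Longrightarrow> e v = e' v) \<Longrightarrow> sat M e \<phi> = sat M e' \<phi>"
proof (induction \<phi> arbitrary: e e')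
  case (Eq s t)
  then show ?case using eval_cong[of s e e' M] eval_cong[of t e e' M] by auto
next
  case (Rel r ts)
  have "map (eval M e) ts = map (eval M e') ts"
    using Rel by (intro map_cong refl eval_cong) auto
  then show ?case by (simp only: sat.simps)
next
  case (Conj \<phi> \<psi>)
  then show ?case by (metis UnCI fv.simps(4) sat.simps(4))
next
  case (Ex v \<phi>)
  have "sat M (e(v := d)) \<phi> = sat M (e'(v := d)) \<phi>" for d
    using Ex.prems by (intro Ex.IH) auto
  then show ?case by simp
next
  case (Neg \<phi>)
  have "sat M e \<phi> = sat M e' \<phi>" using Neg.prems by (intro Neg.IH) simp
  then show ?case by simp
qed

text \<open>Renaming is done by quantifying, \<open>Ex v (v = \<rho> v \<and> \<chi>)\<close>, one
  variable at a time; the equation stands outside \<open>\<chi>\<close>, so nothing can be captured.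
  No target \<open>\<rho> v\<close> is itself renamed, which keeps the steps from
  interfering.\<close>

lemma substitution_formula:
  assumes "finite V" "wff L \<phi>" "V \<inter> \<rho> ` V = {}"
  shows "\<exists>\<chi>. wff L \<chi> \<and> fv \<chi> \<subseteq> (fv \<phi> - V) \<union> \<rho> ` V \<and>
     (\<forall>e. sat M e \<chi> = sat M (\<lambda>v. if v \<in> V then e (\<rho> v) else e v) \<phi>)"
  using assms(1,3)
proof (induction V rule: finite_induct)
  case empty
  then show ?case using assms(2) by auto
next
  case (insert v V)
  then obtain \<chi> where \<chi>: "wff L \<chi>" "fv \<chi> \<subseteq> (fv \<phi> - V) \<union> \<rho> ` V"
    and s: "\<And>e. sat M e \<chi> = sat M (\<lambda>v. if v \<in> V then e (\<rho> v) else e v) \<phi>"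
    by auto
  define \<chi>' where "\<chi>' = Ex v (Conj (Eq (Var v) (Var (\<rho> v))) \<chi>)"
  have ne: "\<rho> v \<noteq> v" "\<And>x. x \<in> V \<Longrightarrow> \<rho> x \<noteq> v"
    using insert.prems by auto
  have "sat M e \<chi>' = sat M (\<lambda>x. if x \<in> insert v V then e (\<rho> x) else e x) \<phi>" for e
  proof -
    have "sat M e \<chi>' = sat M (e(v := e (\<rho> v))) \<chi>"
      using ne(1) by (auto simp: \<chi>'_def)
    also have "\<dots> = sat M (\<lambda>x. if x \<in> insert v V then e (\<rho> x) else e x) \<phi>"
      unfolding s using ne insert.hyps(2) by (intro sat_cong) auto
    finally show ?thesis .
  qed
  moreover have "wff L \<chi>'" "fv \<chi>' \<subseteq> (fv \<phi> - insert v V) \<union> \<rho> ` insert v V"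
    using \<chi> ne by (auto simp: \<chi>'_def)
  ultimately show ?case by blast
qed

locale lstruct =
  fixes L :: "('f, 'r) lang" and M :: "('f, 'r, 'm) struct"
begin

text \<open>Working with definable predicates on assignments instead of formulas hides the bookkeeping
  of variables: conjunction, reindexing and projection become closure properties.\<close>

definition dfn :: "'m set \<Rightarrow> (('i \<Rightarrow> 'm) \<Rightarrow> bool) \<Rightarrow> bool" where
  "dfn B P \<longleftrightarrow> (\<exists>\<phi> e. wff L \<phi> \<and> (\<forall>v\<in>fv \<phi>. e v \<in> UNIV <+> B) \<and>
     (\<forall>a. P a \<longleftrightarrow> sat M (case_sum a id \<circ> e) \<phi>))"

section \<open>Closure properties of definable predicates\<close>

lemma dfnI:
  assumes "wff L \<phi>" "\<And>v. v \<in> fv \<phi> \<Longrightarrow> e v \<in> UNIV <+> B" "\<And>a. P a \<longleftrightarrow> sat M (case_sum a id \<circ> e) \<phi>"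
  shows "dfn B P"
  using assms unfolding dfn_def by blast

lemma dfn_pformula: "dfn B P \<longleftrightarrow> (\<exists>p \<in> pformulas L UNIV B. \<forall>a. P a \<longleftrightarrow> psat M a p)"
  by (force simp: dfn_def pformulas_def psat_def formulas_def)

lemma dfn_mono:
  assumes "dfn B P" "B \<subseteq> B'"
  shows "dfn B' P"
proof -
  have "UNIV <+> B \<subseteq> UNIV <+> B'" using assms(2) by auto
  then show ?thesis using assms(1) unfolding dfn_def by (meson subsetD)
qed

lemma dfn_neg: assumes "dfn B P" shows "dfn B (\<lambda>a. \<not> P a)"
proof -
  obtain \<phi> e where "wff L \<phi>" "\<forall>v\<in>fv \<phi>. e v \<in> UNIV <+> B"
    "\<forall>a. P a \<longleftrightarrow> sat M (case_sum a id \<circ> e) \<phi>"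
    using assms unfolding dfn_def by blast
  then show ?thesis by (intro dfnI[of "Neg \<phi>" e]) auto
qed

text \<open>The two formulas come with different substitutions \<open>e\<close> and
  \<open>e'\<close>, so the free variables of \<open>\<psi>\<close> are first shifted past all those
  in use; then the single \<open>e''\<close> serves both.\<close>

lemma dfn_conj: assumes "dfn B P" "dfn B Q" shows "dfn B (\<lambda>a. P a \<and> Q a)"
proof -
  obtain \<phi> e where \<phi>: "wff L \<phi>" "\<forall>v\<in>fv \<phi>. e v \<in> UNIV <+> B"
    "\<forall>a. P a \<longleftrightarrow> sat M (case_sum a id \<circ> e) \<phi>"
    using assms unfolding dfn_def by blast
  obtain \<psi> e' where \<psi>: "wff L \<psi>" "\<forall>v\<in>fv \<psi>. e' v \<in> UNIV <+> B"
    "\<forall>a. Q a \<longleftrightarrow> sat M (case_sum a id \<circ> e') \<psi>"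
    using assms unfolding dfn_def by blast
  obtain N where N: "\<And>v. v \<in> fv \<phi> \<union> fv \<psi> \<Longrightarrow> v < N"
    using finite_nat_set_iff_bounded[of "fv \<phi> \<union> fv \<psi>"] by auto
  have "v + N \<notin> fv \<psi>" for v
    using N[of "v + N"] by auto
  then have "fv \<psi> \<inter> (\<lambda>v. v + N) ` fv \<psi> = {}"
    by blast
  then obtain \<chi> where \<chi>: "wff L \<chi>" "fv \<chi> \<subseteq> (\<lambda>v. v + N) ` fv \<psi>"
    and s: "\<And>e. sat M e \<chi> = sat M (\<lambda>v. if v \<in> fv \<psi> then e (v + N) else e v) \<psi>"
    using substitution_formula[OF finite_fv[of \<psi>] \<psi>(1), where \<rho> = "\<lambda>v. v + N" and M = M] by auto
  define e'' where "e'' v = (if v < N then e v else e' (v - N))" for v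
  show ?thesis
  proof (rule dfnI[of "Conj \<phi> \<chi>" e''])
    show "wff L (Conj \<phi> \<chi>)" using \<phi> \<chi> by simp
  next
    fix v assume "v \<in> fv (Conj \<phi> \<chi>)"
    then consider "v \<in> fv \<phi>" | u where "v = u + N" "u \<in> fv \<psi>"
      using \<chi>(2) by auto
    then show "e'' v \<in> UNIV <+> B"
    proof cases
      case 1
      then have "v < N" using N by blast
      then show ?thesis using \<phi>(2) 1 by (simp add: e''_def)
    next
      case 2
      then show ?thesis using \<psi>(2) unfolding e''_def by simp
    qed
  next
    fix a
    have "sat M (case_sum a id \<circ> e'') \<phi> = sat M (case_sum a id \<circ> e) \<phi>"
      using N by (intro sat_cong) (auto simp: e''_def)
    moreover have "sat M (case_sum a id \<circ> e'') \<chi> = sat M (case_sum a id \<circ> e') \<psi>"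
        unfolding s by (intro sat_cong) (auto simp: e''_def)
    ultimately show "(P a \<and> Q a) \<longleftrightarrow> sat M (case_sum a id \<circ> e'') (Conj \<phi> \<chi>)"
      using \<phi> \<psi> by simp
  qed
qed

lemma dfn_imp: "dfn B P \<Longrightarrow> dfn B Q \<Longrightarrow> dfn B (\<lambda>a. P a \<longrightarrow> Q a)"
  using dfn_neg[OF dfn_conj[OF _ dfn_neg], of B P Q] by simp

lemma dfn_iff: "dfn B P \<Longrightarrow> dfn B Q \<Longrightarrow> dfn B (\<lambda>a. P a = Q a)"
  using dfn_conj[OF dfn_imp[of B P Q] dfn_imp[of B Q P]] by (auto simp: iff_conv_conj_imp)

lemma dfn_eq: "dfn B (\<lambda>a. a i = a j)"
  by (rule dfnI[of "Eq (Var 0) (Var 1)" "\<lambda>v. if v = 0 then Inl i else Inl j"]) auto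

lemma dfn_eq_param: "b \<in> B \<Longrightarrow> dfn B (\<lambda>a. a i = b)"
  by (rule dfnI[of "Eq (Var 0) (Var 1)" "\<lambda>v. if v = 0 then Inl i else Inr b"]) auto

lemma dfn_True: "dfn B (\<lambda>a. True)"
  using dfn_eq[of B undefined undefined] by simp

lemma dfn_all_finite:
  assumes "finite X" "\<And>x. x \<in> X \<Longrightarrow> dfn B (P x)"
  shows "dfn B (\<lambda>a. \<forall>x\<in>X. P x a)"
  using assms
proof (induction X rule: finite_induct)
  case empty then show ?case by (simp add: dfn_True)
next
  case (insert x X)
  then show ?case using dfn_conj[of B "P x" "\<lambda>a. \<forall>x\<in>X. P x a"] by simp
qed

lemma dfn_param:
  assumes "dfn B P" "B \<subseteq> B'" "\<And>i. h i \<in> UNIV <+> B'"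
  shows "dfn B' (\<lambda>a. P (\<lambda>i. case_sum a id (h i)))"
proof -
  obtain \<phi> e where \<phi>: "wff L \<phi>" "\<forall>v\<in>fv \<phi>. e v \<in> UNIV <+> B"
    "\<forall>a. P a \<longleftrightarrow> sat M (case_sum a id \<circ> e) \<phi>"
    using assms unfolding dfn_def by blast
  show ?thesis
  proof (rule dfnI[of \<phi> "\<lambda>v. case e v of Inl i \<Rightarrow> h i | Inr b \<Rightarrow> Inr b"])
    fix v assume "v \<in> fv \<phi>"
    then have "e v \<in> UNIV <+> B" using \<phi>(2) by blast
    then show "(case e v of Inl i \<Rightarrow> h i | Inr b \<Rightarrow> Inr b) \<in> UNIV <+> B'"
      using assms(2,3) by (cases "e v") auto
  next
    fix a
    show "P (\<lambda>i. case_sum a id (h i)) \<longleftrightarrow>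
        sat M (case_sum a id \<circ> (\<lambda>v. case e v of Inl i \<Rightarrow> h i | Inr b \<Rightarrow> Inr b)) \<phi>"
      unfolding \<phi>(3)[rule_format] by (intro sat_cong) (auto split: sum.splits)
  qed (rule \<phi>)
qed

lemma dfn_reindex: "dfn B P \<Longrightarrow> dfn B (\<lambda>a. P (\<lambda>i. a (r i)))"
  using dfn_param[of B P B "\<lambda>i. Inl (r i)"] by auto

lemma dfn_ex1: assumes "dfn B P" shows "dfn B (\<lambda>a. \<exists>d. P (a(i := d)))"
proof -
  obtain \<phi> e where \<phi>: "wff L \<phi>" "\<forall>v\<in>fv \<phi>. e v \<in> UNIV <+> B"
    "\<forall>a. P a \<longleftrightarrow> sat M (case_sum a id \<circ> e) \<phi>"
    using assms unfolding dfn_def by blast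
  \<comment> \<open>Several variables of \<open>\<phi>\<close> may stand for the coordinate
    \<open>i\<close>; they are merged into one fresh \<open>w\<close>, which can then be
    quantified.\<close>
  define V where "V = {v \<in> fv \<phi>. e v = Inl i}"
  obtain w where w: "w \<notin> fv \<phi>"
    using finite_fv ex_new_if_finite infinite_UNIV_nat by blast
  have "finite V" "V \<inter> (\<lambda>_. w) ` V = {}" using w by (auto simp: V_def)
  then obtain \<chi> where \<chi>: "wff L \<chi>" "fv \<chi> \<subseteq> (fv \<phi> - V) \<union> (\<lambda>_. w) ` V"
    and s: "\<And>e. sat M e \<chi> = sat M (\<lambda>v. if v \<in> V then e w else e v) \<phi>"
    using substitution_formula[OF _ \<phi>(1), where V = V and \<rho> = "\<lambda>_. w" and M = M] by auto
  show ?thesis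
  proof (rule dfnI[of "Ex w \<chi>" e])
    fix a
    have "sat M (case_sum (a(i := d)) id \<circ> e) \<phi> = sat M ((case_sum a id \<circ> e)(w := d)) \<chi>" for d
      unfolding s using w by (intro sat_cong) (auto simp: V_def split: sum.splits)
    then show "(\<exists>d. P (a(i := d))) \<longleftrightarrow> sat M (case_sum a id \<circ> e) (Ex w \<chi>)"
      using \<phi>(3) by simp
  next
    fix v assume "v \<in> fv (Ex w \<chi>)"
    then have "v \<in> fv \<phi>" using \<chi>(2) by auto
    then show "e v \<in> UNIV <+> B" using \<phi>(2) by blast
  qed (simp add: \<chi>)
qed

lemma dfn_support:
  assumes "dfn B P"
  shows "\<exists>S. finite S \<and> (\<forall>a b. (\<forall>i\<in>S. a i = b i) \<longrightarrow> P a = P b)"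
proof -
  obtain \<phi> e where \<phi>: "\<forall>a. P a \<longleftrightarrow> sat M (case_sum a id \<circ> e) \<phi>"
    using assms unfolding dfn_def by blast
  have "P a = P b" if "\<forall>i\<in>{i. \<exists>v\<in>fv \<phi>. e v = Inl i}. a i = b i" for a b
    unfolding \<phi>[rule_format] using that by (intro sat_cong) (auto split: sum.splits)
  moreover have "{i. \<exists>v\<in>fv \<phi>. e v = Inl i} \<subseteq> projl ` e ` fv \<phi>" by force
  then have "finite {i. \<exists>v\<in>fv \<phi>. e v = Inl i}" by (rule finite_subset) simp
  ultimately show ?thesis by blast
qed

lemma dfn_finite_params:
  assumes "dfn B P"
  shows "\<exists>B0. finite B0 \<and> B0 \<subseteq> B \<and> dfn B0 P"
proof -
  obtain \<phi> e where \<phi>: "wff L \<phi>" "\<forall>v\<in>fv \<phi>. e v \<in> UNIV <+> B"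
    "\<forall>a. P a \<longleftrightarrow> sat M (case_sum a id \<circ> e) \<phi>"
    using assms unfolding dfn_def by blast
  let ?B = "{b. \<exists>v\<in>fv \<phi>. e v = Inr b}"
  have "?B \<subseteq> projr ` e ` fv \<phi>" by force
  then have "finite ?B" by (rule finite_subset) simp
  moreover have "?B \<subseteq> B" using \<phi>(2) by force
  moreover have "dfn ?B P"
  proof (rule dfnI[of \<phi> e])
    fix v assume "v \<in> fv \<phi>"
    then show "e v \<in> UNIV <+> ?B" using \<phi>(2) by (cases "e v") auto
  qed (use \<phi> in auto)
  ultimately show ?thesis by blast
qed

lemma dfn_ex_finite:
  assumes "dfn B P" "finite F"
  shows "dfn B (\<lambda>a. \<exists>t. (\<forall>i. i \<notin> F \<longrightarrow> t i = a i) \<and> P t)"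
  using assms(2)
proof (induction F rule: finite_induct)
  case empty
  have "(\<exists>t. (\<forall>i. i \<notin> {} \<longrightarrow> t i = a i) \<and> P t) = P a" for a by (auto simp: fun_eq_iff[symmetric])
  then show ?case using assms(1) by simp
next
  case (insert j F)
  have "(\<exists>d t. (\<forall>i. i \<notin> F \<longrightarrow> t i = (a(j := d)) i) \<and> P t) \<longleftrightarrow>
     (\<exists>t. (\<forall>i. i \<notin> insert j F \<longrightarrow> t i = a i) \<and> P t)" for a
  proof
    assume "\<exists>t. (\<forall>i. i \<notin> insert j F \<longrightarrow> t i = a i) \<and> P t"
    then obtain t where "\<forall>i. i \<notin> insert j F \<longrightarrow> t i = a i" "P t" by blast
    then show "\<exists>d t. (\<forall>i. i \<notin> F \<longrightarrow> t i = (a(j := d)) i) \<and> P t"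
      by (intro exI[of _ "t j"] exI[of _ t]) auto
  next
    assume "\<exists>d t. (\<forall>i. i \<notin> F \<longrightarrow> t i = (a(j := d)) i) \<and> P t"
    then obtain d t where "\<forall>i. i \<notin> F \<longrightarrow> t i = (a(j := d)) i" "P t" by blast
    then show "\<exists>t. (\<forall>i. i \<notin> insert j F \<longrightarrow> t i = a i) \<and> P t"
      by (intro exI[of _ t]) simp
  qed
  then show ?case using dfn_ex1[OF insert.IH, of j] by simp
qed

text \<open>Infinitely many coordinates may lie outside \<open>F\<close>, but only those in a finite
  support of \<open>P\<close> need a quantifier.\<close>

lemma dfn_project:
  assumes "dfn B P"
  shows "dfn B (\<lambda>a. \<exists>t. (\<forall>i\<in>F. t i = a i) \<and> P t)"
proof -
  obtain S where S: "finite S" "\<And>a b. (\<forall>i\<in>S. a i = b i) \<Longrightarrow> P a = P b"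
    using dfn_support[OF assms] by blast
  have "(\<exists>t. (\<forall>i. i \<notin> S - F \<longrightarrow> t i = a i) \<and> P t) \<longleftrightarrow> (\<exists>t. (\<forall>i\<in>F. t i = a i) \<and> P t)" for a
  proof
    assume "\<exists>t. (\<forall>i\<in>F. t i = a i) \<and> P t"
    then obtain t where t: "\<forall>i\<in>F. t i = a i" "P t" by blast
    then have "P (\<lambda>i. if i \<in> S - F then t i else a i)"
      using S(2)[of t "\<lambda>i. if i \<in> S - F then t i else a i"] by auto
    then show "\<exists>t. (\<forall>i. i \<notin> S - F \<longrightarrow> t i = a i) \<and> P t"
      by (intro exI[of _ "\<lambda>i. if i \<in> S - F then t i else a i"]) auto
  qed auto
  then show ?thesis using dfn_ex_finite[OF assms, of "S - F"] S(1) by simp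
qed

lemma dfn_ex:
  assumes "dfn B (P :: ('i + 'j \<Rightarrow> 'm) \<Rightarrow> bool)"
  shows "dfn B (\<lambda>s :: 'i \<Rightarrow> 'm. \<exists>x. P (case_sum s x))"
proof -
  \<comment> \<open>The coordinates \<open>Inr j\<close> are projected away, so any filler does;
    with \<open>s undefined\<close> the padded assignment is a reindexing of
    \<open>s\<close>.\<close>
  have "(\<exists>t. (\<forall>i\<in>range Inl. t i = case_sum s (\<lambda>_. s undefined) i) \<and> P t) \<longleftrightarrow>
      (\<exists>x. P (case_sum s x))" for s
  proof
    assume "\<exists>t. (\<forall>i\<in>range Inl. t i = case_sum s (\<lambda>_. s undefined) i) \<and> P t"
    then obtain t where t: "\<forall>i. t (Inl i) = s i" "P t" by auto
    then have "t = case_sum s (t \<circ> Inr)" by (auto split: sum.splits)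
    then show "\<exists>x. P (case_sum s x)" using t(2) by metis
  next
    assume "\<exists>x. P (case_sum s x)"
    then obtain x where "P (case_sum s x)" by blast
    then show "\<exists>t. (\<forall>i\<in>range Inl. t i = case_sum s (\<lambda>_. s undefined) i) \<and> P t"
      by (intro exI[of _ "case_sum s x"]) auto
  qed
  moreover have "case_sum s (\<lambda>_. s undefined) = (\<lambda>i. s (case_sum id (\<lambda>_. undefined) i))" for s :: "'i \<Rightarrow> 'm"
    by (auto split: sum.splits)
  ultimately show ?thesis
    using dfn_reindex[OF dfn_project[OF assms, of "range Inl"], of "case_sum id (\<lambda>_. undefined)"]
    by simp
qed

lemma dfn_all:
  assumes "dfn B (P :: ('i + 'j \<Rightarrow> 'm) \<Rightarrow> bool)"
  shows "dfn B (\<lambda>s :: 'i \<Rightarrow> 'm. \<forall>x. P (case_sum s x))"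
  using dfn_neg[OF dfn_ex[OF dfn_neg[OF assms]]] by simp

text \<open>Parameters listed by \<open>h\<close> become variables, so that the predicate can be
  evaluated at other tuples in their place. If \<open>h\<close> repeats a parameter,
  \<open>inv h\<close> picks one of its indices.\<close>

lemma dfn_abstract:
  assumes "dfn (B \<union> range h) (P :: ('i \<Rightarrow> 'm) \<Rightarrow> bool)"
  obtains G :: "('i + 'j \<Rightarrow> 'm) \<Rightarrow> bool" where "dfn B G" "\<And>a. P a = G (case_sum a h)"
proof -
  obtain \<phi> e where \<phi>: "wff L \<phi>" "\<forall>v\<in>fv \<phi>. e v \<in> UNIV <+> (B \<union> range h)"
    "\<forall>a. P a \<longleftrightarrow> sat M (case_sum a id \<circ> e) \<phi>"
    using assms unfolding dfn_def by blast
  define e' :: "nat \<Rightarrow> ('i + 'j) + 'm" where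
    "e' v = (case e v of Inl i \<Rightarrow> Inl (Inl i)
       | Inr b \<Rightarrow> if b \<in> range h then Inl (Inr (inv h b)) else Inr b)" for v
  have "dfn B (\<lambda>a. sat M (case_sum a id \<circ> e') \<phi>)"
  proof (rule dfnI[of \<phi> e'])
    fix v assume "v \<in> fv \<phi>"
    then have "e v \<in> UNIV <+> (B \<union> range h)" using \<phi>(2) by blast
    then show "e' v \<in> UNIV <+> B" by (auto simp: e'_def)
  qed (rule \<phi>, rule refl)
  moreover have "P a = sat M (case_sum (case_sum a h) id \<circ> e') \<phi>" for a
    unfolding \<phi>(3)[rule_format]
    by (rule sat_cong) (auto simp: e'_def f_inv_into_f split: sum.splits)
  ultimately show ?thesis using that by blast
qed

end

section \<open>Saturation, homogeneity and algebraic closure\<close>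

lemma automorphism_comp:
  assumes "automorphism L M g" "automorphism L M h"
  shows "automorphism L M (g \<circ> h)"
  using assms unfolding automorphism_def by (auto simp: bij_comp)
    (metis length_map list.map_comp)+

lemma automorphism_inv:
  assumes "automorphism L M g"
  shows "automorphism L M (inv g)"
proof -
  have b: "bij g" using assms by (simp add: automorphism_def)
  have m: "map g (map (inv g) ms) = ms" for ms
    using b by (simp add: bij_is_surj surj_f_inv_f map_idI)
  have "inv g (fun_interp M f ms) = fun_interp M f (map (inv g) ms)"
    if "fun_arity L f = Some (length ms)" for f ms
  proof -
    have "g (fun_interp M f (map (inv g) ms)) = fun_interp M f (map g (map (inv g) ms))"
      using assms that unfolding automorphism_def by (metis length_map)
    then have "g (fun_interp M f (map (inv g) ms)) = fun_interp M f ms"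
      unfolding m .
    then show ?thesis using b by (metis bij_inv_eq_iff)
  qed
  moreover have "rel_interp M r (map (inv g) ms) = rel_interp M r ms"
    if "rel_arity L r = Some (length ms)" for r ms
  proof -
    have "rel_interp M r (map g (map (inv g) ms)) = rel_interp M r (map (inv g) ms)"
      using assms that unfolding automorphism_def by (metis length_map)
    then show ?thesis unfolding m by simp
  qed
  ultimately show ?thesis using b by (auto simp: automorphism_def bij_imp_bij_inv)
qed

lemma eval_automorphism:
  assumes "automorphism L M g" "wft L t"
  shows "g (eval M e t) = eval M (g \<circ> e) t"
  using assms(2)
proof (induction t)
  case (Fn f ts)
  then have ar: "fun_arity L f = Some (length (map (eval M e) ts))"
    and w: "\<forall>t\<in>set ts. wft L t"
    by (auto simp: list_all_iff)
  have "g (fun_interp M f (map (eval M e) ts)) = fun_interp M f (map g (map (eval M e) ts))"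
    using assms(1) ar unfolding automorphism_def by blast
  also have "map g (map (eval M e) ts) = map (eval M (g \<circ> e)) ts"
    using Fn.IH w by (simp add: comp_def)
  finally show ?case by (simp only: eval.simps)
qed simp

lemma sat_automorphism:
  assumes "automorphism L M g" "wff L \<phi>"
  shows "sat M (g \<circ> e) \<phi> = sat M e \<phi>"
  using assms(2)
proof (induction \<phi> arbitrary: e)
  case (Eq s t)
  have "inj g" using assms(1) by (simp add: automorphism_def bij_is_inj)
  then show ?case
    using Eq eval_automorphism[OF assms(1), of s e] eval_automorphism[OF assms(1), of t e]
    by (metis inj_eq sat.simps(1) wff.simps(1))
next
  case (Rel r ts)
  then have ar: "rel_arity L r = Some (length (map (eval M e) ts))"
    and w: "\<forall>t\<in>set ts. wft L t"
    by (auto simp: list_all_iff)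
  have "map (eval M (g \<circ> e)) ts = map g (map (eval M e) ts)"
    using w eval_automorphism[OF assms(1)] by simp
  then show ?case
    using assms(1) ar unfolding automorphism_def by (metis sat.simps(2))
next
  case (Ex v \<phi>)
  have "surj g" using assms(1) by (simp add: automorphism_def bij_is_surj)
  then have "(\<exists>d. sat M ((g \<circ> e)(v := d)) \<phi>) \<longleftrightarrow> (\<exists>d. sat M ((g \<circ> e)(v := g d)) \<phi>)"
    by (metis surjD)
  also have "\<dots> \<longleftrightarrow> (\<exists>d. sat M (g \<circ> (e(v := d))) \<phi>)" by (simp add: fun_upd_comp)
  also have "\<dots> \<longleftrightarrow> (\<exists>d. sat M (e(v := d)) \<phi>)"
    using Ex.IH Ex.prems by (simp only: wff.simps)
  finally show ?case by (simp only: sat.simps)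
qed simp_all

context lstruct
begin

definition aut :: "'m set \<Rightarrow> ('m \<Rightarrow> 'm) set" where
  "aut C = {g. automorphism L M g \<and> (\<forall>c\<in>C. g c = c)}"

lemma aut_comp: "g \<in> aut C \<Longrightarrow> h \<in> aut C \<Longrightarrow> g \<circ> h \<in> aut C"
  by (auto simp: aut_def automorphism_comp)

lemma aut_bij: "g \<in> aut C \<Longrightarrow> bij g"
  by (auto simp: aut_def automorphism_def)

lemma aut_inj: "g \<in> aut C \<Longrightarrow> inj g"
  by (simp add: aut_bij bij_is_inj)

lemma aut_inv: "g \<in> aut C \<Longrightarrow> inv g \<in> aut C"
  using aut_inj by (fastforce simp: aut_def automorphism_inv inv_f_eq)

lemma aut_mono: "C \<subseteq> D \<Longrightarrow> aut D \<subseteq> aut C"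
  by (auto simp: aut_def)

lemma aut_id: "id \<in> aut C"
  by (auto simp: aut_def automorphism_def)

lemma aut_image: "g \<in> aut C \<Longrightarrow> B \<subseteq> C \<Longrightarrow> g ` B = B"
  by (force simp: aut_def)

lemma dfn_aut: assumes "dfn B P" "g \<in> aut B" shows "P (g \<circ> a) = P a"
proof -
  obtain \<phi> e where \<phi>: "wff L \<phi>" "\<forall>v\<in>fv \<phi>. e v \<in> UNIV <+> B"
    "\<forall>a. P a \<longleftrightarrow> sat M (case_sum a id \<circ> e) \<phi>"
    using assms unfolding dfn_def by blast
  have "(case_sum (g \<circ> a) id \<circ> e) v = (g \<circ> (case_sum a id \<circ> e)) v" if "v \<in> fv \<phi>" for v
  proof -
    have "e v \<in> UNIV <+> B" using that \<phi>(2) by blast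
    then show ?thesis using assms(2) by (cases "e v") (auto simp: aut_def)
  qed
  then have "P (g \<circ> a) = sat M (g \<circ> (case_sum a id \<circ> e)) \<phi>"
    unfolding \<phi>(3)[rule_format] by (rule sat_cong)
  also have "\<dots> = P a"
    using sat_automorphism[OF _ \<phi>(1)] assms(2) \<phi>(3) by (metis (no_types, lifting) aut_def mem_Collect_eq)
  finally show ?thesis .
qed

lemma dfn_image:
  assumes "dfn B P" "automorphism L M g"
  shows "dfn (g ` B) (\<lambda>a. P (inv g \<circ> a))"
proof -
  obtain \<phi> e where \<phi>: "wff L \<phi>" "\<forall>v\<in>fv \<phi>. e v \<in> UNIV <+> B"
    "\<forall>a. P a \<longleftrightarrow> sat M (case_sum a id \<circ> e) \<phi>"
    using assms unfolding dfn_def by blast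
  have b: "bij g" using assms(2) by (simp add: automorphism_def)
  show ?thesis
  proof (rule dfnI[of \<phi> "\<lambda>v. map_sum id g (e v)"])
    fix v assume "v \<in> fv \<phi>"
    then have "e v \<in> UNIV <+> B" using \<phi>(2) by blast
    then show "map_sum id g (e v) \<in> UNIV <+> g ` B" by auto
  next
    fix a
    have "inv g \<circ> (case_sum a id \<circ> (\<lambda>v. map_sum id g (e v))) = case_sum (inv g \<circ> a) id \<circ> e"
      using b by (auto simp: fun_eq_iff bij_is_inj map_sum_def split: sum.splits)
    then show "P (inv g \<circ> a) = sat M (case_sum a id \<circ> (\<lambda>v. map_sum id g (e v))) \<phi>"
      using sat_automorphism[OF automorphism_inv[OF assms(2)] \<phi>(1)] \<phi>(3) by metis
  qed (rule \<phi>)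
qed

text \<open>With \<open>Q\<close> saying that two entries differ, the negation bounds a number of
  solutions or of classes by \<open>N\<close> within a formula. All the \<open>y k\<close> are
  packed into one tuple, so that a single \<open>dfn_ex\<close> suffices.\<close>

lemma dfn_clique:
  assumes "dfn B (Q :: ('i + ('j + 'j) \<Rightarrow> 'm) \<Rightarrow> bool)"
  shows "dfn B (\<lambda>s :: 'i \<Rightarrow> 'm. \<exists>y :: nat \<Rightarrow> 'j \<Rightarrow> 'm. \<forall>k\<le>N. \<forall>l<k. Q (case_sum s (case_sum (y k) (y l))))"
proof -
  define \<rho> :: "nat \<times> nat \<Rightarrow> 'i + ('j + 'j) \<Rightarrow> 'i + nat \<times> 'j" where
    "\<rho> p = case_sum Inl (case_sum (\<lambda>r. Inr (fst p, r)) (\<lambda>r. Inr (snd p, r)))" for p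
  let ?X = "Sigma {..N} lessThan"
  have \<rho>: "(\<lambda>i. case_sum s z (\<rho> p i)) = case_sum s (case_sum (curry z (fst p)) (curry z (snd p)))"
    for s :: "'i \<Rightarrow> 'm" and z p
    by (auto simp: \<rho>_def fun_eq_iff split: sum.splits)
  have "dfn B (\<lambda>a. \<forall>p\<in>?X. Q (\<lambda>i. a (\<rho> p i)))"
    by (intro dfn_all_finite dfn_reindex[OF assms]) auto
  from dfn_ex[OF this]
  have "dfn B (\<lambda>s. \<exists>z. \<forall>k\<le>N. \<forall>l<k. Q (case_sum s (case_sum (curry z k) (curry z l))))"
    by (simp add: \<rho> Ball_def imp_conjL)
  moreover have "(\<exists>z. \<forall>k\<le>N. \<forall>l<k. Q (case_sum s (case_sum (curry z k) (curry z l)))) \<longleftrightarrow>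
     (\<exists>y. \<forall>k\<le>N. \<forall>l<k. Q (case_sum s (case_sum (y k) (y l))))" for s
    by (metis curry_case_prod)
  ultimately show ?thesis by simp
qed

section \<open>Algebraic closure by definable predicates in one variable\<close>

abbreviation dfn1 :: "'m set \<Rightarrow> ('m \<Rightarrow> bool) \<Rightarrow> bool" where
  "dfn1 B P \<equiv> dfn B (\<lambda>a :: unit \<Rightarrow> 'm. P (a ()))"

lemma acl_iff: "m \<in> acl L M B \<longleftrightarrow> (\<exists>P. dfn1 B P \<and> P m \<and> finite {d. P d})"
proof
  assume "m \<in> acl L M B"
  then obtain p where p: "p \<in> pformulas L {()} B" "psat M (\<lambda>_. m) p" "finite {d. psat M (\<lambda>_. d) p}"
    unfolding acl_def by auto
  have "dfn1 B (\<lambda>d. psat M (\<lambda>_. d) p)"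
    unfolding dfn_pformula
  proof (intro bexI allI)
    show "psat M (\<lambda>_. a ()) p = psat M a p" for a
      by (rule arg_cong[of _ _ "\<lambda>a. psat M a p"]) auto
  qed (use p in \<open>simp add: UNIV_unit\<close>)
  then show "\<exists>P. dfn1 B P \<and> P m \<and> finite {d. P d}"
    using p by (intro exI[of _ "\<lambda>d. psat M (\<lambda>_. d) p"]) simp
next
  assume "\<exists>P. dfn1 B P \<and> P m \<and> finite {d. P d}"
  then obtain P p where P: "P m" "finite {d. P d}" and
    p: "p \<in> pformulas L UNIV B" "\<And>a. P (a ()) = psat M a p"
    unfolding dfn_pformula by blast
  then have "psat M (\<lambda>_. d) p = P d" for d by metis
  then show "m \<in> acl L M B" using P p(1) unfolding acl_def UNIV_unit
    by (intro CollectI bexI[of _ p]) simp_all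
qed

lemma acl_extensive: "B \<subseteq> acl L M B"
proof
  fix b assume "b \<in> B"
  then have "dfn1 B (\<lambda>d. d = b)" by (rule dfn_eq_param)
  then show "b \<in> acl L M B" unfolding acl_iff by (intro exI[of _ "\<lambda>d. d = b"]) simp
qed

lemma acl_mono: "B \<subseteq> B' \<Longrightarrow> acl L M B \<subseteq> acl L M B'"
  unfolding subset_iff acl_iff using dfn_mono by (metis subset_iff)

lemma acl_image:
  assumes "automorphism L M g"
  shows "acl L M (g ` B) = g ` acl L M B"
proof -
  have le: "h ` acl L M B \<subseteq> acl L M (h ` B)" if h: "automorphism L M h" for h B
  proof (intro image_subsetI)
    fix m assume "m \<in> acl L M B"
    then obtain P where P: "dfn1 B P" "P m" "finite {d. P d}" unfolding acl_iff by blast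
    have b: "bij h" using h by (simp add: automorphism_def)
    have "dfn1 (h ` B) (\<lambda>d. P (inv h d))" using dfn_image[OF P(1) h] by simp
    moreover have "{d. P (inv h d)} \<subseteq> h ` {d. P d}"
      using b by (metis (mono_tags, lifting) bij_inv_eq_iff image_iff mem_Collect_eq subsetI)
    then have "finite {d. P (inv h d)}" using P(3) finite_surj by blast
    ultimately show "h m \<in> acl L M (h ` B)"
      unfolding acl_iff using P(2) b by (intro exI[of _ "\<lambda>d. P (inv h d)"]) (simp add: bij_is_inj)
  qed
  have b: "bij g" using assms by (simp add: automorphism_def)
  have "inv g ` acl L M (g ` B) \<subseteq> acl L M (inv g ` g ` B)"
    by (rule le[OF automorphism_inv[OF assms]])
  then have "inv g ` acl L M (g ` B) \<subseteq> acl L M B"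
    using b by (simp add: image_inv_f_f bij_is_inj)
  then have "g ` inv g ` acl L M (g ` B) \<subseteq> g ` acl L M B" by blast
  then have "acl L M (g ` B) \<subseteq> g ` acl L M B"
    using b by (simp add: image_f_inv_f bij_is_surj)
  then show ?thesis using le[OF assms] by blast
qed

lemma alg_closed_image: "automorphism L M g \<Longrightarrow> alg_closed L M B \<Longrightarrow> alg_closed L M (g ` B)"
  by (simp add: alg_closed_def acl_image)

lemma alg_closed_Int: "alg_closed L M A \<Longrightarrow> alg_closed L M B \<Longrightarrow> alg_closed L M (A \<inter> B)"
  using acl_mono[of "A \<inter> B" A] acl_mono[of "A \<inter> B" B] acl_extensive[of "A \<inter> B"]
  unfolding alg_closed_def by blast

lemma tp_eqI:
  assumes "g \<in> aut C" "\<And>a. a \<in> A \<Longrightarrow> f a = g a"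
  shows "tp L M f A C = tp L M id A C"
proof -
  have "psat M f p = psat M id p" if p: "p \<in> pformulas L A C" for p
  proof -
    obtain \<phi> e where pe: "p = (\<phi>, e)" "wff L \<phi>" "\<forall>v\<in>fv \<phi>. e v \<in> A <+> C"
      using p by (auto simp: pformulas_def formulas_def)
    have "(case_sum f id \<circ> e) v = (g \<circ> (case_sum id id \<circ> e)) v" if "v \<in> fv \<phi>" for v
    proof -
      have "e v \<in> A <+> C" using pe that by blast
      then show ?thesis using assms by (auto simp: aut_def)
    qed
    then have "psat M f p = sat M (g \<circ> (case_sum id id \<circ> e)) \<phi>"
      unfolding pe psat_def fst_conv snd_conv by (rule sat_cong)
    also have "\<dots> = sat M (case_sum id id \<circ> e) \<phi>"
      by (rule sat_automorphism[OF _ pe(2)]) (use assms(1) in \<open>simp add: aut_def\<close>)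
    finally show ?thesis by (simp only: psat_def pe fst_conv snd_conv)
  qed
  then show ?thesis unfolding tp_def by blast
qed

end

locale monster = lstruct L M for L :: "('f, 'r) lang" and M :: "('f, 'r, 'm) struct" +
  fixes T :: "('f, 'r) fm set" and \<kappa> :: "'k rel"
  assumes monster: "monster_model L T \<kappa> M"
begin

section \<open>Small sets\<close>

abbreviation sm :: "'m set \<Rightarrow> bool" where "sm \<equiv> small \<kappa>"

lemma Card_order: "Card_order \<kappa>"
  using monster by (simp add: monster_model_def)

lemma infinite_formulas: "infinite (formulas L)"
proof -
  define F :: "nat \<Rightarrow> ('f, 'r) fm" where "F n = Eq (Var n) (Var n)" for n
  have "inj F" by (auto simp: F_def inj_def)
  then have "infinite (range F)" using finite_imageD[of F UNIV] by auto
  moreover have "range F \<subseteq> formulas L" by (auto simp: F_def formulas_def)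
  ultimately show ?thesis using finite_subset by blast
qed

lemma nat_ordLess: "|UNIV :: nat set| <o \<kappa>"
proof -
  have "|UNIV :: nat set| \<le>o |formulas L|"
    using infinite_formulas infinite_iff_card_of_nat by blast
  then show ?thesis using monster ordLeq_ordLess_trans by (auto simp: monster_model_def)
qed

lemma infinite_Field: "infinite (Field \<kappa>)"
proof
  assume "finite (Field \<kappa>)"
  moreover have "|UNIV :: nat set| \<le>o |Field \<kappa>|"
    using nat_ordLess card_of_Field_ordIso[OF Card_order]
    by (meson ordIso_symmetric ordLess_imp_ordLeq ordLeq_ordIso_trans)
  ultimately show False using card_of_ordLeq_finite infinite_UNIV_nat by blast
qed

lemma small_subset: "sm B \<Longrightarrow> A \<subseteq> B \<Longrightarrow> sm A"
  unfolding small_def by (meson card_of_mono1 ordLeq_ordLess_trans)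

lemma small_Un: "sm A \<Longrightarrow> sm B \<Longrightarrow> sm (A \<union> B)"
  unfolding small_def using card_of_Un_ordLess_infinite_Field infinite_Field Card_order by blast

lemma small_image: "sm A \<Longrightarrow> sm (f ` A)"
  unfolding small_def by (meson card_of_image ordLeq_ordLess_trans)

lemma small_range: "sm (range (h :: 'i :: countable \<Rightarrow> 'm))"
proof -
  have "|range h| \<le>o |UNIV :: 'i set|" by (rule card_of_image)
  also have "|UNIV :: 'i set| \<le>o |UNIV :: nat set|"
    by (rule card_of_ordLeqI[of to_nat]) auto
  also note nat_ordLess
  finally show ?thesis by (simp add: small_def)
qed

lemma small_finite: "finite A \<Longrightarrow> sm A"
  by (metis finite_imp_nat_seg_image_inj_on small_image small_range small_subset image_mono top_greatest)

lemma small_UN: "finite I \<Longrightarrow> (\<And>i. i \<in> I \<Longrightarrow> sm (A i)) \<Longrightarrow> sm (\<Union>i\<in>I. A i)"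
  by (induction I rule: finite_induct) (auto intro: small_Un small_finite)

section \<open>Cardinality of the algebraic closure of a small set\<close>

lemma card_lists_length:
  assumes "infinite (Z :: 'z set)"
  shows "|{xs. set xs \<subseteq> Z \<and> length xs = n}| \<le>o |Z|"
proof (induction n)
  case 0
  have "{xs. set xs \<subseteq> Z \<and> length xs = 0} = {[]}" by auto
  then show ?case using assms by (metis card_of_singl_ordLeq finite.emptyI)
next
  case (Suc n)
  have "{xs. set xs \<subseteq> Z \<and> length xs = Suc n} \<subseteq>
      (\<lambda>(x, xs). x # xs) ` (Z \<times> {xs. set xs \<subseteq> Z \<and> length xs = n})"
    by (auto simp: length_Suc_conv image_iff)
  then have "|{xs. set xs \<subseteq> Z \<and> length xs = Suc n}| \<le>o |Z \<times> {xs. set xs \<subseteq> Z \<and> length xs = n}|"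
    by (meson card_of_image card_of_mono1 ordLeq_transitive)
  also have "|Z \<times> {xs. set xs \<subseteq> Z \<and> length xs = n}| \<le>o |Z|"
    by (rule card_of_Sigma_ordLeq_infinite[OF assms]) (use Suc in \<open>simp_all add: card_of_mono1\<close>)
  finally show ?case .
qed

lemma card_lists:
  assumes "infinite (Z :: 'z set)"
  shows "|{xs. set xs \<subseteq> Z}| \<le>o |Z|"
proof -
  have "{xs. set xs \<subseteq> Z} = (\<Union>n\<in>(UNIV :: nat set). {xs. set xs \<subseteq> Z \<and> length xs = n})" by auto
  moreover have "|\<Union>n\<in>(UNIV :: nat set). {xs. set xs \<subseteq> Z \<and> length xs = n}| \<le>o |Z|"
    using assms card_lists_length[OF assms] infinite_iff_card_of_nat
    by (intro card_of_UNION_ordLeq_infinite) auto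
  ultimately show ?thesis by simp
qed

text \<open>An algebraic element lies in a finite solution set named by a formula and finitely many
  parameters, and there are no more such names than elements of
  \<open>formulas L <+> B\<close>.\<close>

lemma small_acl:
  assumes "sm B"
  shows "sm (acl L M B)"
proof -
  define Z :: "(('f, 'r) fm + 'm) set" where "Z = formulas L <+> B"
  have inf: "infinite Z" unfolding Z_def using infinite_formulas by simp
  have Z: "|Z| <o \<kappa>"
    unfolding Z_def using assms monster infinite_Field Card_order
    by (intro card_of_Plus_ordLess_infinite_Field) (auto simp: small_def monster_model_def)
  \<comment> \<open>A list names a solution set: its head is the formula, and entry
    \<open>Suc v\<close> tells whether the variable \<open>v\<close> stands for a parameter
    (\<open>Inr\<close>) or for the element sought (\<open>Inl\<close>, whatever its
    content).\<close>
  define S :: "(('f, 'r) fm + 'm) list \<Rightarrow> 'm set" where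
    "S xs = {d. sat M (\<lambda>v. case xs ! Suc v of Inl _ \<Rightarrow> d | Inr b \<Rightarrow> b) (projl (hd xs))}" for xs
  define I where "I = {xs. set xs \<subseteq> Z \<and> finite (S xs)}"
  have "acl L M B \<subseteq> (\<Union>xs\<in>I. S xs)"
  proof
    fix m assume "m \<in> acl L M B"
    then obtain \<phi> e where p: "wff L \<phi>" "\<forall>v\<in>fv \<phi>. e v \<in> {()} <+> B"
      "psat M (\<lambda>_. m) (\<phi>, e)" "finite {d. psat M (\<lambda>_. d) (\<phi>, e)}"
      unfolding acl_def pformulas_def formulas_def by auto
    obtain N where N: "fv \<phi> \<subseteq> {..<N}"
      using finite_nat_set_iff_bounded[of "fv \<phi>"] by auto
    define xs where "xs = Inl \<phi> # map (\<lambda>v. if v \<in> fv \<phi> then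
        (case e v of Inl _ \<Rightarrow> Inl \<phi> | Inr b \<Rightarrow> Inr b) else Inl \<phi>) [0..<N]"
    have "sat M (\<lambda>v. case xs ! Suc v of Inl _ \<Rightarrow> d | Inr b \<Rightarrow> b) (projl (hd xs)) = psat M (\<lambda>_. d) (\<phi>, e)" for d
    proof -
      have "(case xs ! Suc v of Inl _ \<Rightarrow> d | Inr b \<Rightarrow> b) = (case_sum (\<lambda>_. d) id \<circ> e) v" if "v \<in> fv \<phi>" for v
      proof -
        have "v < N" using that N by auto
        then show ?thesis using that by (simp add: xs_def split: sum.splits)
      qed
      then show ?thesis unfolding psat_def xs_def list.sel sum.sel fst_conv snd_conv by (rule sat_cong)
    qed
    then have S: "S xs = {d. psat M (\<lambda>_. d) (\<phi>, e)}" unfolding S_def by blast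
    have "set xs \<subseteq> Z"
    proof -
      have "(case e v of Inl _ \<Rightarrow> Inl \<phi> | Inr b \<Rightarrow> Inr b) \<in> Z" if "v \<in> fv \<phi>" for v
      proof -
        have "e v \<in> {()} <+> B" using p(2) that by blast
        then show ?thesis using p(1) by (auto simp: Z_def formulas_def)
      qed
      then show ?thesis using p(1) by (auto simp: xs_def Z_def formulas_def)
    qed
    then have "xs \<in> I" using p(4) by (simp add: I_def S)
    moreover have "m \<in> S xs" using p(3) S by blast
    ultimately show "m \<in> (\<Union>xs\<in>I. S xs)" by blast
  qed
  then have "|acl L M B| \<le>o |\<Union>xs\<in>I. S xs|" by (rule card_of_mono1)
  also have "|\<Union>xs\<in>I. S xs| \<le>o |Z|"
  proof (rule card_of_UNION_ordLeq_infinite[OF inf])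
    have "|I| \<le>o |{xs. set xs \<subseteq> Z}|" unfolding I_def by (rule card_of_mono1) auto
    then show "|I| \<le>o |Z|" using card_lists[OF inf] ordLeq_transitive by blast
    show "\<forall>xs\<in>I. |S xs| \<le>o |Z|"
      unfolding I_def using inf by (metis (no_types, lifting) card_of_Well_order card_of_ordLeq_finite mem_Collect_eq ordLeq_total)
  qed
  finally have "|acl L M B| \<le>o |Z|" .
  then show ?thesis unfolding small_def using Z by (rule ordLeq_ordLess_trans)
qed

text \<open>Strong homogeneity speaks of types over the empty set, so \<open>D\<close> is joined to
  the entries of \<open>b\<close> and fixed by the elementary map \<open>f\<close>.\<close>

lemma tp_eqD:
  fixes b c :: "'i \<Rightarrow> 'm"
  assumes "tp L M c I D = tp L M b I D" "sm D" "sm (b ` I)"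
  shows "\<exists>g\<in>aut D. \<forall>i\<in>I. g (b i) = c i"
proof -
  have eq: "psat M c p = psat M b p" if "p \<in> pformulas L I D" for p
    using assms(1) that unfolding tp_def by blast
  \<comment> \<open>One index for each entry, as \<open>b\<close> may repeat entries.\<close>
  define k where "k m = (SOME i. i \<in> I \<and> b i = m)" for m
  have k: "k m \<in> I \<and> b (k m) = m" if "m \<in> b ` I" for m
    unfolding k_def by (rule someI_ex) (use that in blast)
  define f where "f m = (if m \<in> D then m else c (k m))" for m
  let ?X = "D \<union> b ` I"
  have "psat M f p = psat M id p" if p: "p \<in> pformulas L ?X {}" for p
  proof -
    obtain \<phi> e where pe: "p = (\<phi>, e)" "wff L \<phi>" "\<forall>v\<in>fv \<phi>. e v \<in> ?X <+> {}"
      using p by (auto simp: pformulas_def formulas_def)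
    define e' where "e' v = (case e v of Inl x \<Rightarrow> if x \<in> D then Inr x else Inl (k x) | Inr x \<Rightarrow> Inr x)" for v
    have e: "\<exists>x\<in>?X. e v = Inl x" if "v \<in> fv \<phi>" for v
      using pe that by blast
    have "psat M f p = psat M c (\<phi>, e')"
      unfolding pe psat_def fst_conv snd_conv
      by (rule sat_cong) (use e in \<open>fastforce simp: e'_def f_def\<close>)
    also have "\<dots> = psat M b (\<phi>, e')"
    proof (rule eq)
      have "e' v \<in> I <+> D" if "v \<in> fv \<phi>" for v
        using e[OF that] k by (auto simp: e'_def)
      then show "(\<phi>, e') \<in> pformulas L I D" using pe(2) by (auto simp: pformulas_def formulas_def)
    qed
    also have "\<dots> = psat M id p"
      unfolding pe psat_def fst_conv snd_conv
    proof (rule sat_cong)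
      fix v assume "v \<in> fv \<phi>"
      then show "(case_sum b id \<circ> e') v = (case_sum id id \<circ> e) v"
        using e[of v] k by (auto simp: e'_def)
    qed
    finally show ?thesis .
  qed
  then have "tp L M f ?X {} = tp L M id ?X {}" unfolding tp_def by blast
  moreover have "sm ?X" using assms by (intro small_Un)
  ultimately obtain g where g: "automorphism L M g" "\<forall>x\<in>?X. g x = f x"
    using monster unfolding monster_model_def strongly_homogeneous_def by blast
  have "g \<in> aut D" using g by (auto simp: aut_def f_def)
  \<comment> \<open>The values of \<open>f\<close> come from \<open>D\<close> or from one chosen
    index; equality formulas in the type make \<open>c\<close> agree with both choices.\<close>
  moreover have "g (b i) = c i" if i: "i \<in> I" for i
  proof (cases "b i \<in> D")
    case True
    let ?p = "(Eq (Var 0) (Var 1), \<lambda>v :: nat. if v = 0 then Inl i else Inr (b i)) :: ('f, 'r, 'i, 'm) pfm"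
    have "?p \<in> pformulas L I D" using i True by (auto simp: pformulas_def formulas_def)
    from eq[OF this] have "c i = b i" by (simp add: psat_def)
    then show ?thesis using g True by (simp add: f_def)
  next
    case False
    have k: "k (b i) \<in> I" "b (k (b i)) = b i" using k[of "b i"] i by auto
    let ?p = "(Eq (Var 0) (Var 1), \<lambda>v :: nat. if v = 0 then Inl i else Inl (k (b i))) :: ('f, 'r, 'i, 'm) pfm"
    have "?p \<in> pformulas L I D" using i k by (auto simp: pformulas_def formulas_def)
    from eq[OF this] have "c i = c (k (b i))" using k by (simp add: psat_def)
    then show ?thesis using g False i by (simp add: f_def)
  qed
  ultimately show ?thesis by blast
qed

lemma homogeneous:
  fixes b c :: "'i :: countable \<Rightarrow> 'm"
  assumes "sm D" "\<And>P. dfn D P \<Longrightarrow> P b \<Longrightarrow> P c"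
  shows "\<exists>g\<in>aut D. g \<circ> b = c"
proof -
  have "psat M c p = psat M b p" if "p \<in> pformulas L UNIV D" for p
  proof -
    have d: "dfn D (\<lambda>a. psat M a p)" using that unfolding dfn_pformula by blast
    show ?thesis using assms(2)[OF d] assms(2)[OF dfn_neg[OF d]] by blast
  qed
  then have "tp L M c UNIV D = tp L M b UNIV D" unfolding tp_def by blast
  from tp_eqD[OF this assms(1) small_range] show ?thesis by (auto simp: fun_eq_iff)
qed

section \<open>Compactness for elements and for countable tuples\<close>

lemma realise_element:
  assumes "sm B" "\<And>P. P \<in> \<P> \<Longrightarrow> dfn1 B P"
    and "\<And>\<P>'. finite \<P>' \<Longrightarrow> \<P>' \<subseteq> \<P> \<Longrightarrow> \<exists>y. \<forall>P\<in>\<P>'. P y"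
  shows "\<exists>y. \<forall>P\<in>\<P>. P y"
proof -
  define \<Gamma> where "\<Gamma> = {p \<in> pformulas L {()} B. \<exists>P\<in>\<P>. \<forall>a. P (a ()) = psat M a p}"
  have "consistent M \<Gamma>"
    unfolding consistent_def
  proof (intro allI impI)
    fix \<Gamma>' assume \<Gamma>': "finite \<Gamma>' \<and> \<Gamma>' \<subseteq> \<Gamma>"
    then have "\<forall>p\<in>\<Gamma>'. \<exists>P. P \<in> \<P> \<and> (\<forall>a. P (a ()) = psat M a p)" by (auto simp: \<Gamma>_def)
    then obtain F where F: "\<forall>p\<in>\<Gamma>'. F p \<in> \<P> \<and> (\<forall>a. F p (a ()) = psat M a p)"
      by metis
    then obtain y where "\<forall>P\<in>F ` \<Gamma>'. P y" using assms(3)[of "F ` \<Gamma>'"] \<Gamma>' by blast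
    then show "\<exists>a. \<forall>p\<in>\<Gamma>'. psat M a p"
      using F by (intro exI[of _ "\<lambda>_. y"]) auto
  qed
  moreover have "\<Gamma> \<subseteq> pformulas L {()} B" by (auto simp: \<Gamma>_def)
  ultimately obtain a where a: "\<forall>p\<in>\<Gamma>. psat M a p"
    using monster assms(1) unfolding monster_model_def saturated_def by blast
  have "P (a ())" if P: "P \<in> \<P>" for P
  proof -
    obtain p where "p \<in> pformulas L UNIV B" "\<forall>a. P (a ()) = psat M a p"
      using assms(2)[OF P] unfolding dfn_pformula by blast
    moreover from this have "p \<in> \<Gamma>" using P unfolding \<Gamma>_def UNIV_unit by blast
    ultimately show ?thesis using a by blast
  qed
  then show ?thesis by blast
qed

text \<open>Saturation provides single elements, so the coordinates are chosen one by one in the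
  order of \<open>to_nat\<close>. The invariant \<open>K n f\<close> says that \<open>\<P>\<close>
  stays finitely satisfiable with the first \<open>n\<close> choices kept.\<close>

lemma realise_tuple:
  fixes \<P> :: "(('i :: countable \<Rightarrow> 'm) \<Rightarrow> bool) set"
  assumes "sm B" "\<And>P. P \<in> \<P> \<Longrightarrow> dfn B P"
    and "\<And>\<P>'. finite \<P>' \<Longrightarrow> \<P>' \<subseteq> \<P> \<Longrightarrow> \<exists>a. \<forall>P\<in>\<P>'. P a"
  shows "\<exists>a. \<forall>P\<in>\<P>. P a"
proof -
  define K where "K n f \<longleftrightarrow> (\<forall>\<P>'. finite \<P>' \<and> \<P>' \<subseteq> \<P> \<longrightarrow>
      (\<exists>a. (\<forall>i. to_nat i < n \<longrightarrow> a i = f (to_nat i)) \<and> (\<forall>P\<in>\<P>'. P a)))" for n :: nat and f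
  have "\<exists>f. \<forall>n. K n f \<longrightarrow> K (Suc n) (f(n := f n))"
  proof (rule dependent_wf_choice[of less_than])
    fix f g :: "nat \<Rightarrow> 'm" and n r
    assume fg: "\<And>m. (m, n) \<in> less_than \<Longrightarrow> f m = g m"
    have "K n f = K n g" unfolding K_def using fg by simp
    moreover have "(f(n := r)) m = (g(n := r)) m" if "m < Suc n" for m
      using fg that by (cases "m = n") auto
    then have "K (Suc n) (f(n := r)) = K (Suc n) (g(n := r))" unfolding K_def by simp
    ultimately show "(K n f \<longrightarrow> K (Suc n) (f(n := r))) = (K n g \<longrightarrow> K (Suc n) (g(n := r)))" by simp
  next
    fix n f
    show "\<exists>y. K n f \<longrightarrow> K (Suc n) (f(n := y))"
    proof (cases "K n f")
      case True
      \<comment> \<open>The choice \<open>y\<close> for coordinate \<open>n\<close> leaves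
        \<open>\<P>'\<close> solvable. Projecting away the other coordinates makes this a predicate
        of \<open>y\<close> alone, over \<open>B\<close> and the values chosen so far.\<close>
      define R where "R \<P>' y \<longleftrightarrow> (\<exists>a. (\<forall>i\<in>{i. to_nat i < n}. a i = f (to_nat i)) \<and>
         (\<forall>i\<in>{i. to_nat i = n}. a i = y) \<and> (\<forall>P\<in>\<P>'. P a))"
        for \<P>' :: "(('i \<Rightarrow> 'm) \<Rightarrow> bool) set" and y
      have fin: "finite {i :: 'i. to_nat i < m}" for m
        using finite_vimageI[of "{..<m}" "to_nat :: 'i \<Rightarrow> nat"] by (simp add: vimage_def)
      have fin': "finite {i :: 'i. to_nat i = n}"
        by (rule finite_subset[OF _ fin[of "Suc n"]]) auto
      have d: "dfn1 (B \<union> f ` {..<n}) (R \<P>')" if "finite \<P>'" "\<P>' \<subseteq> \<P>" for \<P>'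
      proof -
        have "dfn (B \<union> f ` {..<n}) (\<lambda>s :: unit + 'i \<Rightarrow> 'm.
            (\<forall>i\<in>{i. to_nat i < n}. s (Inr i) = f (to_nat i)) \<and>
            (\<forall>i\<in>{i. to_nat i = n}. s (Inr i) = s (Inl ())) \<and> (\<forall>P\<in>\<P>'. P (\<lambda>i. s (Inr i))))"
        proof (intro dfn_conj dfn_all_finite fin fin' that(1))
          show "dfn (B \<union> f ` {..<n}) (\<lambda>s :: unit + 'i \<Rightarrow> 'm. s (Inr i) = f (to_nat i))"
            if "i \<in> {i. to_nat i < n}" for i
            by (rule dfn_eq_param) (use that in auto)
          show "dfn (B \<union> f ` {..<n}) (\<lambda>s :: unit + 'i \<Rightarrow> 'm. s (Inr i) = s (Inl ()))" for i
            by (rule dfn_eq)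
          show "dfn (B \<union> f ` {..<n}) (\<lambda>s :: unit + 'i \<Rightarrow> 'm. P (\<lambda>i. s (Inr i)))" if "P \<in> \<P>'" for P
            using dfn_mono[OF dfn_reindex[OF assms(2)], of P] that \<open>\<P>' \<subseteq> \<P>\<close> by blast
        qed
        from dfn_ex[OF this] show ?thesis by (simp add: R_def)
      qed
      have "sm (B \<union> f ` {..<n})" by (simp add: assms(1) small_Un small_finite)
      moreover have "\<exists>y. \<forall>Q\<in>\<Q>. Q y" if \<Q>: "finite \<Q>" "\<Q> \<subseteq> R ` {\<P>'. finite \<P>' \<and> \<P>' \<subseteq> \<P>}" for \<Q>
      proof -
        obtain \<F> where \<F>: "\<Q> = R ` \<F>" "finite \<F>" "\<F> \<subseteq> {\<P>'. finite \<P>' \<and> \<P>' \<subseteq> \<P>}"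
          using finite_subset_image[OF \<Q>] by blast
        then have "finite (\<Union>\<F>)" "\<Union>\<F> \<subseteq> \<P>" by auto
        then obtain a where a: "\<forall>i. to_nat i < n \<longrightarrow> a i = f (to_nat i)" "\<forall>P\<in>\<Union>\<F>. P a"
          using True unfolding K_def by meson
        \<comment> \<open>No index need have the code \<open>n\<close>; then \<open>y\<close> is
          arbitrary.\<close>
        obtain y where y: "\<forall>i\<in>{i. to_nat i = n}. a i = y"
          by (metis (mono_tags, lifting) from_nat_to_nat mem_Collect_eq)
        have "R \<P>' y" if "\<P>' \<in> \<F>" for \<P>'
          unfolding R_def using a y that by blast
        then show ?thesis using \<F>(1) by blast
      qed
      ultimately obtain y where y: "\<forall>Q\<in>R ` {\<P>'. finite \<P>' \<and> \<P>' \<subseteq> \<P>}. Q y"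
        using realise_element[of "B \<union> f ` {..<n}" "R ` {\<P>'. finite \<P>' \<and> \<P>' \<subseteq> \<P>}"] d by blast
      have "K (Suc n) (f(n := y))"
        unfolding K_def
      proof (intro allI impI)
        fix \<P>' assume "finite \<P>' \<and> \<P>' \<subseteq> \<P>"
        then have "R \<P>' y" using y by blast
        then obtain a where a: "\<forall>i\<in>{i. to_nat i < n}. a i = f (to_nat i)"
          "\<forall>i\<in>{i. to_nat i = n}. a i = y" "\<forall>P\<in>\<P>'. P a"
          unfolding R_def by blast
        then have "\<forall>i. to_nat i < Suc n \<longrightarrow> a i = (f(n := y)) (to_nat i)"
          by (auto simp: less_Suc_eq)
        then show "\<exists>a. (\<forall>i. to_nat i < Suc n \<longrightarrow> a i = (f(n := y)) (to_nat i)) \<and> (\<forall>P\<in>\<P>'. P a)"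
          using a(3) by blast
      qed
      then show ?thesis by blast
    qed auto
  qed simp
  then obtain f where f: "\<And>n. K n f \<Longrightarrow> K (Suc n) f" by auto
  have K: "K n f" for n
  proof (induction n)
    case 0 then show ?case using assms(3) unfolding K_def by simp
  qed (rule f)
  \<comment> \<open>A finite support of \<open>P\<close> has bounded codes, so the truth of
    \<open>P\<close> is settled at some stage.\<close>
  have "P (\<lambda>i. f (to_nat i))" if P: "P \<in> \<P>" for P
  proof -
    obtain S where S: "finite S" "\<And>a b. (\<forall>i\<in>S. a i = b i) \<Longrightarrow> P a = P b"
      using dfn_support[OF assms(2)[OF P]] by blast
    obtain n where n: "\<forall>i\<in>S. to_nat i < n"
      using S(1) finite_nat_set_iff_bounded[of "to_nat ` S"] by auto
    obtain a where "\<forall>i. to_nat i < n \<longrightarrow> a i = f (to_nat i)" "P a"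
      using K[of n] P unfolding K_def by (metis empty_subsetI finite.emptyI finite_insert insertI1 insert_subset)
    then show ?thesis using S(2)[of a "\<lambda>i. f (to_nat i)"] n by simp
  qed
  then show ?thesis by blast
qed

text \<open>Each formula over \<open>B\<close> satisfied by \<open>e\<close> has infinitely many
  solutions, hence one off any finite part of \<open>X\<close>; saturation and homogeneity then move
  \<open>e\<close> off all of \<open>X\<close>.\<close>

lemma conjugate_outside:
  assumes "sm B" "sm X" "e \<notin> acl L M B"
  shows "\<exists>g\<in>aut B. g e \<notin> X"
proof -
  let ?\<P> = "{P. dfn1 B P \<and> P e} \<union> (\<lambda>x d. d \<noteq> x) ` X"
  have "\<exists>y. \<forall>P\<in>?\<P>. P y"
  proof (rule realise_element[of "B \<union> X"])
    show "sm (B \<union> X)" by (rule small_Un[OF assms(1,2)])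
    show "dfn1 (B \<union> X) P" if "P \<in> ?\<P>" for P
      using that dfn_mono[of B _ "B \<union> X"] dfn_neg[OF dfn_eq_param, of _ "B \<union> X" "()"] by auto
    fix \<Q> assume \<Q>: "finite \<Q>" "\<Q> \<subseteq> ?\<P>"
    define \<Q>1 where "\<Q>1 = {P \<in> \<Q>. dfn1 B P \<and> P e}"
    have "dfn1 B (\<lambda>d. \<forall>P\<in>\<Q>1. P d)"
      using \<Q>(1) by (intro dfn_all_finite) (auto simp: \<Q>1_def)
    then have inf: "infinite {d. \<forall>P\<in>\<Q>1. P d}"
      using assms(3) unfolding acl_iff by (auto simp: \<Q>1_def)
    obtain Y where Y: "finite Y" "\<Q> - \<Q>1 = (\<lambda>x d. d \<noteq> x) ` Y"
      using finite_subset_image[of "\<Q> - \<Q>1" "\<lambda>x d. d \<noteq> x" X] \<Q> unfolding \<Q>1_def by blast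
    obtain y where "\<forall>P\<in>\<Q>1. P y" "y \<notin> Y"
      using inf Y(1) finite_subset[of "{d. \<forall>P\<in>\<Q>1. P d}" Y] by auto
    moreover have "P y" if "P \<in> \<Q> - \<Q>1" "y \<notin> Y" for P y
      using that unfolding Y(2) by auto
    ultimately have "\<forall>P\<in>\<Q>. P y" by blast
    then show "\<exists>y. \<forall>P\<in>\<Q>. P y" by blast
  qed
  then obtain y where y: "\<forall>P\<in>?\<P>. P y" by (rule exE)
  have yP: "P y" if "dfn1 B P" "P e" for P using y[THEN bspec, of P] that by simp
  have yX: "y \<notin> X" using y by auto
  have P: "P (\<lambda>_. y)" if "dfn B P" "P (\<lambda>_. e)" for P :: "(unit \<Rightarrow> 'm) \<Rightarrow> bool"
  proof (rule yP[of "\<lambda>d. P (\<lambda>_. d)"])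
    show "dfn1 B (\<lambda>d. P (\<lambda>_. d))" using dfn_reindex[OF that(1), of "\<lambda>_. ()"] by simp
  qed (rule that)
  obtain g where "g \<in> aut B" "g \<circ> (\<lambda>_ :: unit. e) = (\<lambda>_. y)"
    using homogeneous[OF assms(1) P] by (rule bexE)
  then show ?thesis using yX by (intro bexI[of _ g]) (metis comp_apply)
qed

text \<open>An \<open>e\<close> in \<open>acl(acl B) - acl B\<close> has a conjugate over \<open>B\<close> outside the small set \<open>acl(acl B)\<close>,
  which is invariant under automorphisms over \<open>B\<close>.\<close>

lemma acl_idem: assumes "sm B" shows "acl L M (acl L M B) = acl L M B"
proof
  show "acl L M (acl L M B) \<subseteq> acl L M B"
  proof
    fix e assume e: "e \<in> acl L M (acl L M B)"
    show "e \<in> acl L M B"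
    proof (rule ccontr)
      assume "e \<notin> acl L M B"
      then obtain g where g: "g \<in> aut B" "g e \<notin> acl L M (acl L M B)"
        using conjugate_outside[OF assms small_acl[OF small_acl[OF assms]]] by blast
      have "automorphism L M g" "g ` B = B" using g(1) aut_image[of g B B] by (auto simp: aut_def)
      then have "g ` acl L M (acl L M B) = acl L M (acl L M B)"
        using acl_image[of g] by metis
      then show False using e g(2) by blast
    qed
  qed
qed (rule acl_extensive)

lemma alg_closed_acl: "sm B \<Longrightarrow> alg_closed L M (acl L M B)"
  by (simp add: alg_closed_def acl_idem)

end

section \<open>Free sequences of copies and SOP3\<close>

context lstruct
begin

section \<open>Binary definable relations on sequences and a criterion for SOP3\<close>

lemma dfn_binary:
  assumes "dfn B (\<lambda>s :: nat + nat \<Rightarrow> 'm. \<Phi> (s \<circ> Inl) (s \<circ> Inr))"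
  shows "dfn B (\<lambda>s. \<Phi> (\<lambda>r. s (i r)) (\<lambda>r. s (j r)))"
  using dfn_reindex[OF assms, of "case_sum i j"] by (simp add: comp_def)

lemma dfn_binary_param:
  assumes "dfn {} (\<lambda>s :: nat + nat \<Rightarrow> 'm. \<Phi> (s \<circ> Inl) (s \<circ> Inr))" "range c \<subseteq> B"
  shows "dfn B (\<lambda>x. \<Phi> x c)"
proof -
  have "dfn B (\<lambda>a. (\<lambda>s. \<Phi> (s \<circ> Inl) (s \<circ> Inr)) (\<lambda>i. case_sum a id (case_sum Inl (\<lambda>r. Inr (c r)) i)))"
    by (rule dfn_param[OF assms(1)]) (use assms(2) in \<open>auto split: sum.splits\<close>)
  then show ?thesis by (simp add: comp_def)
qed

lemma dfn_binary_aut: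
  assumes "dfn {} (\<lambda>s :: nat + nat \<Rightarrow> 'm. \<Phi> (s \<circ> Inl) (s \<circ> Inr))" "g \<in> aut C"
  shows "\<Phi> (g \<circ> x) (g \<circ> y) = \<Phi> x y"
proof -
  have "g \<in> aut {}" using assms(2) aut_mono by blast
  from dfn_aut[OF assms(1) this, of "case_sum x y"] show ?thesis by (simp add: comp_def)
qed

lemma dfn_common:
  assumes "dfn B (\<lambda>s :: nat + nat \<Rightarrow> 'm. \<Phi> (s \<circ> Inl) (s \<circ> Inr))"
  shows "dfn B (\<lambda>s :: nat + nat \<Rightarrow> 'm. \<exists>x. \<Phi> x (s \<circ> Inl) \<and> \<Phi> x (s \<circ> Inr))"
proof -
  have "dfn B (\<lambda>s :: (nat + nat) + nat \<Rightarrow> 'm.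
      \<Phi> (\<lambda>r. s (Inr r)) (\<lambda>r. s (Inl (Inl r))) \<and> \<Phi> (\<lambda>r. s (Inr r)) (\<lambda>r. s (Inl (Inr r))))"
    by (intro dfn_conj dfn_binary[OF assms])
  from dfn_ex[OF this] show ?thesis by (simp add: comp_def)
qed

text \<open>A definable relation on infinite sequences looks at finitely many coordinates, so
  cutting the sequences off at a bound \<open>K\<close> turns it into a formula on
  \<open>K\<close>-tuples.\<close>

lemma SOP3_I:
  assumes dR: "dfn {} (\<lambda>s :: nat + nat \<Rightarrow> 'm. R (s \<circ> Inl) (s \<circ> Inr))"
    and cycle: "\<And>x y z. \<not> (R x y \<and> R y z \<and> R z x)"
    and chain: "\<And>i j :: nat. i < j \<Longrightarrow> R (t i) (t j)"
  shows "SOP3 L M"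
proof -
  obtain \<phi> e where \<phi>: "wff L \<phi>" "\<forall>v\<in>fv \<phi>. e v \<in> UNIV <+> {}"
    "\<And>s. R (s \<circ> Inl) (s \<circ> Inr) = sat M (case_sum s id \<circ> e) \<phi>"
    using dR unfolding dfn_def by blast
  have e: "\<exists>r. e v = Inl r" if "v \<in> fv \<phi>" for v using \<phi>(2) that by auto
  obtain K where K: "\<And>v. v \<in> fv \<phi> \<Longrightarrow> case_sum id id (projl (e v)) < K"
    using finite_nat_set_iff_bounded[of "(\<lambda>v. case_sum id id (projl (e v))) ` fv \<phi>"] by auto
  obtain N0 where N0: "\<And>v. v \<in> fv \<phi> \<Longrightarrow> v < N0"
    using finite_nat_set_iff_bounded[of "fv \<phi>"] by auto
  \<comment> \<open>The variables are renamed twice, first upwards by \<open>N\<close> and then down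
    to their places below \<open>K + K\<close>, because \<open>substitution_formula\<close> wants
    sources and targets disjoint.\<close>
  define N where "N = N0 + (K + K)"
  define \<rho> where "\<rho> v = case_sum id (\<lambda>r. K + r) (projl (e (v - N)))" for v
  have "v + N \<notin> fv \<phi>" for v using N0[of "v + N"] by (auto simp: N_def)
  then have "fv \<phi> \<inter> (\<lambda>v. v + N) ` fv \<phi> = {}" by blast
  from substitution_formula[OF finite_fv \<phi>(1) this, of M] obtain \<chi> where
    \<chi>: "wff L \<chi>" "fv \<chi> \<subseteq> (\<lambda>v. v + N) ` fv \<phi>"
    "\<And>e. sat M e \<chi> = sat M (\<lambda>v. if v \<in> fv \<phi> then e (v + N) else e v) \<phi>"
    by auto
  have \<rho>: "\<rho> v < K + K" if v: "v \<in> fv \<chi>" for v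
  proof -
    obtain w where w: "v = w + N" "w \<in> fv \<phi>" using \<chi>(2) v by blast
    show ?thesis using K[OF w(2)] by (auto simp: \<rho>_def w(1) split: sum.splits)
  qed
  have "\<rho> v \<notin> fv \<chi>" if v: "v \<in> fv \<chi>" for v
  proof
    assume "\<rho> v \<in> fv \<chi>"
    then have "N \<le> \<rho> v" using \<chi>(2) by auto
    then show False using \<rho>[OF v] by (simp add: N_def)
  qed
  then have "fv \<chi> \<inter> \<rho> ` fv \<chi> = {}" by blast
  from substitution_formula[OF finite_fv \<chi>(1) this, of M] obtain \<psi> where
    \<psi>: "wff L \<psi>" "fv \<psi> \<subseteq> \<rho> ` fv \<chi>"
    "\<And>e. sat M e \<psi> = sat M (\<lambda>v. if v \<in> fv \<chi> then e (\<rho> v) else e v) \<chi>"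
    by auto
  have sub: "sat M e' \<psi> = sat M (\<lambda>v. e' (\<rho> (v + N))) \<phi>" for e'
  proof -
    have "sat M e' \<psi> = sat M (\<lambda>v. e' (\<rho> v)) \<chi>"
      unfolding \<psi>(3) by (rule sat_cong) simp
    also have "\<dots> = sat M (\<lambda>v. e' (\<rho> (v + N))) \<phi>"
      unfolding \<chi>(3) by (rule sat_cong) simp
    finally show ?thesis .
  qed
  have holds: "holds2 M K \<psi> (map x [0..<K]) (map y [0..<K]) = R x y" for x y
  proof -
    have "R x y = sat M (case_sum (case_sum x y) id \<circ> e) \<phi>"
      using \<phi>(3)[of "case_sum x y"] by (simp add: comp_def)
    also have "\<dots> = holds2 M K \<psi> (map x [0..<K]) (map y [0..<K])"
      unfolding holds2_def sub
    proof (rule sat_cong)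
      fix v assume v: "v \<in> fv \<phi>"
      obtain r where r: "e v = Inl r" using e[OF v] by blast
      show "(case_sum (case_sum x y) id \<circ> e) v =
        (if \<rho> (v + N) < K then map x [0..<K] ! \<rho> (v + N) else map y [0..<K] ! (\<rho> (v + N) - K))"
        using K[OF v] r by (auto simp: \<rho>_def split: sum.splits)
    qed
    finally show ?thesis by simp
  qed
  have "fv \<psi> \<subseteq> {..<K + K}" using \<psi>(2) \<rho> by fastforce
  moreover have "\<psi> \<in> formulas L" using \<psi>(1) by (simp add: formulas_def)
  moreover have "\<not> (holds2 M K \<psi> a1 a2 \<and> holds2 M K \<psi> a2 a3 \<and> holds2 M K \<psi> a3 a1)"
    if "length a1 = K" "length a2 = K" "length a3 = K" for a1 a2 a3
    using holds[of "(!) a1" "(!) a2"] holds[of "(!) a2" "(!) a3"] holds[of "(!) a3" "(!) a1"]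
      cycle[of "(!) a1" "(!) a2" "(!) a3"] that map_nth[of a1] map_nth[of a2] map_nth[of a3] by simp
  moreover have "\<forall>i. length (map (t i) [0..<K]) = K" by simp
  moreover have "\<forall>i j. i < j \<longrightarrow> holds2 M K \<psi> (map (t i) [0..<K]) (map (t j) [0..<K])"
    using chain by (simp add: holds)
  ultimately show ?thesis unfolding SOP3_def
    by (intro bexI[of _ \<psi>] exI[of _ K] conjI exI[of _ "\<lambda>i. map (t i) [0..<K]"]) blast+
qed

end

locale free_amalgamation = monster L M T \<kappa>
  for L :: "('f, 'r) lang" and M :: "('f, 'r, 'm) struct" and T and \<kappa> :: "'k rel" +
  fixes R :: "'m indep"
  assumes invariant: "invariance L \<kappa> M R"
    and monotone: "monotonicity \<kappa> R"
    and existence: "full_existence L \<kappa> M R"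
    and stationary: "stationarity L \<kappa> M R"
    and free: "freedom \<kappa> R"
    and closure: "indep_closure L \<kappa> M R"
begin

section \<open>The independence axioms in terms of automorphisms\<close>

lemma indep_image:
  assumes "g \<in> aut D" "sm A" "sm B" "sm C" "R A C B"
  shows "R (g ` A) (g ` C) (g ` B)"
proof -
  have "tp L M g (A \<union> B \<union> C) {} = tp L M id (A \<union> B \<union> C) {}"
    using assms(1) aut_mono[of "{}" D] by (intro tp_eqI[of g]) auto
  then show ?thesis using invariant assms unfolding invariance_def by blast
qed

lemma indep_mono: "sm A \<Longrightarrow> sm B \<Longrightarrow> sm C \<Longrightarrow> R A C B \<Longrightarrow> A' \<subseteq> A \<Longrightarrow> B' \<subseteq> B \<Longrightarrow> R A' C B'"
  using monotone unfolding monotonicity_def by blast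

lemma indep_exists:
  assumes "sm A" "sm B" "sm C" "alg_closed L M C"
  shows "\<exists>g\<in>aut C. R (g ` A) C B"
proof -
  obtain f where f: "tp L M f A C = tp L M id A C" "R (f ` A) C B"
    using existence assms unfolding full_existence_def by blast
  then obtain g where "g \<in> aut C" "\<forall>a\<in>A. g a = f a"
    using tp_eqD[OF f(1)] assms by auto
  then show ?thesis using f(2) by (metis image_cong)
qed

lemma indep_stationary:
  assumes "sm A" "sm B" "sm C" "alg_closed L M A" "alg_closed L M B" "alg_closed L M C"
    "C \<subseteq> A" "C \<subseteq> B" "g \<in> aut C" "R A C B" "R (g ` A) C B"
  shows "\<exists>h\<in>aut B. \<forall>a\<in>A. h a = g a"
proof -
  have "tp L M g A C = tp L M id A C" using assms(9) by (rule tp_eqI) simp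
  then have "tp L M g A B = tp L M id A B"
    using stationary assms unfolding stationarity_def by (metis le_inf_iff)
  from tp_eqD[OF this] assms(1,2) show ?thesis by simp
qed

lemma indep_free: "sm A \<Longrightarrow> sm B \<Longrightarrow> sm C \<Longrightarrow> R A C B \<Longrightarrow> C \<inter> (A \<union> B) \<subseteq> D \<Longrightarrow> D \<subseteq> C \<Longrightarrow> R A D B"
  using free unfolding freedom_def by blast

lemma indep_closed:
  "sm A \<Longrightarrow> sm B \<Longrightarrow> sm C \<Longrightarrow> alg_closed L M A \<Longrightarrow> alg_closed L M B \<Longrightarrow> alg_closed L M C \<Longrightarrow>
    C \<subseteq> A \<Longrightarrow> C \<subseteq> B \<Longrightarrow> R A C B \<Longrightarrow> alg_closed L M (A \<union> B)"
  using closure unfolding indep_closure_def by blast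

text \<open>For \<open>E = A \<inter> B\<close> one has \<open>E \<perp>\<^sub>C E\<close>.  If \<open>E \<noteq> C\<close>, take a conjugate \<open>gE\<close> of \<open>E\<close> with
  a different enumeration and a copy \<open>hE \<perp>\<^sub>C E \<union> gE\<close>: by stationarity \<open>h\<close> agrees on \<open>E\<close>
  with the identity as well as with \<open>g\<close>.\<close>

lemma indep_Int:
  assumes A: "sm A" "alg_closed L M A" and B: "sm B" "alg_closed L M B"
    and C: "sm C" "alg_closed L M C" "C \<subseteq> A" "C \<subseteq> B" and R: "R A C B"
  shows "A \<inter> B = C"
proof (rule ccontr)
  assume "A \<inter> B \<noteq> C"
  then obtain e where e: "e \<in> A \<inter> B" "e \<notin> C" using C by blast
  define E where "E = A \<inter> B"
  have E: "sm E" "alg_closed L M E" "C \<subseteq> E"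
    unfolding E_def using A B C small_subset[of A] alg_closed_Int by auto
  have RE: "R E C E" using indep_mono[OF A(1) B(1) C(1) R] by (simp add: E_def)
  have "e \<notin> acl L M C" using C(2) e(2) by (simp add: alg_closed_def)
  then obtain g where g: "g \<in> aut C" "g e \<notin> {e}"
    using conjugate_outside[OF C(1) small_finite[of "{e}"]] by blast
  have gC: "g ` C = C" using aut_image[OF g(1)] by blast
  have gE: "sm (g ` E)" "alg_closed L M (g ` E)" "C \<subseteq> g ` E"
    using small_image[OF E(1)] alg_closed_image[OF _ E(2)] g(1) image_mono[OF E(3), of g] gC
    by (simp_all add: aut_def)
  obtain h where h: "h \<in> aut C" "R (h ` E) C (E \<union> g ` E)"
    using indep_exists[OF E(1) small_Un[OF E(1) gE(1)] C(1,2)] by blast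
  have R1: "R (h ` E) C E" and R2: "R (h ` E) C (g ` E)"
    using indep_mono[OF small_image[OF E(1)] small_Un[OF E(1) gE(1)] C(1) h(2)] by auto
  have R3: "R (g ` E) C (g ` E)" using indep_image[OF g(1) E(1) E(1) C(1) RE] gC by simp
  obtain k where k: "k \<in> aut E" "\<forall>a\<in>E. k a = h a"
    using indep_stationary[OF E(1) E(1) C(1) E(2) E(2) C(2) E(3) E(3) h(1) RE R1] by blast
  have "h e = e" using k e(1) by (auto simp: aut_def E_def)
  moreover
  have hg: "h \<circ> inv g \<in> aut C" using h(1) g(1) by (simp add: aut_comp aut_inv)
  have "(h \<circ> inv g) ` g ` E = h ` E"
    using aut_inj[OF g(1)] by (simp add: image_comp comp_def)
  then obtain k' where k': "k' \<in> aut (g ` E)" "\<forall>a\<in>g ` E. k' a = (h \<circ> inv g) a"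
    using indep_stationary[OF gE(1) gE(1) C(1) gE(2) gE(2) C(2) gE(3) gE(3) hg R3] R2 by auto
  have "k' (g e) = g e" "k' (g e) = h e"
    using k' e(1) aut_inj[OF g(1)] by (auto simp: aut_def E_def)
  ultimately show False using g(2) by simp
qed

end

section \<open>Free sequences of copies of \<open>B\<close> over \<open>C\<close>\<close>

locale free_copies = free_amalgamation L M T \<kappa> R
  for L :: "('f, 'r) lang" and M :: "('f, 'r, 'm) struct" and T and \<kappa> :: "'k rel" and R +
  fixes B C
  assumes B: "sm B" "alg_closed L M B"
    and C: "sm C" "alg_closed L M C" "C \<subseteq> B"
begin

definition span :: "(nat \<Rightarrow> 'm \<Rightarrow> 'm) \<Rightarrow> nat \<Rightarrow> 'm set" where
  "span u n = C \<union> (\<Union>i<n. u i ` B)"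

text \<open>Copies are recorded as automorphisms rather than as sets, so that each carries the
  enumeration transported from \<open>B\<close>.\<close>

definition free_seq :: "nat \<Rightarrow> (nat \<Rightarrow> 'm \<Rightarrow> 'm) \<Rightarrow> bool" where
  "free_seq n u \<longleftrightarrow> (\<forall>i<n. u i \<in> aut C \<and> R (u i ` B) C (span u i))"

lemma small_span: "sm (span u n)"
  unfolding span_def by (intro small_Un C(1) small_UN) (auto intro: small_image B(1))

lemma copy:
  assumes "g \<in> aut C"
  shows "sm (g ` B)" "alg_closed L M (g ` B)" "C \<subseteq> g ` B"
proof -
  show "sm (g ` B)" by (rule small_image[OF B(1)])
  show "alg_closed L M (g ` B)" using alg_closed_image[OF _ B(2)] assms by (simp add: aut_def)
  show "C \<subseteq> g ` B" using aut_image[OF assms, of C] C(3) by blast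
qed

lemma span_Suc: "span u (Suc n) = u n ` B \<union> span u n"
  by (auto simp: span_def lessThan_Suc)

lemma closed_span: "free_seq n u \<Longrightarrow> alg_closed L M (span u n)"
proof (induction n)
  case 0
  then show ?case using C(2) by (simp add: span_def)
next
  case (Suc n)
  then have n: "u n \<in> aut C" "R (u n ` B) C (span u n)" and "free_seq n u"
    by (auto simp: free_seq_def)
  then show ?case unfolding span_Suc
    using copy[OF n(1)] C small_span Suc.IH
    by (intro indep_closed[of _ _ C]) (auto simp: span_def)
qed

text \<open>A map \<open>k\<close> that is right on the first \<open>n\<close> copies takes the next
  one to a set free from \<open>span h n\<close> over \<open>C\<close>. This span is closed, so
  stationarity corrects \<open>k\<close> there by a map \<open>k'\<close> that fixes the span and
  hence the earlier values.\<close>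

lemma free_seq_conjugate:
  "free_seq n u \<Longrightarrow> free_seq n h \<Longrightarrow> \<exists>k\<in>aut C. \<forall>i<n. \<forall>x\<in>B. k (u i x) = h i x"
proof (induction n)
  case 0
  then show ?case using aut_id by auto
next
  case (Suc n)
  then have "free_seq n u" "free_seq n h" by (auto simp: free_seq_def)
  then obtain k where k: "k \<in> aut C" "\<And>i x. i < n \<Longrightarrow> x \<in> B \<Longrightarrow> k (u i x) = h i x"
    using Suc.IH by blast
  have u: "u n \<in> aut C" "R (u n ` B) C (span u n)" and h: "h n \<in> aut C" "R (h n ` B) C (span h n)"
    using Suc.prems by (auto simp: free_seq_def)
  have kC: "k ` C = C" using aut_image[OF k(1)] by blast
  have "k ` span u n = C \<union> (\<Union>i<n. k ` u i ` B)" by (simp add: span_def image_Un image_UN kC)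
  also have "(\<Union>i<n. k ` u i ` B) = (\<Union>i<n. h i ` B)"
    using k(2) by (intro SUP_cong) (auto simp: image_image)
  finally have ks: "k ` span u n = span h n" by (simp add: span_def)
  let ?A = "k ` u n ` B"
  have ku: "k \<circ> u n \<in> aut C" using k(1) u(1) by (rule aut_comp)
  have RA: "R ?A C (span h n)"
    using indep_image[OF k(1) copy(1)[OF u(1)] small_span C(1) u(2)] kC ks by simp
  define f where "f = h n \<circ> inv (k \<circ> u n)"
  have f: "f \<in> aut C" unfolding f_def using h(1) ku by (simp add: aut_comp aut_inv)
  have fk: "f (k (u n x)) = h n x" for x
    using aut_inj[OF ku] inv_f_f[of "k \<circ> u n" x] by (simp add: f_def)
  then have "f ` ?A = h n ` B" by (simp add: image_image)
  moreover have A: "?A = (k \<circ> u n) ` B" by (simp add: image_comp)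
  ultimately obtain k' where k': "k' \<in> aut (span h n)" "\<forall>a\<in>?A. k' a = f a"
    using indep_stationary[of ?A "span h n" C f] RA h(2) small_span C closed_span[OF \<open>free_seq n h\<close>] f
      copy[OF ku] by (auto simp: span_def)
  have "k' \<circ> k \<in> aut C" using k' k(1) aut_mono[of C "span h n"] by (auto simp: span_def intro: aut_comp)
  moreover have "(k' \<circ> k) (u i x) = h i x" if i: "i < Suc n" and x: "x \<in> B" for i x
  proof (cases "i = n")
    case True
    then show ?thesis using k'(2) fk x by simp
  next
    case False
    then have "i < n" using i by simp
    then have "h i x \<in> span h n" using x by (auto simp: span_def)
    then show ?thesis using k(2)[OF \<open>i < n\<close> x] k'(1) by (simp add: aut_def)
  qed
  ultimately show ?case by blast
qed

text \<open>Each copy is chosen free over \<open>P\<close> from the earlier ones. A copy of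
  \<open>B\<close> by an automorphism over \<open>P\<close> meets \<open>P\<close> only where
  \<open>B\<close> does, that is in \<open>C\<close>, so freedom lowers the base from
  \<open>P\<close> to \<open>C\<close>.\<close>

lemma free_seq_over:
  assumes P: "sm P" "alg_closed L M P" "P \<inter> B = C"
  shows "\<exists>g. (\<forall>n. g n \<in> aut P) \<and> (\<forall>n. free_seq n g)"
proof -
  have "\<exists>g. \<forall>n. g n \<in> aut P \<and> R (g n ` B) C (span g n)"
  proof (rule dependent_wf_choice[of less_than])
    fix f g :: "nat \<Rightarrow> 'm \<Rightarrow> 'm" and n r
    assume "\<And>m. (m, n) \<in> less_than \<Longrightarrow> f m = g m"
    then have "span f n = span g n" by (simp add: span_def)
    then show "(r \<in> aut P \<and> R (r ` B) C (span f n)) = (r \<in> aut P \<and> R (r ` B) C (span g n))" by simp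
  next
    fix n f
    assume IH: "\<And>m. (m, n) \<in> less_than \<Longrightarrow> f m \<in> aut P \<and> R (f m ` B) C (span f m)"
    have PB: "P \<inter> g ` B \<subseteq> C" if "g \<in> aut P" for g
    proof
      fix x assume x: "x \<in> P \<inter> g ` B"
      then obtain b where b: "x = g b" "b \<in> B" by blast
      have "g x = x" using x that by (simp add: aut_def)
      then have "x = b" using b(1) aut_inj[OF that] by (metis injD)
      then show "x \<in> C" using x b(2) P(3) by blast
    qed
    obtain g where g: "g \<in> aut P" "R (g ` B) P (span f n)"
      using indep_exists[OF B(1) small_span P(1,2)] by blast
    have "P \<inter> f m ` B \<subseteq> C" if "m < n" for m
      by (rule PB) (use IH[of m] that in simp)
    then have "P \<inter> (g ` B \<union> span f n) \<subseteq> C"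
      using PB[OF g(1)] unfolding span_def by blast
    then have "R (g ` B) C (span f n)"
      using indep_free[OF small_image[OF B(1)] small_span P(1) g(2)] P(3) by blast
    then show "\<exists>g. g \<in> aut P \<and> R (g ` B) C (span f n)" using g(1) by blast
  qed simp
  then obtain g where g: "\<And>n. g n \<in> aut P" "\<And>n. R (g n ` B) C (span g n)" by blast
  have "g n \<in> aut C" for n using g(1) aut_mono[of C P] P(3) by blast
  then show ?thesis using g by (auto simp: free_seq_def)
qed

lemma copies_Int:
  assumes "g \<in> aut C" "h \<in> aut C" "R (g ` B) C X" "sm X" "h ` B \<subseteq> X"
  shows "g ` B \<inter> h ` B = C"
  using indep_Int[OF copy(1,2)[OF assms(1)] copy(1,2)[OF assms(2)] C(1,2) copy(3)[OF assms(1)] copy(3)[OF assms(2)]]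
    indep_mono[OF copy(1)[OF assms(1)] assms(4) C(1) assms(3)] assms(5) by blast

text \<open>A realisation \<open>q\<close> of the relation \<open>(w, v\<^sub>k) \<equiv> (1, g)\<close> to all \<open>v\<^sub>k\<close> exists because copies of
  \<open>gB\<close> that are free over \<open>B\<close> are free over \<open>C\<close>.  Moving it to be free from the \<open>u\<^sub>i\<close> over the span
  \<open>W\<close> of the \<open>v\<^sub>k\<close> makes it free from them over \<open>C\<close>, since \<open>W\<close> meets everything only in \<open>C\<close>.\<close>

lemma half_graph_step:
  assumes g: "g \<in> aut C" "B \<inter> g ` B = C"
    and u: "\<And>i. i < n \<Longrightarrow> u i \<in> aut C" and v: "free_seq n v"
    and earlier: "\<And>i k. k < i \<Longrightarrow> i < n \<Longrightarrow> \<exists>h\<in>aut C. \<forall>x\<in>B. h x = u i x \<and> h (g x) = v k x"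
    and later: "\<And>i k. i \<le> k \<Longrightarrow> k < n \<Longrightarrow> v k ` B \<inter> u i ` B = C"
  shows "\<exists>w\<in>aut C. R (w ` B) C (span u n) \<and> (\<forall>k<n. \<exists>h\<in>aut C. \<forall>x\<in>B. h x = w x \<and> h (g x) = v k x)"
proof -
  \<comment> \<open>A copy of \<open>g B\<close> is a copy of \<open>B\<close> under
    \<open>p i \<circ> g\<close>. Since \<open>p i\<close> fixes \<open>B\<close>, it also carries
    the pair \<open>B\<close>, \<open>g B\<close> to \<open>B\<close> and this copy.\<close>
  interpret gB: free_copies L M T \<kappa> R "g ` B" C
    by unfold_locales (use copy[OF g(1)] C in auto)
  obtain p where p: "\<And>i. p i \<in> aut B" "gB.free_seq n p"
    using gB.free_seq_over[OF B g(2)] by blast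
  have pC: "p i \<in> aut C" for i using p(1) aut_mono[OF C(3)] by blast
  have pg: "p i \<circ> g \<in> aut C" for i using pC g(1) by (rule aut_comp)
  have pgn: "free_seq n (\<lambda>i. p i \<circ> g)"
    using p(2) pg by (auto simp: free_seq_def gB.free_seq_def span_def gB.span_def image_comp)
  \<comment> \<open>Conjugating that sequence to \<open>v\<close> makes \<open>q \<circ> p i\<close>
    equal to \<open>q\<close> on \<open>B\<close> and send \<open>g x\<close> to
    \<open>v i x\<close>; only independence from the \<open>u i\<close> is still missing, and
    \<open>m\<close> below supplies it.\<close>
  obtain q where "q \<in> aut C" "\<forall>i<n. \<forall>x\<in>B. q ((p i \<circ> g) x) = v i x"
    using free_seq_conjugate[OF pgn v] by blast
  then have q: "q \<in> aut C" "\<And>i x. i < n \<Longrightarrow> x \<in> B \<Longrightarrow> q (p i (g x)) = v i x"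
    by auto
  define W where "W = span v n"
  have CW: "C \<subseteq> W" by (simp add: W_def span_def)
  have W: "sm W" "alg_closed L M W" unfolding W_def using small_span closed_span[OF v] by auto
  obtain m where m: "m \<in> aut W" "R (m ` q ` B) W (span u n)"
    using indep_exists[OF copy(1)[OF q(1)] small_span W] by blast
  have mC: "m \<in> aut C" using m(1) aut_mono[OF CW] by blast
  have "W \<inter> (m ` q ` B \<union> span u n) \<subseteq> C"
  proof
    fix x assume x: "x \<in> W \<inter> (m ` q ` B \<union> span u n)"
    show "x \<in> C"
    proof (cases "x \<in> C")
      case False
      then obtain k b' where k: "k < n" "b' \<in> B" "x = v k b'"
        using x by (auto simp: W_def span_def)
      consider b where "b \<in> B" "x = m (q b)" | i where "i < n" "x \<in> u i ` B"
        using x False by (auto simp: span_def)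
      then show ?thesis
      proof cases
        case 1
        \<comment> \<open>As \<open>m\<close> fixes \<open>x\<close>, the point already lies in
          \<open>q B\<close>; pulled back along \<open>q \<circ> p k\<close> it lands in
          \<open>B \<inter> g B\<close>.\<close>
        have "m x = x" using x m(1) by (simp add: aut_def)
        then have "x = q b" using 1(2) aut_inj[OF m(1)] by (metis injD)
        then have "q (p k (g b')) = q b" using k q(2) by simp
        then have "p k (g b') = b" using aut_inj[OF q(1)] by (metis injD)
        moreover have "p k b = b" using p(1)[of k] 1(1) by (simp add: aut_def)
        ultimately have "g b' = b" using aut_inj[OF pC] by (metis injD)
        then have "b \<in> C" using 1(1) k(2) g(2) by blast
        then show ?thesis using \<open>x = q b\<close> q(1) by (simp add: aut_def)
      next
        case 2
        then obtain b where b: "b \<in> B" "x = u i b" by blast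
        \<comment> \<open>For \<open>k < i\<close> the copies under \<open>u i\<close> and
          \<open>v k\<close> are jointly conjugate to \<open>B\<close> and \<open>g B\<close>; for
          \<open>k \<ge> i\<close> they meet in \<open>C\<close> by \<open>later\<close>.\<close>
        show ?thesis
        proof (cases "k < i")
          case True
          then obtain h where h: "h \<in> aut C" "\<forall>x\<in>B. h x = u i x \<and> h (g x) = v k x"
            using earlier 2(1) by blast
          then have "h b = h (g b')" using b k by simp
          then have "b = g b'" using aut_inj[OF h(1)] by (metis injD)
          then have "b \<in> C" using b(1) k(2) g(2) by blast
          then show ?thesis using b(2) u[OF 2(1)] by (simp add: aut_def)
        next
          case False
          then show ?thesis using later[of i k] k 2(2) by auto
        qed
      qed
    qed
  qed
  then have "R (m ` q ` B) C (span u n)"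
    using indep_free[OF small_image[OF copy(1)[OF q(1)]] small_span W(1) m(2)] CW by blast
  then have "R ((m \<circ> q) ` B) C (span u n)" by (simp add: image_comp)
  moreover have "m \<circ> q \<in> aut C" using mC q(1) by (rule aut_comp)
  moreover have "\<exists>h\<in>aut C. \<forall>x\<in>B. h x = (m \<circ> q) x \<and> h (g x) = v k x" if k: "k < n" for k
  proof (intro bexI ballI conjI)
    show "m \<circ> q \<circ> p k \<in> aut C" using mC q(1) pC by (intro aut_comp)
    fix x assume x: "x \<in> B"
    show "(m \<circ> q \<circ> p k) x = (m \<circ> q) x" using p(1)[of k] x by (simp add: aut_def)
    have "v k x \<in> W" using k x by (auto simp: W_def span_def)
    then show "(m \<circ> q \<circ> p k) (g x) = v k x" using q(2)[OF k x] m(1) by (simp add: aut_def)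
  qed
  ultimately show ?thesis by blast
qed

text \<open>One recursion on pairs: \<open>u n\<close> comes from \<open>half_graph_step\<close>,
  and \<open>v n\<close> is then a copy free over \<open>C\<close> from everything chosen so far,
  \<open>u n\<close> included. This makes \<open>v\<close> a free sequence and lets the copies under
  \<open>v k\<close> and \<open>u i\<close> meet in \<open>C\<close> only for
  \<open>i \<le> k\<close>, as the next step demands.\<close>

lemma half_graph:
  assumes g: "g \<in> aut C" "B \<inter> g ` B = C"
  obtains u v where "\<And>n. u n \<in> aut C" "\<And>n. v n \<in> aut C"
    "\<And>n. R (u n ` B) C (span u n)"
    "\<And>n. R (v n ` B) C (span u (Suc n) \<union> span v n)"
    "\<And>n k. k < n \<Longrightarrow> \<exists>h\<in>aut C. \<forall>x\<in>B. h x = u n x \<and> h (g x) = v k x"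
proof -
  define Q where "Q f n uv \<longleftrightarrow> (case uv of (u, v) \<Rightarrow> u \<in> aut C \<and> v \<in> aut C \<and>
      R (u ` B) C (span (fst \<circ> f) n) \<and>
      R (v ` B) C (span (fst \<circ> f) n \<union> u ` B \<union> span (snd \<circ> f) n) \<and>
      (\<forall>k<n. \<exists>h\<in>aut C. \<forall>x\<in>B. h x = u x \<and> h (g x) = snd (f k) x))" for f :: "nat \<Rightarrow> ('m \<Rightarrow> 'm) \<times> ('m \<Rightarrow> 'm)" and n uv
  have "\<exists>f. \<forall>n. Q f n (f n)"
  proof (rule dependent_wf_choice[of less_than])
    fix f f' :: "nat \<Rightarrow> ('m \<Rightarrow> 'm) \<times> ('m \<Rightarrow> 'm)" and n uv
    assume ff: "\<And>m. (m, n) \<in> less_than \<Longrightarrow> f m = f' m"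
    then have "span (fst \<circ> f) n = span (fst \<circ> f') n" "span (snd \<circ> f) n = span (snd \<circ> f') n"
      by (simp_all add: span_def)
    then show "Q f n uv = Q f' n uv" using ff by (simp add: Q_def split: prod.splits)
  next
    fix n f
    assume IH: "\<And>m. (m, n) \<in> less_than \<Longrightarrow> Q f m (f m)"
    define u v where "u = fst \<circ> f" and "v = snd \<circ> f"
    have uv: "u m \<in> aut C" "v m \<in> aut C"
      "R (v m ` B) C (span u (Suc m) \<union> span v m)"
      "\<forall>k<m. \<exists>h\<in>aut C. \<forall>x\<in>B. h x = u m x \<and> h (g x) = v k x" if "m < n" for m
      using IH[of m] that by (auto simp: Q_def u_def v_def span_Suc Un_ac split: prod.splits)
    have sm: "sm (span u a \<union> span v b)" for a b by (intro small_Un small_span)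
    have "free_seq n v"
      unfolding free_seq_def using uv indep_mono[OF copy(1) sm C(1)] by blast
    moreover have "v k ` B \<inter> u i ` B = C" if "i \<le> k" "k < n" for i k
    proof (rule copies_Int[OF uv(2) _ uv(3) sm])
      show "u i ` B \<subseteq> span u (Suc k) \<union> span v k" 
      proof -
        have "i \<in> {..<Suc k}" using that(1) by simp
        then show ?thesis unfolding span_def by blast
      qed
    qed (use that uv in auto)
    ultimately obtain w where w: "w \<in> aut C" "R (w ` B) C (span u n)"
      "\<forall>k<n. \<exists>h\<in>aut C. \<forall>x\<in>B. h x = w x \<and> h (g x) = v k x"
      using half_graph_step[OF g, of n u v, OF uv(1) _ uv(4)[rule_format]] by force
    obtain z where z: "z \<in> aut C" "R (z ` B) C (span u n \<union> w ` B \<union> span v n)"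
      using indep_exists[OF B(1) _ C(1,2), of "span u n \<union> w ` B \<union> span v n"]
        small_Un[OF small_Un[OF small_span copy(1)[OF w(1)]] small_span] by blast
    have "Q f n (w, z)" using w z by (simp add: Q_def u_def v_def)
    then show "\<exists>uv. Q f n uv" by blast
  qed simp
  then obtain f where f: "\<And>n. Q f n (f n)" by blast
  show ?thesis
    by (rule that[of "fst \<circ> f" "snd \<circ> f"]; insert f)
      (auto simp: Q_def span_Suc Un_ac split_beta)
qed

lemma SOP3_of_configuration:
  fixes a b :: "nat \<Rightarrow> 'm"
  assumes \<Phi>: "dfn {} (\<lambda>s :: nat + nat \<Rightarrow> 'm. \<Phi> (s \<circ> Inl) (s \<circ> Inr))"
    and A: "sm A" "alg_closed L M A" "A \<inter> B = C"
    and g: "g \<in> aut C" "B \<inter> g ` B = C"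
    and ab: "range a \<subseteq> A" "range b \<subseteq> B" "\<Phi> a b"
    and incons: "\<not> (\<exists>x. \<Phi> x b \<and> \<Phi> x (g \<circ> b))"
  shows "SOP3 L M"
proof -
  obtain u v where u: "\<And>n. u n \<in> aut C" "\<And>n. R (u n ` B) C (span u n)"
    and v: "\<And>n. v n \<in> aut C" "\<And>n. R (v n ` B) C (span u (Suc n) \<union> span v n)"
    and uv: "\<And>n k. k < n \<Longrightarrow> \<exists>h\<in>aut C. \<forall>x\<in>B. h x = u n x \<and> h (g x) = v k x"
    by (rule half_graph[OF g], rule that) blast+
  have bB: "b r \<in> B" for r using ab(2) by blast
  \<comment> \<open>A common solution would pull back along \<open>h\<close> to one for
    \<open>b\<close> and \<open>g \<circ> b\<close>.\<close>
  have no: "\<not> (\<exists>x. \<Phi> x (u n \<circ> b) \<and> \<Phi> x (v k \<circ> b))" if "k < n" for k n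
  proof
    assume "\<exists>x. \<Phi> x (u n \<circ> b) \<and> \<Phi> x (v k \<circ> b)"
    then obtain x where x: "\<Phi> x (u n \<circ> b)" "\<Phi> x (v k \<circ> b)" by blast
    obtain h where h: "h \<in> aut C" "\<forall>x\<in>B. h x = u n x \<and> h (g x) = v k x" using uv \<open>k < n\<close> by blast
    have "u n \<circ> b = h \<circ> b" "v k \<circ> b = h \<circ> (g \<circ> b)" using h(2) bB by (auto simp: fun_eq_iff)
    moreover have "x = h \<circ> (inv h \<circ> x)"
      using aut_bij[OF h(1)] by (simp add: fun_eq_iff bij_is_surj surj_f_inv_f)
    ultimately have "\<Phi> (inv h \<circ> x) b" "\<Phi> (inv h \<circ> x) (g \<circ> b)"
      using x dfn_binary_aut[OF \<Phi> h(1)] by metis+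
    then show False using incons by blast
  qed
  \<comment> \<open>The members of this sequence fix \<open>a\<close>, so \<open>a\<close> solves
    \<open>\<Phi>\<close> along it; conjugacy transfers solvability to finite parts of every free
    sequence.\<close>
  obtain p where p: "\<And>i. p i \<in> aut A" "\<And>n. free_seq n p"
    using free_seq_over[OF A] by blast
  have pb: "\<Phi> a (p i \<circ> b)" for i
  proof -
    have "p i \<circ> a = a" using p(1)[of i] ab(1) by (auto simp: aut_def fun_eq_iff)
    then show ?thesis using dfn_binary_aut[OF \<Phi> p(1), of i a b] ab(3) by (simp only:)
  qed
  have "\<exists>x. (\<forall>i\<le>j. \<Phi> x (u i \<circ> b)) \<and> (\<forall>k\<ge>j. \<Phi> x (v k \<circ> b))" for j
  proof -
    \<comment> \<open>The sequence \<open>u 0, ..., u j, v j, v (j + 1), ...\<close>; since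
      \<open>v j\<close> follows \<open>u j\<close>, indices after \<open>j\<close> are shifted by
      one.\<close>
    define s where "s i = (if i \<le> j then u i else v (i - 1))" for i
    have fs: "free_seq n s" for n
      unfolding free_seq_def
    proof (intro allI impI conjI)
      fix i
      show "s i \<in> aut C" using u v by (simp add: s_def)
      show "R (s i ` B) C (span s i)"
      proof (cases "i \<le> j")
        case True
        then have "span s i = span u i" by (auto simp: span_def s_def)
        then show ?thesis using u(2) True by (simp add: s_def)
      next
        case False
        \<comment> \<open>Here \<open>j \<le> i - 1\<close>, so everything before
          \<open>s i = v (i - 1)\<close> belongs to what \<open>v (i - 1)\<close> was chosen free
          from.\<close>
        have "span s i \<subseteq> span u (Suc (i - 1)) \<union> span v (i - 1)"
        proof
          fix x assume "x \<in> span s i"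
          then consider "x \<in> C" | l where "l < i" "x \<in> s l ` B" by (auto simp: span_def)
          then show "x \<in> span u (Suc (i - 1)) \<union> span v (i - 1)"
          proof cases
            case 2
            show ?thesis
            proof (cases "l \<le> j")
              case True
              then have "x \<in> u l ` B" "l \<in> {..<Suc (i - 1)}" using 2 by (auto simp: s_def)
              then show ?thesis unfolding span_def by blast
            next
              case False
              then have "x \<in> v (l - 1) ` B" "l - 1 \<in> {..<i - 1}" using 2 by (auto simp: s_def)
              then show ?thesis unfolding span_def by blast
            qed
          qed (simp add: span_def)
        qed
        then have "R (v (i - 1) ` B) C (span s i)"
          by (rule indep_mono[OF copy(1)[OF v(1)] small_Un[OF small_span small_span] C(1) v(2) order_refl])
        then show ?thesis using False by (simp add: s_def)
      qed
    qed
    have "\<exists>x. \<forall>P\<in>(\<lambda>i x. \<Phi> x (s i \<circ> b)) ` UNIV. P x"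
    proof (rule realise_tuple[of "range (\<lambda>(i, r). s i (b r))"])
      show "sm (range (\<lambda>(i, r). s i (b r)))" by (rule small_range)
      show "dfn (range (\<lambda>(i, r). s i (b r))) P" if P: "P \<in> (\<lambda>i x. \<Phi> x (s i \<circ> b)) ` UNIV" for P
      proof -
        obtain i where P: "P = (\<lambda>x. \<Phi> x (s i \<circ> b))" using P by blast
        show ?thesis unfolding P by (rule dfn_binary_param[OF \<Phi>]) auto
      qed
      fix \<Q> assume "finite \<Q>" "\<Q> \<subseteq> (\<lambda>i x. \<Phi> x (s i \<circ> b)) ` UNIV"
      then obtain I where I: "finite I" "\<Q> = (\<lambda>i x. \<Phi> x (s i \<circ> b)) ` I"
        by (meson finite_subset_image)
      obtain n where n: "\<And>i. i \<in> I \<Longrightarrow> i < n"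
        using I(1) finite_nat_set_iff_bounded[of I] by blast
      obtain k where k: "k \<in> aut C" "\<forall>i<n. \<forall>x\<in>B. k (p i x) = s i x"
        using free_seq_conjugate[OF p(2) fs] by blast
      have "\<Phi> (k \<circ> a) (s i \<circ> b)" if i: "i \<in> I" for i
      proof -
        have "s i \<circ> b = k \<circ> (p i \<circ> b)" using k(2) n[OF i] bB by (auto simp: fun_eq_iff)
        then show ?thesis using dfn_binary_aut[OF \<Phi> k(1)] pb by (simp only:)
      qed
      then show "\<exists>x. \<forall>P\<in>\<Q>. P x" using I(2) by blast
    qed
    then obtain x where x: "\<And>i. \<Phi> x (s i \<circ> b)" by auto
    have "\<Phi> x (u i \<circ> b)" if "i \<le> j" for i using x[of i] that by (simp add: s_def)
    moreover have "\<Phi> x (v k \<circ> b)" if "k \<ge> j" for k using x[of "Suc k"] that by (simp add: s_def)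
    ultimately show ?thesis by blast
  qed
  then obtain w where w: "\<And>i j. i \<le> j \<Longrightarrow> \<Phi> (w j) (u i \<circ> b)" "\<And>j k. j \<le> k \<Longrightarrow> \<Phi> (w j) (v k \<circ> b)"
    by metis
  \<comment> \<open>A tuple \<open>s\<close> codes the triple of its subsequences at the indices \<open>0\<close>, \<open>1\<close> and \<open>2\<close> modulo \<open>3\<close>,
    standing for \<open>u\<close>, \<open>v\<close> and \<open>w\<close>.\<close>
  define E where "E s t \<longleftrightarrow> \<Phi> (\<lambda>r. t (3 * r + 2)) (\<lambda>r. s (3 * r)) \<and> \<Phi> (\<lambda>r. s (3 * r + 2)) (\<lambda>r. t (3 * r + 1)) \<and>
     \<not> (\<exists>x. \<Phi> x (\<lambda>r. t (3 * r)) \<and> \<Phi> x (\<lambda>r. s (3 * r + 1)))" for s t :: "nat \<Rightarrow> 'm"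
  define t where "t i r = (if r mod 3 = 0 then u i (b (r div 3)) else if r mod 3 = 1 then v i (b (r div 3))
     else w i (r div 3))" for i r
  show ?thesis
  proof (rule SOP3_I[of E t])
    show "dfn {} (\<lambda>s. E (s \<circ> Inl) (s \<circ> Inr))"
      unfolding E_def comp_def
      by (intro dfn_conj dfn_neg dfn_binary[OF \<Phi>] dfn_binary[OF dfn_common[OF \<Phi>]])
    \<comment> \<open>The \<open>w\<close>-part of \<open>z\<close> solves \<open>\<Phi>\<close> at
      the \<open>u\<close>-part of \<open>y\<close>, by \<open>E y z\<close>, and at the
      \<open>v\<close>-part of \<open>x\<close>, by \<open>E z x\<close>; \<open>E x y\<close>
      forbids this.\<close>
    show "\<not> (E x y \<and> E y z \<and> E z x)" for x y z unfolding E_def by blast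
    fix i j :: nat assume ij: "i < j"
    have "(3 * r + 2) mod 3 = (2 :: nat)" "(3 * r + 1) mod 3 = (1 :: nat)"
      "(3 * r + 2) div 3 = r" "(3 * r + 1) div 3 = r" for r :: nat by presburger+
    then have "(\<lambda>r. t i (3 * r)) = u i \<circ> b" "(\<lambda>r. t i (3 * r + 1)) = v i \<circ> b" "(\<lambda>r. t i (3 * r + 2)) = w i" for i
      by (simp_all add: t_def fun_eq_iff)
    then show "E (t i) (t j)" using w ij no unfolding E_def by simp
  qed
qed

end

section \<open>Finite satisfiability and algebraic closure\<close>

text \<open>For fixed \<open>N\<close> the right-hand side is a negated clique as in
  \<open>dfn_clique\<close>; in this form finiteness of a number of classes enters formulas.\<close>

lemma finite_range_iff_bounded:
  "finite (range f) \<longleftrightarrow> (\<exists>N :: nat. \<forall>y :: nat \<Rightarrow> _. \<exists>k\<le>N. \<exists>l<k. f (y k) = f (y l))"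
proof
  assume fin: "finite (range f)"
  have "\<exists>k\<le>card (range f). \<exists>l<k. f (y k) = f (y l)" for y :: "nat \<Rightarrow> _"
  proof -
    have "card ((\<lambda>k. f (y k)) ` {..card (range f)}) \<le> card (range f)"
      by (rule card_mono[OF fin]) auto
    then have "\<not> inj_on (\<lambda>k. f (y k)) {..card (range f)}"
      by (intro pigeonhole) simp
    then obtain k l where "k \<le> card (range f)" "l \<le> card (range f)" "k \<noteq> l" "f (y k) = f (y l)"
      by (auto simp: inj_on_def)
    then show ?thesis by (metis nat_neq_iff)
  qed
  then show "\<exists>N :: nat. \<forall>y :: nat \<Rightarrow> _. \<exists>k\<le>N. \<exists>l<k. f (y k) = f (y l)" by blast
next
  assume "\<exists>N :: nat. \<forall>y :: nat \<Rightarrow> _. \<exists>k\<le>N. \<exists>l<k. f (y k) = f (y l)"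
  then obtain N where N: "\<And>y :: nat \<Rightarrow> _. \<exists>k\<le>N. \<exists>l<k. f (y k) = f (y l)" by blast
  show "finite (range f)"
  proof (rule ccontr)
    assume "infinite (range f)"
    then obtain e :: "nat \<Rightarrow> _" where e: "inj e" "range e \<subseteq> range f"
      using infinite_countable_subset by blast
    have "f (inv f (e k)) = e k" for k using e(2) by (intro f_inv_into_f) auto
    then show False using N[of "\<lambda>k. inv f (e k)"] e(1) by (auto dest: injD)
  qed
qed

text \<open>In the pair \<open>h i\<close>, the first node continues the path and the second one branches off it.\<close>

lemma tree_array:
  fixes col :: "(nat \<Rightarrow> bool list \<times> bool list) \<Rightarrow> nat \<Rightarrow> bool list \<Rightarrow> 'c"
  assumes fin: "\<And>h i. finite (range (col h i))"
    and adm: "\<And>h h' i. (\<And>j. j < i \<Longrightarrow> h j = h' j) \<Longrightarrow> col h i = col h' i"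
  shows "\<exists>h. (\<forall>i. col h i (fst (h i)) = col h i (snd (h i))) \<and>
    (\<forall>i j. i \<le> j \<longrightarrow> prefix (fst (h i)) (fst (h j))) \<and>
    (\<forall>i. length (fst (h i)) < length (fst (h (Suc i)))) \<and>
    (\<forall>i. \<exists>\<nu>. snd (h i) = \<nu> @ [True] \<and> prefix (\<nu> @ [False]) (fst (h i)))"
proof -
  \<comment> \<open>The tip of the path before stage \<open>i\<close>, starting at the root.\<close>
  define node where "node h i = (if i = 0 then [] else fst (h (i - 1)))"
    for h :: "nat \<Rightarrow> bool list \<times> bool list" and i :: nat
  define Q where "Q h i p \<longleftrightarrow> col h i (fst p) = col h i (snd p) \<and>
    (\<exists>\<alpha> \<beta>. \<alpha> < \<beta> \<and> snd p = node h i @ replicate \<alpha> False @ [True] \<and>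
       fst p = node h i @ replicate \<beta> False @ [True])" for h i p
  have "\<exists>h. \<forall>i. Q h i (h i)"
  proof (rule dependent_wf_choice[of less_than])
    fix h h' :: "nat \<Rightarrow> bool list \<times> bool list" and i p
    assume hh: "\<And>j. (j, i) \<in> less_than \<Longrightarrow> h j = h' j"
    then have "col h i = col h' i" "node h i = node h' i"
      by (auto intro!: adm simp: node_def)
    then show "Q h i p = Q h' i p" by (simp add: Q_def)
  next
    fix i h
    \<comment> \<open>Infinitely many nodes leave the all-\<open>False\<close> branch above the tip,
      so two of them share a colour. The one leaving later continues the path; the other branches
      off it.\<close>
    define f where "f \<alpha> = col h i (node h i @ replicate \<alpha> False @ [True])" for \<alpha>
    have "finite (range f)" by (rule finite_subset[OF _ fin[of h i]]) (auto simp: f_def)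
    then have "\<not> inj f" using finite_imageD[of f UNIV] by auto
    then obtain \<alpha> \<beta> where "\<alpha> < \<beta>" "f \<alpha> = f \<beta>" by (metis injI nat_neq_iff)
    then show "\<exists>p. Q h i p"
      by (intro exI[of _ "(node h i @ replicate \<beta> False @ [True], node h i @ replicate \<alpha> False @ [True])"])
        (auto simp: Q_def f_def)
  qed simp
  then obtain h where h: "\<And>i. Q h i (h i)" by blast
  have step: "prefix (fst (h i)) (fst (h (Suc i)))" "length (fst (h i)) < length (fst (h (Suc i)))" for i
    using h[of "Suc i"] by (auto simp: Q_def node_def)
  have "prefix (fst (h i)) (fst (h j))" if "i \<le> j" for i j
    using that by (induction j rule: dec_induct) (auto intro: step prefix_order.trans)
  moreover have "\<exists>\<nu>. snd (h i) = \<nu> @ [True] \<and> prefix (\<nu> @ [False]) (fst (h i))" for i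
  proof -
    obtain \<alpha> \<beta> where ab: "\<alpha> < \<beta>" "snd (h i) = node h i @ replicate \<alpha> False @ [True]"
      "fst (h i) = node h i @ replicate \<beta> False @ [True]"
      using h[of i] by (auto simp: Q_def)
    have "replicate \<beta> False = replicate \<alpha> False @ [False] @ replicate (\<beta> - \<alpha> - 1) False"
      using ab(1) by (simp flip: replicate_add replicate_Suc)
    then have "prefix ((node h i @ replicate \<alpha> False) @ [False]) (fst (h i))"
      unfolding ab(3) by (simp add: prefix_def)
    then show ?thesis using ab(2) by (intro exI[of _ "node h i @ replicate \<alpha> False"]) simp
  qed
  ultimately show ?thesis using h step(2) by (intro exI[of _ h]) (auto simp: Q_def)
qed

context monster
begin

text \<open>Choose \<open>\<Theta>\<close> over \<open>C \<union> E\<close> with the least number of solutions among the formulas satisfied by \<open>e\<close>.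
  That \<open>\<Theta>\<close> meets an algebraic formula \<open>P(y, c)\<close> with at most \<open>N\<close> solutions passes from \<open>c\<close> to some
  \<open>z\<close> in \<open>C\<close>, so \<open>\<Theta>\<close> has a solution in \<open>C\<close>; by minimality this is \<open>e\<close>.\<close>

lemma acl_Int_of_finitely_satisfiable:
  fixes c :: "nat \<Rightarrow> 'm"
  assumes C: "alg_closed L M C"
    and fs: "\<And>P. dfn (C \<union> E) P \<Longrightarrow> P c \<Longrightarrow> \<exists>z :: nat \<Rightarrow> 'm. range z \<subseteq> C \<and> P z"
  shows "acl L M (C \<union> range c) \<inter> acl L M (C \<union> E) = C"
proof
  show "C \<subseteq> acl L M (C \<union> range c) \<inter> acl L M (C \<union> E)"
    using acl_extensive by blast
  show "acl L M (C \<union> range c) \<inter> acl L M (C \<union> E) \<subseteq> C"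
  proof
    fix e assume e: "e \<in> acl L M (C \<union> range c) \<inter> acl L M (C \<union> E)"
    then obtain P0 where P0: "dfn1 (C \<union> range c) P0" "P0 e" "finite {d. P0 d}"
      using acl_iff[of e "C \<union> range c"] by auto
    \<comment> \<open>The parameters \<open>c\<close> become variables, so that \<open>P\<close> can
      be evaluated at tuples from \<open>C\<close>.\<close>
    obtain G :: "(unit + nat \<Rightarrow> 'm) \<Rightarrow> bool"
      where G: "dfn C G" "\<And>a. P0 (a ()) = G (case_sum a c)"
      using dfn_abstract[OF P0(1)] by metis
    define P where "P y z \<longleftrightarrow> G (case_sum (\<lambda>_. y) z)" for y z
    have P0P: "P0 = (\<lambda>y. P y c)" using G(2)[of "\<lambda>_. y" for y] by (simp add: P_def fun_eq_iff)
    define N where "N = card {d. P0 d}"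
    \<comment> \<open>For \<open>N = 0\<close> the condition on \<open>ys\<close> in
      \<open>S\<close> below would hold vacuously, and \<open>S\<close> would never be true.\<close>
    have N: "0 < N" unfolding N_def using P0(2,3) card_gt_0_iff by blast
    obtain \<Theta> where \<Theta>: "dfn1 (C \<union> E) \<Theta>" "\<Theta> e" "finite {d. \<Theta> d}"
      and least: "\<And>Q. dfn1 (C \<union> E) Q \<Longrightarrow> Q e \<Longrightarrow> finite {d. Q d} \<Longrightarrow> card {d. \<Theta> d} \<le> card {d. Q d}"
    proof -
      let ?Q = "\<lambda>Q. dfn1 (C \<union> E) Q \<and> Q e \<and> finite {d. Q d}"
      obtain Q where "?Q Q" using e acl_iff[of e "C \<union> E"] by auto
      from ex_has_least_nat[of ?Q, OF this, of "\<lambda>Q. card {d. Q d}"]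
      obtain \<Theta> where "?Q \<Theta> \<and> (\<forall>Q. ?Q Q \<longrightarrow> card {d. \<Theta> d} \<le> card {d. Q d})" by (rule exE)
      then show ?thesis by (intro that[of \<Theta>]) simp_all
    qed
    \<comment> \<open>\<open>S z\<close> says that the formula \<open>P\<close> with parameters
      \<open>z\<close> shares a solution with \<open>\<Theta>\<close> and has at most
      \<open>N\<close> solutions; the bound makes the shared solution algebraic over
      \<open>z\<close>.\<close>
    define S where "S z \<longleftrightarrow> (\<exists>y. P y z \<and> \<Theta> y) \<and>
      \<not> (\<exists>ys :: nat \<Rightarrow> unit \<Rightarrow> 'm. \<forall>k\<le>N. \<forall>l<k. P (ys k ()) z \<and> P (ys l ()) z \<and> ys k () \<noteq> ys l ())" for z
    have P_unit: "P (y ()) z = G (case_sum y z)" for y :: "unit \<Rightarrow> 'm" and z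
      by (auto simp: P_def intro!: arg_cong[of _ _ G] split: sum.splits)
    have dS: "dfn (C \<union> E) S"
    proof -
      have G': "dfn (C \<union> E) G" by (rule dfn_mono[OF G(1)]) simp
      have "dfn (C \<union> E) (\<lambda>s :: nat + unit \<Rightarrow> 'm.
          G (\<lambda>i. s (case_sum Inr Inl i)) \<and> \<Theta> (s (Inr ())))"
        using dfn_conj[OF dfn_reindex[OF G', of "case_sum Inr Inl"] dfn_reindex[OF \<Theta>(1), of Inr]] .
      from dfn_ex[OF this]
      have "dfn (C \<union> E) (\<lambda>z. \<exists>y :: unit \<Rightarrow> 'm. G (\<lambda>i. case_sum z y (case_sum Inr Inl i)) \<and> \<Theta> (y ()))"
        by simp
      moreover have "(\<lambda>i. case_sum z y (case_sum Inr Inl i)) = case_sum y z" for z :: "nat \<Rightarrow> 'm" and y :: "unit \<Rightarrow> 'm"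
        by (auto split: sum.splits)
      moreover have "(\<exists>y :: unit \<Rightarrow> 'm. G (case_sum y z) \<and> \<Theta> (y ())) \<longleftrightarrow> (\<exists>y. P y z \<and> \<Theta> y)" for z
      proof
        assume "\<exists>y. P y z \<and> \<Theta> y"
        then obtain y where "P y z" "\<Theta> y" by blast
        then show "\<exists>y :: unit \<Rightarrow> 'm. G (case_sum y z) \<and> \<Theta> (y ())"
          by (intro exI[of _ "\<lambda>_. y"]) (simp add: P_def)
      qed (auto simp: P_unit[symmetric])
      ultimately have d1: "dfn (C \<union> E) (\<lambda>z. \<exists>y. P y z \<and> \<Theta> y)" by simp
      define K1 :: "unit + nat \<Rightarrow> nat + (unit + unit)" where "K1 = case_sum (\<lambda>_. Inr (Inl ())) Inl"
      define K2 :: "unit + nat \<Rightarrow> nat + (unit + unit)" where "K2 = case_sum (\<lambda>_. Inr (Inr ())) Inl"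
      have K: "(\<lambda>i. case_sum z (case_sum y y') (K1 i)) = case_sum y z"
        "(\<lambda>i. case_sum z (case_sum y y') (K2 i)) = case_sum y' z" for z :: "nat \<Rightarrow> 'm" and y y' :: "unit \<Rightarrow> 'm"
        by (auto simp: K1_def K2_def split: sum.splits)
      have "dfn (C \<union> E) (\<lambda>s :: nat + (unit + unit) \<Rightarrow> 'm.
          G (\<lambda>i. s (K1 i)) \<and> G (\<lambda>i. s (K2 i)) \<and> s (Inr (Inl ())) \<noteq> s (Inr (Inr ())))"
        by (intro dfn_conj dfn_neg dfn_eq dfn_reindex[OF G', of K1] dfn_reindex[OF G', of K2])
      from dfn_clique[OF this, of N]
      have "dfn (C \<union> E) (\<lambda>z. \<exists>ys :: nat \<Rightarrow> unit \<Rightarrow> 'm. \<forall>k\<le>N. \<forall>l<k. P (ys k ()) z \<and> P (ys l ()) z \<and> ys k () \<noteq> ys l ())"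
        by (simp add: K P_unit)
      from dfn_conj[OF d1 dfn_neg[OF this]] show ?thesis unfolding S_def .
    qed
    have "S c"
      unfolding S_def
    proof (intro conjI notI)
      show "\<exists>y. P y c \<and> \<Theta> y" using P0(2) \<Theta>(2) unfolding P0P by blast
      assume "\<exists>ys :: nat \<Rightarrow> unit \<Rightarrow> 'm. \<forall>k\<le>N. \<forall>l<k. P (ys k ()) c \<and> P (ys l ()) c \<and> ys k () \<noteq> ys l ()"
      then obtain ys :: "nat \<Rightarrow> unit \<Rightarrow> 'm" where ys: "\<And>k l. k \<le> N \<Longrightarrow> l < k \<Longrightarrow> P (ys k ()) c \<and> P (ys l ()) c \<and> ys k () \<noteq> ys l ()"
        by blast
      have "k = l" if "k \<le> N" "l \<le> N" "ys k () = ys l ()" for k l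
        using ys[of k l] ys[of l k] that by (cases k l rule: linorder_cases) auto
      then have "inj_on (\<lambda>k. ys k ()) {..N}" by (auto simp: inj_on_def)
      moreover have "(\<lambda>k. ys k ()) ` {..N} \<subseteq> {d. P0 d}"
      proof
        fix d assume "d \<in> (\<lambda>k. ys k ()) ` {..N}"
        then obtain k where k: "k \<le> N" "d = ys k ()" by blast
        show "d \<in> {d. P0 d}"
          using ys[of N 0] ys[of N k] k N unfolding P0P by (cases "k = N") simp_all
      qed
      ultimately have "card {..N} \<le> N" unfolding N_def using card_inj_on_le P0(3) by blast
      then show False by simp
    qed
    then obtain z where z: "range z \<subseteq> C" "S z" using fs[OF dS] by blast
    then obtain e' where e': "P e' z" "\<Theta> e'" unfolding S_def by blast
    have "finite {d. P d z}"
    proof (rule ccontr)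
      assume "infinite {d. P d z}"
      then obtain f :: "nat \<Rightarrow> 'm" where f: "inj f" "range f \<subseteq> {d. P d z}"
        using infinite_countable_subset by blast
      have "P (f k) z" for k using f(2) by blast
      moreover have "f k \<noteq> f l" if "l < k" for k l using injD[OF f(1), of k l] that by blast
      ultimately have "\<exists>ys :: nat \<Rightarrow> unit \<Rightarrow> 'm. \<forall>k\<le>N. \<forall>l<k. P (ys k ()) z \<and> P (ys l ()) z \<and> ys k () \<noteq> ys l ()"
        by (intro exI[of _ "\<lambda>k _. f k"]) simp
      then show False using z(2) unfolding S_def by (elim conjE notE)
    qed
    moreover have "dfn1 C (\<lambda>d. P d z)"
    proof -
      have "dfn C (\<lambda>a :: unit \<Rightarrow> 'm. G (\<lambda>i. case_sum a id (case_sum Inl (\<lambda>r. Inr (z r)) i)))"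
        by (rule dfn_param[OF G(1)]) (use z(1) in \<open>auto split: sum.splits\<close>)
      moreover have "(\<lambda>i. case_sum a id (case_sum Inl (\<lambda>r. Inr (z r)) i)) = case_sum a z" for a :: "unit \<Rightarrow> 'm"
        by (auto split: sum.splits)
      ultimately show ?thesis by (simp add: P_unit)
    qed
    ultimately have "e' \<in> acl L M C" unfolding acl_iff using e'(1) by (intro exI[of _ "\<lambda>d. P d z"]) simp
    then have e'C: "e' \<in> C" using C by (simp add: alg_closed_def)
    have "e = e'"
    proof (rule ccontr)
      assume ne: "e \<noteq> e'"
      have "dfn1 (C \<union> E) (\<lambda>d. \<Theta> d \<and> d \<noteq> e')"
        using e'C by (intro dfn_conj[OF \<Theta>(1)] dfn_neg dfn_eq_param) auto
      then have "card {d. \<Theta> d} \<le> card {d. \<Theta> d \<and> d \<noteq> e'}"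
        by (rule least) (use \<Theta> ne in auto)
      moreover have "card {d. \<Theta> d \<and> d \<noteq> e'} < card {d. \<Theta> d}"
        using \<Theta>(3) e'(2) by (intro psubset_card_mono) auto
      ultimately show False by simp
    qed
    then show "e \<in> C" using e'C by simp
  qed
qed

end

section \<open>From the tree of SOP1 to an array\<close>

context lstruct
begin

text \<open>Equality of \<open>cls G z\<close>, when \<open>cls G z\<close> takes finitely many values, is a finite equivalence
  relation definable over \<open>z\<close>.  Agreement on all of these amounts to equality of types over the
  algebraic closure of \<open>z\<close>, and only finitely many colours are needed for finitely many of them.\<close>

definition cls :: "(('w + nat) + 'z \<Rightarrow> 'm) set \<Rightarrow> ('z \<Rightarrow> 'm) \<Rightarrow> (nat \<Rightarrow> 'm) \<Rightarrow> ('w \<Rightarrow> 'm) set" where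
  "cls G z y = {w. case_sum (case_sum w y) z \<in> G}"

definition bounded :: "(('w + nat) + 'z \<Rightarrow> 'm) set \<Rightarrow> nat \<Rightarrow> ('z \<Rightarrow> 'm) \<Rightarrow> bool" where
  "bounded G N z \<longleftrightarrow> (\<forall>y :: nat \<Rightarrow> nat \<Rightarrow> 'm. \<exists>k\<le>N. \<exists>l<k. cls G z (y k) = cls G z (y l))"

lemma dfn_cls_eq:
  fixes G :: "(('w + nat) + 'z \<Rightarrow> 'm) set"
  assumes "dfn {} (\<lambda>s. s \<in> G)"
  shows "dfn {} (\<lambda>u :: 'z + (nat + nat) \<Rightarrow> 'm.
    cls G (u \<circ> Inl) (u \<circ> Inr \<circ> Inl) = cls G (u \<circ> Inl) (u \<circ> Inr \<circ> Inr))"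
proof -
  define r :: "(nat \<Rightarrow> nat + nat) \<Rightarrow> ('w + nat) + 'z \<Rightarrow> ('z + (nat + nat)) + 'w" where
    "r j = case_sum (case_sum Inr (Inl \<circ> Inr \<circ> j)) (Inl \<circ> Inl)" for j
  have r: "(\<lambda>i. case_sum u w (r j i)) = case_sum (case_sum w (u \<circ> Inr \<circ> j)) (u \<circ> Inl)"
    for u :: "'z + (nat + nat) \<Rightarrow> 'm" and w j
    by (auto simp: r_def fun_eq_iff split: sum.splits)
  have "dfn {} (\<lambda>s. ((\<lambda>i. s (r Inl i)) \<in> G) = ((\<lambda>i. s (r Inr i)) \<in> G))"
    by (intro dfn_iff dfn_reindex[OF assms, of "r Inl"] dfn_reindex[OF assms, of "r Inr"])
  from dfn_all[OF this] show ?thesis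
    unfolding r by (simp add: cls_def set_eq_iff)
qed

lemma dfn_bounded:
  fixes G :: "(('w + nat) + 'z \<Rightarrow> 'm) set"
  assumes "dfn {} (\<lambda>s. s \<in> G)"
  shows "dfn {} (bounded G N)"
  using dfn_neg[OF dfn_clique[OF dfn_neg[OF dfn_cls_eq[OF assms]], of N]]
  by (simp add: bounded_def[abs_def] comp_def)

end

context monster
begin

text \<open>\<open>s \<circ> below i\<close> enumerates the entries of an array \<open>s\<close> of pairs that come before the \<open>i\<close>-th pair;
  the fallback value is one of these only for \<open>i > 0\<close>.\<close>

definition below :: "nat \<Rightarrow> nat \<times> bool \<times> nat \<Rightarrow> nat \<times> bool \<times> nat" where
  "below i p = (if fst p < i then p else (0, False, 0))"

text \<open>By compactness finitely many conditions are treated at a time. They involve finitely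
  many equivalence relations, and those with boundedly many classes give a finite colouring for
  \<open>tree_array\<close>.\<close>

lemma array_of_tree:
  fixes \<beta> :: "bool list \<Rightarrow> nat \<Rightarrow> 'm"
  assumes \<Phi>: "dfn {} (\<lambda>s :: nat + nat \<Rightarrow> 'm. \<Phi> (s \<circ> Inl) (s \<circ> Inr))"
    and branch: "\<And>\<sigma> n. \<exists>x. \<forall>m<n. \<Phi> x (\<beta> (map \<sigma> [0..<m]))"
    and incons: "\<forall>\<eta>1 \<eta>2. prefix (\<eta>1 @ [False]) \<eta>2 \<longrightarrow> \<not> (\<exists>x. \<Phi> x (\<beta> \<eta>2) \<and> \<Phi> x (\<beta> (\<eta>1 @ [True])))"
  shows "\<exists>(c :: nat \<times> bool \<times> nat \<Rightarrow> 'm) a.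
    (\<forall>i. \<Phi> a (\<lambda>r. c (i, False, r))) \<and>
    (\<forall>i j. i < j \<longrightarrow> \<not> (\<exists>x. \<Phi> x (\<lambda>r. c (i, True, r)) \<and> \<Phi> x (\<lambda>r. c (j, False, r)))) \<and>
    (\<forall>(G :: ('m \<Rightarrow> 'm) \<Rightarrow> (nat \<Rightarrow> 'm) \<Rightarrow> bool) i. 0 < i \<longrightarrow>
      dfn (c ` {p. fst p < i}) (\<lambda>s. G (s \<circ> Inl) (s \<circ> Inr)) \<longrightarrow> finite (range (\<lambda>y. {w. G w y})) \<longrightarrow>
      {w. G w (\<lambda>r. c (i, False, r))} = {w. G w (\<lambda>r. c (i, True, r))})"
proof -
  \<comment> \<open>Boundedness is a hypothesis inside the condition, which makes it definable
    without parameters.\<close>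
  define agree where "agree = (\<lambda>(G :: (('m + nat) + (nat \<times> bool \<times> nat) \<Rightarrow> 'm) set, N, i) (s :: (nat \<times> bool \<times> nat) + nat \<Rightarrow> 'm).
      bounded G N (\<lambda>p. s (Inl (below i p))) \<longrightarrow>
        cls G (\<lambda>p. s (Inl (below i p))) (\<lambda>r. s (Inl (i, False, r))) =
        cls G (\<lambda>p. s (Inl (below i p))) (\<lambda>r. s (Inl (i, True, r))))"
  define solves where "solves i s = \<Phi> (\<lambda>r. s (Inr r)) (\<lambda>r. s (Inl (i, False, r)))"
    for i and s :: "(nat \<times> bool \<times> nat) + nat \<Rightarrow> 'm"
  define apart where "apart = (\<lambda>(i, j) (s :: (nat \<times> bool \<times> nat) + nat \<Rightarrow> 'm).
      \<not> (\<exists>x. \<Phi> x (\<lambda>r. s (Inl (i, True, r))) \<and> \<Phi> x (\<lambda>r. s (Inl (j, False, r)))))"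
  \<comment> \<open>The case \<open>i = 0\<close> is excluded because the fallback value in
    \<open>below\<close> is then not an earlier entry.\<close>
  define X where "X = {(G :: (('m + nat) + (nat \<times> bool \<times> nat) \<Rightarrow> 'm) set, N :: nat, i :: nat). dfn {} (\<lambda>s. s \<in> G) \<and> 0 < i}"
  define Y where "Y = {(i :: nat, j). i < j}"
  have "\<exists>s. \<forall>P \<in> agree ` X \<union> solves ` UNIV \<union> apart ` Y. P s"
  proof (rule realise_tuple[of "{}"])
    show "sm {}" by (simp add: small_finite)
    have "dfn {} (agree x)" if xX: "x \<in> X" for x
    proof -
      obtain G N i where x: "x = (G, N, i)" "dfn {} (\<lambda>s. s \<in> G)" using xX by (auto simp: X_def)
      have "dfn {} (\<lambda>s :: (nat \<times> bool \<times> nat) + nat \<Rightarrow> 'm. bounded G N (\<lambda>p. s (Inl (below i p))))"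
        by (rule dfn_reindex[OF dfn_bounded[OF x(2)]])
      moreover have "dfn {} (\<lambda>s :: (nat \<times> bool \<times> nat) + nat \<Rightarrow> 'm.
          cls G (\<lambda>p. s (Inl (below i p))) (\<lambda>r. s (Inl (i, False, r))) =
          cls G (\<lambda>p. s (Inl (below i p))) (\<lambda>r. s (Inl (i, True, r))))"
        using dfn_reindex[OF dfn_cls_eq[OF x(2)],
          of "case_sum (\<lambda>p. Inl (below i p)) (case_sum (\<lambda>r. Inl (i, False, r)) (\<lambda>r. Inl (i, True, r)))"]
        by (simp add: comp_def)
      ultimately show ?thesis unfolding agree_def x by (simp add: dfn_imp)
    qed
    moreover have "dfn {} (solves i)" for i unfolding solves_def by (rule dfn_binary[OF \<Phi>])
    moreover have "dfn {} (apart p)" for p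
    proof (cases p)
      case (Pair i j)
      show ?thesis unfolding apart_def Pair prod.case
        by (rule dfn_neg[OF dfn_binary[OF dfn_common[OF \<Phi>]]])
    qed
    ultimately show "dfn {} P" if "P \<in> agree ` X \<union> solves ` UNIV \<union> apart ` Y" for P using that by auto
    fix \<Q> assume \<Q>: "finite \<Q>" "\<Q> \<subseteq> agree ` X \<union> solves ` UNIV \<union> apart ` Y"
    have "finite (\<Q> \<inter> agree ` X)" using \<Q>(1) by simp
    then obtain \<Delta> where \<Delta>: "finite \<Delta>" "\<Delta> \<subseteq> X" "\<Q> \<inter> agree ` X = agree ` \<Delta>"
      by (metis finite_subset_image inf_le2)
    have "finite (\<Q> \<inter> solves ` UNIV)" using \<Q>(1) by simp
    then obtain I where I: "finite I" "\<Q> \<inter> solves ` UNIV = solves ` I"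
      by (metis finite_subset_image inf_le2)
    obtain n where n: "\<And>i. i \<in> I \<Longrightarrow> i < n"
      using I(1) finite_nat_set_iff_bounded[of I] by blast
    define arr where "arr h p = \<beta> ((if fst (snd p) then snd else fst) (h (fst p))) (snd (snd p))"
      for h :: "nat \<Rightarrow> bool list \<times> bool list" and p :: "nat \<times> bool \<times> nat"
    \<comment> \<open>The colour of a node is its class over the earlier entries; the value
      \<open>{}\<close> where the bound fails keeps the range finite.\<close>
    define f where "f h i d \<eta> = (if 0 < i \<and> bounded (fst d) (fst (snd d)) (\<lambda>p. arr h (below i p))
        then cls (fst d) (\<lambda>p. arr h (below i p)) (\<beta> \<eta>) else {})"
      for h i and d :: "(('m + nat) + (nat \<times> bool \<times> nat) \<Rightarrow> 'm) set \<times> nat \<times> nat" and \<eta>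
    define col where "col h i \<eta> = (\<lambda>d. (d, f h i d \<eta>)) ` \<Delta>" for h i \<eta>
    have fin_f: "finite (range (f h i d))" for h i d
    proof (cases "0 < i \<and> bounded (fst d) (fst (snd d)) (\<lambda>p. arr h (below i p))")
      case True
      then have "finite (range (cls (fst d) (\<lambda>p. arr h (below i p))))"
        unfolding finite_range_iff_bounded bounded_def by blast
      then show ?thesis using True by (auto simp: f_def elim!: finite_subset[rotated])
    next
      case False
      then have "f h i d = (\<lambda>\<eta>. {})" by (auto simp: f_def)
      then show ?thesis by simp
    qed
    have fin_col: "finite (range (col h i))" for h i
    proof (rule finite_subset)
      show "range (col h i) \<subseteq> Pow (SIGMA d:\<Delta>. range (f h i d))" by (auto simp: col_def)
      show "finite (Pow (SIGMA d:\<Delta>. range (f h i d)))" using \<Delta>(1) fin_f by simp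
    qed
    have adm_col: "col h i = col h' i" if "\<And>j. j < i \<Longrightarrow> h j = h' j" for h h' i
    proof (cases "0 < i")
      case True
      then have "(\<lambda>p. arr h (below i p)) = (\<lambda>p. arr h' (below i p))"
        using that by (auto simp: arr_def below_def)
      then have "f h i = f h' i" unfolding f_def by (simp only:)
      then show ?thesis unfolding col_def by (simp only:)
    qed (simp add: col_def[abs_def] f_def)
    have tree: "\<exists>h. (\<forall>i. col h i (fst (h i)) = col h i (snd (h i))) \<and>
      (\<forall>i j. i \<le> j \<longrightarrow> prefix (fst (h i)) (fst (h j))) \<and>
      (\<forall>i. length (fst (h i)) < length (fst (h (Suc i)))) \<and>
      (\<forall>i. \<exists>\<nu>. snd (h i) = \<nu> @ [True] \<and> prefix (\<nu> @ [False]) (fst (h i)))"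
      by (rule tree_array[OF fin_col]) (rule adm_col, blast)
    obtain h where h: "\<And>i. col h i (fst (h i)) = col h i (snd (h i))"
      "\<And>i j. i \<le> j \<Longrightarrow> prefix (fst (h i)) (fst (h j))"
      "\<And>i. length (fst (h i)) < length (fst (h (Suc i)))"
      "\<And>i. \<exists>\<nu>. snd (h i) = \<nu> @ [True] \<and> prefix (\<nu> @ [False]) (fst (h i))"
      using tree by metis
    \<comment> \<open>A branch through \<open>fst (h n)\<close>, where \<open>n\<close> exceeds
      every index in \<open>I\<close>; its values further out do not matter.\<close>
    define \<sigma> where "\<sigma> m = fst (h n) ! m" for m
    have path: "fst (h i) = map \<sigma> [0..<length (fst (h i))]" if i: "i < n" for i
    proof -
      obtain zs where zs: "fst (h n) = fst (h i) @ zs" using h(2)[of i n] i by (auto simp: prefix_def)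
      show ?thesis by (rule nth_equalityI) (simp_all add: \<sigma>_def zs nth_append)
    qed
    have len: "length (fst (h i)) < length (fst (h n))" if "i < n" for i
      using that h(3) lift_Suc_mono_less[of "\<lambda>i. length (fst (h i))"] by simp
    obtain x where x: "\<And>m. m < length (fst (h n)) \<Longrightarrow> \<Phi> x (\<beta> (map \<sigma> [0..<m]))"
      using branch by blast
    have x: "\<Phi> x (\<beta> (fst (h i)))" if "i < n" for i
      using x[OF len[OF that]] path[OF that] by simp
    define s where "s = case_sum (arr h) x"
    have sF: "(\<lambda>r. s (Inl (i, False, r))) = \<beta> (fst (h i))" and sT: "(\<lambda>r. s (Inl (i, True, r))) = \<beta> (snd (h i))" for i
      by (simp_all add: s_def arr_def)
    have "agree d s" if d: "d \<in> \<Delta>" for d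
    proof -
      obtain G N i where Gi: "d = (G, N, i)" "0 < i" using d \<Delta>(2) by (auto simp: X_def)
      have "(d, f h i d (fst (h i))) \<in> col h i (snd (h i))"
        using d unfolding h(1)[symmetric] by (auto simp: col_def)
      then have "f h i d (fst (h i)) = f h i d (snd (h i))" by (auto simp: col_def)
      then show ?thesis using Gi(2) unfolding agree_def Gi(1) prod.case sF sT
        by (auto simp: f_def s_def)
    qed
    moreover have "solves i s" if "i \<in> I" for i
      using x[OF n[OF that]] by (simp add: solves_def sF) (simp add: s_def)
    moreover have "apart p s" if pY: "p \<in> Y" for p
    proof -
      obtain i j where p: "p = (i, j)" "i < j" using pY by (auto simp: Y_def)
      obtain \<nu> where \<nu>: "snd (h i) = \<nu> @ [True]" "prefix (\<nu> @ [False]) (fst (h i))" using h(4) by blast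
      have "prefix (fst (h i)) (fst (h j))" using h(2) p(2) by simp
      with \<nu>(2) have "prefix (\<nu> @ [False]) (fst (h j))" by (rule prefix_order.trans)
      then show ?thesis using incons unfolding apart_def p(1) prod.case sF sT \<nu>(1) by blast
    qed
    moreover have "\<Q> \<subseteq> agree ` \<Delta> \<union> solves ` I \<union> apart ` Y"
      unfolding \<Delta>(3)[symmetric] I(2)[symmetric] using \<Q>(2) by auto
    ultimately have "\<forall>P\<in>\<Q>. P s" by auto
    then show "\<exists>s. \<forall>P\<in>\<Q>. P s" by blast
  qed
  then obtain s where s: "\<forall>P \<in> agree ` X \<union> solves ` UNIV \<union> apart ` Y. P s" by blast
  show ?thesis
  proof (intro exI[of _ "\<lambda>p. s (Inl p)"] exI[of _ "\<lambda>r. s (Inr r)"] conjI allI impI)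
    have "solves i s" for i using s by blast
    then show "\<Phi> (\<lambda>r. s (Inr r)) (\<lambda>r. s (Inl (i, False, r)))" for i by (simp add: solves_def)
    have "apart (i, j) s" if "i < j" for i j
    proof -
      have "(i, j) \<in> Y" using that by (simp add: Y_def)
      then show ?thesis using s by blast
    qed
    then show "\<not> (\<exists>x. \<Phi> x (\<lambda>r. s (Inl (i, True, r))) \<and> \<Phi> x (\<lambda>r. s (Inl (j, False, r))))" if "i < j" for i j
      using that unfolding apart_def by blast
    fix G :: "('m \<Rightarrow> 'm) \<Rightarrow> (nat \<Rightarrow> 'm) \<Rightarrow> bool" and i
    assume i: "0 < i" and G: "dfn ((\<lambda>p. s (Inl p)) ` {p. fst p < i}) (\<lambda>s. G (s \<circ> Inl) (s \<circ> Inr))"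
      and fin: "finite (range (\<lambda>y. {w. G w y}))"
    \<comment> \<open>The parameters are replaced by variables for the earlier entries, so that a
      condition in \<open>agree\<close> applies.\<close>
    let ?z = "\<lambda>p. s (Inl (below i p))"
    have "range ?z = (\<lambda>p. s (Inl p)) ` {p. fst p < i}"
      using i by (force simp: below_def)
    then have "dfn ({} \<union> range ?z) (\<lambda>s. G (s \<circ> Inl) (s \<circ> Inr))" using G by simp
    then obtain G' :: "(('m + nat) + (nat \<times> bool \<times> nat) \<Rightarrow> 'm) \<Rightarrow> bool" where
      G': "dfn {} G'" "\<And>a. G (a \<circ> Inl) (a \<circ> Inr) = G' (case_sum a ?z)"
      by (rule dfn_abstract) blast
    have GG: "{w. G w y} = cls (Collect G') ?z y" for y
      using G'(2)[of "case_sum w y" for w] by (simp add: cls_def comp_def)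
    obtain N where "bounded (Collect G') N ?z"
      using fin unfolding GG finite_range_iff_bounded bounded_def by blast
    moreover have "(Collect G', N, i) \<in> X" using G'(1) i by (simp add: X_def)
    then have "agree (Collect G', N, i) s" using s by blast
    ultimately show "{w. G w (\<lambda>r. s (Inl (i, False, r)))} = {w. G w (\<lambda>r. s (Inl (i, True, r)))}"
      unfolding GG by (simp add: agree_def)
  qed
qed

end

section \<open>The dichotomy\<close>

context monster
begin

text \<open>The set attached to \<open>y\<close> depends only on which admissible
  \<open>w \<circ> \<kappa>'\<close> satisfy \<open>H y\<close>. There are finitely many of these,
  because \<open>\<kappa>'\<close> maps into \<open>F\<close> and each \<open>w m\<close> with
  \<open>m\<close> in \<open>F\<close> has finitely many choices.\<close>

lemma finite_class_determined:
  fixes \<kappa>' :: "'m \<Rightarrow> 'm"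
  assumes "finite F" "\<And>m. m \<in> F \<Longrightarrow> finite (\<Theta> m)" "\<And>m. \<kappa>' m \<in> F"
  shows "finite (range (\<lambda>y. {w. (\<forall>m\<in>F. w m \<in> \<Theta> m) \<and> H y (w \<circ> \<kappa>')}))"
proof -
  let ?X = "(\<lambda>f. f \<circ> \<kappa>') ` {f. \<forall>m. (m \<in> F \<longrightarrow> f m \<in> (\<Union>m\<in>F. \<Theta> m)) \<and> (m \<notin> F \<longrightarrow> f m = undefined)}"
  have fin: "finite ?X"
    using assms(1,2) by (intro finite_imageI finite_set_of_finite_funs) auto
  have X: "w \<circ> \<kappa>' \<in> ?X" if "\<forall>m\<in>F. w m \<in> \<Theta> m" for w
  proof (rule image_eqI)
    show "w \<circ> \<kappa>' = (\<lambda>m. if m \<in> F then w m else undefined) \<circ> \<kappa>'" using assms(3) by auto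
  qed (use that in auto)
  have "range (\<lambda>y. {w. (\<forall>m\<in>F. w m \<in> \<Theta> m) \<and> H y (w \<circ> \<kappa>')}) \<subseteq>
      (\<lambda>Z. {w. (\<forall>m\<in>F. w m \<in> \<Theta> m) \<and> w \<circ> \<kappa>' \<in> Z}) ` Pow ?X"
  proof (rule image_subsetI)
    fix y
    show "{w. (\<forall>m\<in>F. w m \<in> \<Theta> m) \<and> H y (w \<circ> \<kappa>')} \<in>
        (\<lambda>Z. {w. (\<forall>m\<in>F. w m \<in> \<Theta> m) \<and> w \<circ> \<kappa>' \<in> Z}) ` Pow ?X"
      by (rule image_eqI[of _ _ "{x \<in> ?X. H y x}"]) (use X in auto)
  qed
  then show ?thesis by (rule finite_subset) (use fin in simp)
qed

lemma configuration_of_tree: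
  fixes \<beta> :: "bool list \<Rightarrow> nat \<Rightarrow> 'm"
  assumes \<Phi>: "dfn {} (\<lambda>s :: nat + nat \<Rightarrow> 'm. \<Phi> (s \<circ> Inl) (s \<circ> Inr))"
    and branch: "\<And>\<sigma> n. \<exists>x. \<forall>m<n. \<Phi> x (\<beta> (map \<sigma> [0..<m]))"
    and incons: "\<forall>\<eta>1 \<eta>2. prefix (\<eta>1 @ [False]) \<eta>2 \<longrightarrow> \<not> (\<exists>x. \<Phi> x (\<beta> \<eta>2) \<and> \<Phi> x (\<beta> (\<eta>1 @ [True])))"
  obtains C g a b where "sm C" "alg_closed L M C" "g \<in> aut C" "\<Phi> a b"
    "\<not> (\<exists>x. \<Phi> x b \<and> \<Phi> x (g \<circ> b))"
    "acl L M (C \<union> range b) \<inter> acl L M (C \<union> range a) = C"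
    "acl L M (C \<union> range b) \<inter> acl L M (C \<union> range (g \<circ> b)) = C"
proof -
  from array_of_tree[where \<Phi> = \<Phi> and \<beta> = \<beta>, OF \<Phi> branch incons]
  obtain c :: "nat \<times> bool \<times> nat \<Rightarrow> 'm" and a where c:
    "(\<forall>i. \<Phi> a (\<lambda>r. c (i, False, r))) \<and>
    (\<forall>i j. i < j \<longrightarrow> \<not> (\<exists>x. \<Phi> x (\<lambda>r. c (i, True, r)) \<and> \<Phi> x (\<lambda>r. c (j, False, r)))) \<and>
    (\<forall>(G :: ('m \<Rightarrow> 'm) \<Rightarrow> (nat \<Rightarrow> 'm) \<Rightarrow> bool) i. 0 < i \<longrightarrow>
      dfn (c ` {p. fst p < i}) (\<lambda>s. G (s \<circ> Inl) (s \<circ> Inr)) \<longrightarrow> finite (range (\<lambda>y. {w. G w y})) \<longrightarrow>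
      {w. G w (\<lambda>r. c (i, False, r))} = {w. G w (\<lambda>r. c (i, True, r))})"
    by (elim exE) (rule that)
  note solves = c[THEN conjunct1, rule_format]
    and apart = c[THEN conjunct2, THEN conjunct1, rule_format]
    and agree = c[THEN conjunct2, THEN conjunct2, rule_format]
  define c0 c1 where "c0 i = (\<lambda>r. c (i, False, r))" and "c1 i = (\<lambda>r. c (i, True, r))" for i
  define C where "C = acl L M (range c)"
  have C: "sm C" "alg_closed L M C" unfolding C_def using small_acl alg_closed_acl small_range by auto
  have cC: "range (c0 i) \<subseteq> C" "range (c1 i) \<subseteq> C" for i
    using acl_extensive[of "range c"] by (auto simp: c0_def c1_def C_def)
  have initial: "\<exists>n. dfn (c ` {p. fst p < n}) P" if P: "dfn (range c) P" for P :: "('i \<Rightarrow> 'm) \<Rightarrow> bool"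
  proof -
    obtain F where F: "finite F" "F \<subseteq> range c" "dfn F P" using dfn_finite_params[OF P] by blast
    obtain Q where Q: "finite Q" "F = c ` Q" using finite_subset_image[OF F(1,2)] by blast
    obtain n where "\<forall>i\<in>fst ` Q. i < n" using Q(1) finite_nat_set_iff_bounded[of "fst ` Q"] by auto
    then have "F \<subseteq> c ` {p. fst p < n}" unfolding Q(2) by auto
    then show ?thesis using dfn_mono[OF F(3)] by blast
  qed
  \<comment> \<open>The algebraic parameters \<open>F\<close> of \<open>P\<close> become variables
    \<open>w\<close> confined to finite solution sets \<open>T m\<close> over the array. The set of
    all \<open>w\<close> with \<open>H w y\<close> then takes finitely many values, so
    \<open>agree\<close> applies from some index on; \<open>w = id\<close> gives back
    \<open>P\<close>.\<close>
  have agree_C: "\<forall>\<^sub>F i in sequentially. P (c0 i) = P (c1 i)" if P: "dfn C P" for P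
  proof -
    obtain F0 where F0: "finite F0" "F0 \<subseteq> C" "dfn F0 P" using dfn_finite_params[OF P] by blast
    \<comment> \<open>A default value for \<open>\<rho>\<close> that keeps \<open>F\<close>
      nonempty.\<close>
    define m0 where "m0 = c (0, False, 0)"
    have m0: "m0 \<in> C" using acl_extensive[of "range c"] by (auto simp: m0_def C_def)
    define F where "F = insert m0 F0"
    have F: "finite F" "F \<subseteq> C" "dfn F P" using F0 m0 dfn_mono[OF F0(3), of F] by (auto simp: F_def)
    define \<rho> where "\<rho> m = (if m \<in> F then m else m0)" for m
    have \<rho>: "\<rho> m \<in> F" for m by (simp add: \<rho>_def F_def)
    have "range \<rho> = F" using \<rho> by (force simp: \<rho>_def F_def)
    then have "dfn ({} \<union> range \<rho>) P" using F(3) by simp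
    then obtain G :: "(nat + 'm \<Rightarrow> 'm) \<Rightarrow> bool" where G: "dfn {} G" "\<And>a. P a = G (case_sum a \<rho>)"
      by (rule dfn_abstract) blast
    have "\<exists>T. dfn1 (range c) T \<and> T m \<and> finite {d. T d}" if "m \<in> F" for m
      using that F(2) unfolding C_def using acl_iff[of m "range c"] by auto
    then obtain T where T: "\<And>m. m \<in> F \<Longrightarrow> dfn1 (range c) (T m) \<and> T m m \<and> finite {d. T m d}"
      by metis
    define H where "H w y \<longleftrightarrow> (\<forall>m\<in>F. w m \<in> {d. T m d}) \<and> G (case_sum y (w \<circ> \<rho>))"
      for w :: "'m \<Rightarrow> 'm" and y :: "nat \<Rightarrow> 'm"
    have "dfn (range c) (\<lambda>s :: 'm + nat \<Rightarrow> 'm. H (s \<circ> Inl) (s \<circ> Inr))"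
    proof -
      have "dfn (range c) (\<lambda>s :: 'm + nat \<Rightarrow> 'm. T m (s (Inl m)))" if "m \<in> F" for m
        using dfn_reindex[of "range c" "\<lambda>a. T m (a ())" "\<lambda>_. Inl m"] T[OF that] by blast
      then have "dfn (range c) (\<lambda>s :: 'm + nat \<Rightarrow> 'm. \<forall>m\<in>F. T m (s (Inl m)))"
        by (rule dfn_all_finite[OF F(1)])
      moreover have "dfn (range c) (\<lambda>s :: 'm + nat \<Rightarrow> 'm. G (\<lambda>i. s (case_sum Inr (\<lambda>m. Inl (\<rho> m)) i)))"
        by (rule dfn_mono[OF dfn_reindex[OF G(1)]]) simp
      moreover have "(\<lambda>i. s (case_sum Inr (\<lambda>m. Inl (\<rho> m)) i)) = case_sum (s \<circ> Inr) ((s \<circ> Inl) \<circ> \<rho>)"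
        for s :: "'m + nat \<Rightarrow> 'm"
        by (auto split: sum.splits)
      ultimately show ?thesis unfolding H_def by (simp add: dfn_conj)
    qed
    then obtain n where n: "dfn (c ` {p. fst p < n}) (\<lambda>s :: 'm + nat \<Rightarrow> 'm. H (s \<circ> Inl) (s \<circ> Inr))"
      using initial by blast
    have "finite (range (\<lambda>y. {w. H w y}))"
      unfolding H_def by (rule finite_class_determined[OF F(1) _ \<rho>]) (use T in auto)
    then have "{w. H w (c0 i)} = {w. H w (c1 i)}" if "i \<ge> Suc n" for i
      unfolding c0_def c1_def by (intro agree dfn_mono[OF n]) (use that in auto)
    then have "H id (c0 i) = H id (c1 i)" if "i \<ge> Suc n" for i
      using that by (auto simp: set_eq_iff)
    moreover have "H id y = P y" for y
      using T by (auto simp: H_def G(2) comp_def)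
    ultimately show ?thesis by (auto simp: eventually_sequentially)
  qed
  \<comment> \<open>The limit \<open>b\<close> satisfies everything over \<open>C\<close> and
    \<open>a\<close> that holds eventually along \<open>c0\<close>.\<close>
  have "\<exists>b. \<forall>P\<in>{P. dfn (C \<union> range a) P \<and> (\<forall>\<^sub>F i in sequentially. P (c0 i))}. P b"
  proof (rule realise_tuple[of "C \<union> range a"])
    show "sm (C \<union> range a)" by (intro small_Un C(1) small_range)
    fix \<Q> assume "finite \<Q>" "\<Q> \<subseteq> {P. dfn (C \<union> range a) P \<and> (\<forall>\<^sub>F i in sequentially. P (c0 i))}"
    then have "\<forall>\<^sub>F i in sequentially. \<forall>P\<in>\<Q>. P (c0 i)" by (intro eventually_ball_finite) auto
    then show "\<exists>y. \<forall>P\<in>\<Q>. P y" by (auto simp: eventually_sequentially)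
  qed auto
  then obtain b where b: "\<And>P. dfn (C \<union> range a) P \<Longrightarrow> \<forall>\<^sub>F i in sequentially. P (c0 i) \<Longrightarrow> P b"
    by blast
  \<comment> \<open>Otherwise the negation would hold eventually and pass to \<open>b\<close>. As
    the \<open>c0 i\<close> lie in \<open>C\<close>, this gives finite satisfiability in
    \<open>C\<close>.\<close>
  have b_freq: "\<exists>\<^sub>F i in sequentially. P (c0 i)" if "dfn (C \<union> range a) P" "P b" for P
    using b[OF dfn_neg[OF that(1)]] that(2) by (auto simp: frequently_def)
  \<comment> \<open>\<open>d\<close> is to have the type of \<open>b\<close> over \<open>C\<close>
    and to be a limit of \<open>c1\<close> over \<open>b\<close>. A formula over \<open>C\<close>
    true of \<open>b\<close> holds infinitely often along \<open>c0\<close>, so by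
    \<open>agree_C\<close> also along \<open>c1\<close>, which reconciles the two demands.\<close>
  have "\<exists>d. \<forall>P\<in>{P. dfn C P \<and> P b} \<union> {P. dfn (C \<union> range b) P \<and> (\<forall>\<^sub>F i in sequentially. P (c1 i))}. P d"
  proof (rule realise_tuple[of "C \<union> range b"])
    show "sm (C \<union> range b)" by (intro small_Un C(1) small_range)
    show "dfn (C \<union> range b) P" if "P \<in> {P. dfn C P \<and> P b} \<union>
        {P. dfn (C \<union> range b) P \<and> (\<forall>\<^sub>F i in sequentially. P (c1 i))}" for P
      using that dfn_mono[of C P "C \<union> range b"] by auto
    fix \<Q> assume \<Q>: "finite \<Q>" "\<Q> \<subseteq> {P. dfn C P \<and> P b} \<union>
        {P. dfn (C \<union> range b) P \<and> (\<forall>\<^sub>F i in sequentially. P (c1 i))}"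
    define \<Q>1 where "\<Q>1 = {P \<in> \<Q>. dfn C P \<and> P b}"
    have d: "dfn C (\<lambda>y. \<forall>P\<in>\<Q>1. P y)"
      using \<Q>(1) by (intro dfn_all_finite) (auto simp: \<Q>1_def)
    have "\<exists>\<^sub>F i in sequentially. \<forall>P\<in>\<Q>1. P (c0 i)"
      by (rule b_freq[OF dfn_mono[OF d]]) (auto simp: \<Q>1_def)
    moreover have "\<forall>\<^sub>F i in sequentially. (\<forall>P\<in>\<Q>1. P (c0 i)) = (\<forall>P\<in>\<Q>1. P (c1 i))"
      by (rule agree_C[OF d])
    moreover have "\<forall>\<^sub>F i in sequentially. \<forall>P\<in>\<Q> - \<Q>1. P (c1 i)"
      using \<Q> by (intro eventually_ball_finite) (auto simp: \<Q>1_def)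
    ultimately have "\<exists>\<^sub>F i in sequentially. ((\<forall>P\<in>\<Q>1. P (c0 i)) = (\<forall>P\<in>\<Q>1. P (c1 i)) \<and>
        (\<forall>P\<in>\<Q> - \<Q>1. P (c1 i))) \<and> (\<forall>P\<in>\<Q>1. P (c0 i))"
      by (intro frequently_eventually_conj eventually_conj)
    then obtain i where i: "((\<forall>P\<in>\<Q>1. P (c0 i)) = (\<forall>P\<in>\<Q>1. P (c1 i)) \<and>
        (\<forall>P\<in>\<Q> - \<Q>1. P (c1 i))) \<and> (\<forall>P\<in>\<Q>1. P (c0 i))"
      by (rule frequentlyE)
    have "\<forall>P\<in>\<Q>1. P (c1 i)"
      by (rule iffD1[OF i[THEN conjunct1, THEN conjunct1] i[THEN conjunct2]])
    then have "P (c1 i)" if "P \<in> \<Q>" for P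
      using i[THEN conjunct1, THEN conjunct2, THEN bspec, of P] that by (cases "P \<in> \<Q>1") auto
    then show "\<exists>y. \<forall>P\<in>\<Q>. P y" by (intro exI ballI)
  qed
  then obtain d where dP: "\<forall>P\<in>{P. dfn C P \<and> P b} \<union>
      {P. dfn (C \<union> range b) P \<and> (\<forall>\<^sub>F i in sequentially. P (c1 i))}. P d"
    by (rule exE)
  have d: "P d" if "dfn C P" "P b" for P using dP[THEN bspec, of P] that by simp
  have d': "P d" if "dfn (C \<union> range b) P" "\<forall>\<^sub>F i in sequentially. P (c1 i)" for P
    using dP[THEN bspec, of P] that by simp
  have d_freq: "\<exists>\<^sub>F i in sequentially. P (c1 i)" if "dfn (C \<union> range b) P" "P d" for P
    using d'[OF dfn_neg[OF that(1)]] that(2) by (auto simp: frequently_def)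
  have "\<exists>g\<in>aut C. g \<circ> b = d" by (rule homogeneous[OF C(1)]) (rule d)
  then obtain g where g: "g \<in> aut C" "g \<circ> b = d" by blast
  have \<Phi>': "dfn {} (\<lambda>s :: nat + nat \<Rightarrow> 'm. \<Phi> (s \<circ> Inr) (s \<circ> Inl))"
    using dfn_binary[OF \<Phi>, of Inr Inl] by (simp add: comp_def)
  have \<Psi>: "dfn {} (\<lambda>s :: nat + nat \<Rightarrow> 'm. \<exists>x. \<Phi> x (s \<circ> Inl) \<and> \<Phi> x (s \<circ> Inr))"
    by (rule dfn_common[OF \<Phi>])
  have "\<Phi> a b"
  proof (rule b[of "\<lambda>y. \<Phi> a y"])
    show "dfn (C \<union> range a) (\<lambda>y. \<Phi> a y)"
      by (rule dfn_binary_param[where \<Phi> = "\<lambda>x y. \<Phi> y x", OF \<Phi>']) simp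
  qed (use solves in \<open>simp add: c0_def\<close>)
  \<comment> \<open>The limits are taken in turn: first \<open>c0 j\<close> tends to
    \<open>b\<close> with \<open>c1 i\<close> fixed, then \<open>c1 i\<close> tends to
    \<open>d\<close> with \<open>b\<close> as a parameter.\<close>
  moreover have c1b: "\<not> (\<exists>x. \<Phi> x b \<and> \<Phi> x (c1 i))" for i
  proof (rule b[of "\<lambda>y. \<not> (\<exists>x. \<Phi> x y \<and> \<Phi> x (c1 i))"])
    show "dfn (C \<union> range a) (\<lambda>y. \<not> (\<exists>x. \<Phi> x y \<and> \<Phi> x (c1 i)))"
      by (rule dfn_neg[OF dfn_binary_param[where \<Phi> = "\<lambda>y z. \<exists>x. \<Phi> x y \<and> \<Phi> x z", OF \<Psi>]]) (use cC(2) in blast)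
    show "\<forall>\<^sub>F j in sequentially. \<not> (\<exists>x. \<Phi> x (c0 j) \<and> \<Phi> x (c1 i))"
      unfolding eventually_sequentially c0_def c1_def using apart by (meson Suc_le_lessD)
  qed
  have "\<not> (\<exists>x. \<Phi> x d \<and> \<Phi> x b)"
  proof (rule d'[of "\<lambda>y. \<not> (\<exists>x. \<Phi> x y \<and> \<Phi> x b)"])
    show "dfn (C \<union> range b) (\<lambda>y. \<not> (\<exists>x. \<Phi> x y \<and> \<Phi> x b))"
      by (rule dfn_neg[OF dfn_binary_param[where \<Phi> = "\<lambda>y z. \<exists>x. \<Phi> x y \<and> \<Phi> x z", OF \<Psi>]]) simp
    show "\<forall>\<^sub>F j in sequentially. \<not> (\<exists>x. \<Phi> x (c1 j) \<and> \<Phi> x b)"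
      using c1b by (intro always_eventually) blast
  qed
  then have "\<not> (\<exists>x. \<Phi> x b \<and> \<Phi> x (g \<circ> b))" unfolding g(2) by blast
  moreover have "acl L M (C \<union> range b) \<inter> acl L M (C \<union> range a) = C"
  proof (rule acl_Int_of_finitely_satisfiable[OF C(2)])
    fix P assume "dfn (C \<union> range a) P" "P b"
    then obtain i where "P (c0 i)" using b_freq frequently_ex by blast
    then show "\<exists>z. range z \<subseteq> C \<and> P z" using cC(1) by blast
  qed
  moreover have "acl L M (C \<union> range d) \<inter> acl L M (C \<union> range b) = C"
  proof (rule acl_Int_of_finitely_satisfiable[OF C(2)])
    fix P assume "dfn (C \<union> range b) P" "P d"
    then obtain i where "P (c1 i)" using d_freq frequently_ex by blast
    then show "\<exists>z. range z \<subseteq> C \<and> P z" using cC(2) by blast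
  qed
  ultimately show ?thesis using C g by (intro that) (auto simp: Int_commute)
qed

end

lemma (in free_amalgamation) SOP3_if_SOP1:
  assumes "SOP1 L M"
  shows "SOP3 L M"
proof -
  obtain \<phi> k l and t :: "bool list \<Rightarrow> 'm list" where \<phi>: "\<phi> \<in> formulas L"
    and path: "\<And>\<sigma> :: nat \<Rightarrow> bool. consistent M {subst_params k \<phi> (t (map \<sigma> [0..<n])) | n. True}"
    and side: "\<And>\<eta>1 \<eta>2. prefix (\<eta>1 @ [False]) \<eta>2 \<Longrightarrow>
      \<not> consistent M {subst_params k \<phi> (t \<eta>2), subst_params k \<phi> (t (\<eta>1 @ [True]))}"
    using assms unfolding SOP1_def by blast
  \<comment> \<open>The formula read on infinite sequences, of which it sees finitely many
    coordinates; this allows one index type for all tuples.\<close>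
  define \<Phi> where "\<Phi> x y \<longleftrightarrow> sat M (\<lambda>v. if v < k then x v else y (v - k)) \<phi>" for x y :: "nat \<Rightarrow> 'm"
  define \<beta> where "\<beta> \<eta> = (\<lambda>r. t \<eta> ! r)" for \<eta>
  have psat: "psat M x (subst_params k \<phi> (t \<eta>)) = \<Phi> x (\<beta> \<eta>)" for x \<eta>
    unfolding psat_def subst_params_def \<Phi>_def fst_conv snd_conv by (rule sat_cong) (auto simp: \<beta>_def)
  have d\<Phi>: "dfn {} (\<lambda>s :: nat + nat \<Rightarrow> 'm. \<Phi> (s \<circ> Inl) (s \<circ> Inr))"
  proof (rule dfnI[of \<phi> "\<lambda>v. Inl (if v < k then Inl v else Inr (v - k))"])
    show "wff L \<phi>" using \<phi> by (simp add: formulas_def)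
    show "\<Phi> (s \<circ> Inl) (s \<circ> Inr) \<longleftrightarrow> sat M (case_sum s id \<circ> (\<lambda>v. Inl (if v < k then Inl v else Inr (v - k)))) \<phi>"
      for s :: "nat + nat \<Rightarrow> 'm"
      unfolding \<Phi>_def by (rule sat_cong) auto
  qed auto
  have branch: "\<exists>x. \<forall>m<n. \<Phi> x (\<beta> (map \<sigma> [0..<m]))" for \<sigma> :: "nat \<Rightarrow> bool" and n
  proof -
    let ?\<Sigma> = "(\<lambda>m. subst_params k \<phi> (t (map \<sigma> [0..<m]))) ` {..<n}"
    have "finite ?\<Sigma>" "?\<Sigma> \<subseteq> {subst_params k \<phi> (t (map \<sigma> [0..<n])) | n. True}" by auto
    then obtain x where "\<forall>p\<in>?\<Sigma>. psat M x p" using path[of \<sigma>] unfolding consistent_def by meson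
    then show ?thesis using psat by (intro exI[of _ x]) auto
  qed
  have incons: "\<forall>\<eta>1 \<eta>2. prefix (\<eta>1 @ [False]) \<eta>2 \<longrightarrow> \<not> (\<exists>x. \<Phi> x (\<beta> \<eta>2) \<and> \<Phi> x (\<beta> (\<eta>1 @ [True])))"
  proof (intro allI impI notI)
    fix \<eta>1 \<eta>2 :: "bool list" assume pre: "prefix (\<eta>1 @ [False]) \<eta>2"
    assume "\<exists>x. \<Phi> x (\<beta> \<eta>2) \<and> \<Phi> x (\<beta> (\<eta>1 @ [True]))"
    then obtain x where "psat M x (subst_params k \<phi> (t \<eta>2))" "psat M x (subst_params k \<phi> (t (\<eta>1 @ [True])))"
      by (auto simp: psat)
    then have "\<forall>p\<in>{subst_params k \<phi> (t \<eta>2), subst_params k \<phi> (t (\<eta>1 @ [True]))}. psat M x p" by simp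
    then have "consistent M {subst_params k \<phi> (t \<eta>2), subst_params k \<phi> (t (\<eta>1 @ [True]))}"
      unfolding consistent_def by blast
    then show False using side[OF pre] by blast
  qed
  obtain C g a b where C: "sm C" "alg_closed L M C" and g: "g \<in> aut C" and ab: "\<Phi> a b"
    "\<not> (\<exists>x. \<Phi> x b \<and> \<Phi> x (g \<circ> b))"
    and I: "acl L M (C \<union> range b) \<inter> acl L M (C \<union> range a) = C"
    "acl L M (C \<union> range b) \<inter> acl L M (C \<union> range (g \<circ> b)) = C"
    by (rule configuration_of_tree[where \<Phi> = \<Phi> and \<beta> = \<beta>, OF d\<Phi> branch incons])
  define A where "A = acl L M (C \<union> range a)"
  define B where "B = acl L M (C \<union> range b)"
  have sm: "sm (C \<union> range x)" for x :: "nat \<Rightarrow> 'm" by (intro small_Un C(1) small_range)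
  have A: "sm A" "alg_closed L M A" and B: "sm B" "alg_closed L M B"
    unfolding A_def B_def using small_acl[OF sm] alg_closed_acl[OF sm] by auto
  have sub: "C \<subseteq> B" "range a \<subseteq> A" "range b \<subseteq> B"
    using acl_extensive[of "C \<union> range a"] acl_extensive[of "C \<union> range b"] by (auto simp: A_def B_def)
  interpret free_copies L M T \<kappa> R B C
    by unfold_locales (use B C sub in auto)
  \<comment> \<open>\<open>g B\<close> is the closure of \<open>C\<close> and
    \<open>g \<circ> b\<close>, so the second intersection reads
    \<open>B \<inter> g B = C\<close>.\<close>
  have "g ` (C \<union> range b) = C \<union> range (g \<circ> b)"
    using aut_image[OF g, of C] by (simp add: image_Un image_comp)
  then have "g ` B = acl L M (C \<union> range (g \<circ> b))"
    using acl_image[of g "C \<union> range b"] g by (simp add: aut_def B_def)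
  then show ?thesis
    using SOP3_of_configuration[OF d\<Phi> A _ g _ sub(2,3) ab] I by (simp add: A_def B_def Int_commute)
qed

theorem theorem4p2:
  fixes L :: "('f, 'r) lang"
    and T :: "('f, 'r) fm set"
    and \<kappa> :: "'k rel"
    and M :: "('f, 'r, 'm) struct"
  assumes "monster_model L T \<kappa> M"
    and "free_amalgamation_theory L T \<kappa> M"
  shows "NSOP1 L M \<or> SOP3 L M"
proof -
  obtain R where "invariance L \<kappa> M R" "monotonicity \<kappa> R" "full_existence L \<kappa> M R"
    "stationarity L \<kappa> M R" "freedom \<kappa> R" "indep_closure L \<kappa> M R"
    using assms(2) unfolding free_amalgamation_theory_def by blast
  then interpret free_amalgamation L M T \<kappa> R
    using assms(1) by unfold_locales
  show ?thesis using SOP3_if_SOP1 unfolding NSOP1_def by blast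
qed

end
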